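(* Let $\Lambda=\bigcup_{l=1}^2\big((t_0,\omega_0)+a\mathbb{Z}^{\nu}(\sin\theta_l,\cos\theta_l)\big)$, where $a$ and $\nu$ are positive numbers, $\theta_1,\theta_2\in[0,2\pi]$ and $(t_0,\omega_0)\in\mathbb{R}^2$. If $(\theta_1-\theta_2)/\pi\notin\mathbb{Q}$ and either $\nu<1/2$, or $\nu=1/2$ with $a<1$, then $\Lambda$ does Gabor phase retrieval. Moreover, $\Lambda$ does not do Gabor phase retrieval if one of the following conditions is satisfied: (i) $(\theta_1-\theta_2)/\pi\in\mathbb{Q}$; (ii) $\nu>1/2$; (iii) $\nu=1/2$, $a>1$ and $|\cos(\theta_1-\theta_2)|>1/a^2$; (iv) $\nu=1/2$, $a>1$ and $|\sin(\theta_1-\theta_2)|>1/a^2$; (v) $\nu=1/2$, $a>1$ and $|\sin(2\theta_1-2\theta_2)|>1/a^2$.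
   Context: Let $\varphi(x)=e^{-\pi x^2}$, $x\in\mathbb{R}$. For $f\in L^2(\mathbb{R})$ the Gabor transform is $V_\varphi f(t,\omega)=\int_{\mathbb{R}} f(x)\varphi(x-t)e^{-2\pi i x\omega}\,dx$, $(t,\omega)\in\mathbb{R}^2$. A set $\Lambda\subset\mathbb{R}^2$ does Gabor phase retrieval if, for all $f_1,f_2\in L^2(\mathbb{R})$, the condition $|V_\varphi f_1(t,\omega)|=|V_\varphi f_2(t,\omega)|$ for all $(t,\omega)\in\Lambda$ implies that there is a real constant $\alpha$ with $f_1=e^{i\alpha}f_2$ almost everywhere. For $\nu>0$, $\mathbb{Z}^{\nu}:=\{\pm n^{\nu}: n\ge 0,\ n\in\mathbb{Z}\}$; for $a,\nu>0$ and $\theta\in[0,2\pi]$, $a\mathbb{Z}^{\nu}(\sin\theta,\cos\theta):=\{(\lambda\sin\theta,\lambda\cos\theta):\lambda\in a\mathbb{Z}^{\nu}\}$. *)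

theory Defs
  imports "HOL-Analysis.Analysis"
begin

definition gaussian :: "real \<Rightarrow> real" where
  "gaussian x = exp (- pi * x\<^sup>2)"

(* Representatives of the elements of the complex space L2(R). No quotient is formed;
   equality almost everywhere appears explicitly where it matters. *)
definition L2_real :: "(real \<Rightarrow> complex) set" where
  "L2_real = {f. f \<in> borel_measurable lebesgue \<and> integrable lebesgue (\<lambda>x. (norm (f x))\<^sup>2)}"

(* For f in L2_real the integrand is integrable (product of two L2 functions). *)
definition gabor_transform :: "(real \<Rightarrow> complex) \<Rightarrow> real \<Rightarrow> real \<Rightarrow> complex" where
  "gabor_transform f t \<omega> =
     (LINT x|lebesgue. f x * complex_of_real (gaussian (x - t)) *
        exp (- (2 * complex_of_real pi * \<i> * complex_of_real x * complex_of_real \<omega>)))"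

definition does_gabor_phase_retrieval :: "(real \<times> real) set \<Rightarrow> bool" where
  "does_gabor_phase_retrieval \<Lambda> \<longleftrightarrow>
     (\<forall>f1\<in>L2_real. \<forall>f2\<in>L2_real.
        (\<forall>(t, \<omega>)\<in>\<Lambda>. norm (gabor_transform f1 t \<omega>) = norm (gabor_transform f2 t \<omega>)) \<longrightarrow>
        (\<exists>\<alpha>::real. AE x in lebesgue. f1 x = exp (\<i> * complex_of_real \<alpha>) * f2 x))"

(* For \<nu> > 0 the convention 0 powr \<nu> = 0 is the ordinary value. *)
definition int_powers :: "real \<Rightarrow> real set" where
  "int_powers \<nu> = {x. \<exists>n::nat. x = real n powr \<nu> \<or> x = - (real n powr \<nu>)}"

definition line_samples :: "real \<Rightarrow> real \<Rightarrow> real \<Rightarrow> (real \<times> real) set" where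
  "line_samples a \<nu> \<theta> = (\<lambda>x. (x * sin \<theta>, x * cos \<theta>)) ` ((\<lambda>x. a * x) ` int_powers \<nu>)"

end

theory Submission
  imports Defs "HOL-Probability.Probability" "HOL-Complex_Analysis.Complex_Analysis"
begin

text \<open>
  With \<open>w = t - \<i> \<omega>\<close> the Gabor transform of \<open>f\<close> has modulus \<open>exp (- pi/2 |w|\<^sup>2) |F w|\<close>, where \<open>F\<close> is the
  Bargmann transform of \<open>f\<close>, an entire function with \<open>|F w| \<le> C exp (pi/2 |w|\<^sup>2)\<close>. A time-frequency shift
  moves \<open>(t0, \<omega>0)\<close> to the origin, so that the samples lie on two lines through \<open>0\<close>.

  Uniqueness: on a line in direction \<open>u\<close> the difference of \<open>F (z u) * cnj (F (cnj z * u))\<close> for the two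
  functions is entire of order two and type at most \<open>pi\<close>, and vanishes at \<open>a n\<^bsup>\<nu>\<^esup>\<close> and \<open>- a n\<^bsup>\<nu>\<^esup>\<close>. If \<open>\<nu> < 1/2\<close> it has too many
  zeros for its growth; if \<open>\<nu> = 1/2\<close> and \<open>a < 1\<close>, Carlson's theorem in the variable \<open>z\<^sup>2\<close> applies. So the moduli
  agree on both lines, and the quotient of the two Bargmann transforms is invariant under the rotation by
  \<open>2 (\<theta> 1 - \<theta> 2)\<close>, which forces it to be a unimodular constant when the angle is irrational.

  Counterexamples: every \<open>K (w\<^sup>2)\<close> with \<open>K\<close> entire of exponential type below \<open>pi/2\<close> is the Bargmann
  transform of a superposition of chirps. The pairs used are \<open>s\<^sup>q \<plusminus> \<i>\<close> (up to a rotation of \<open>s\<close>) for a rational angle,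
  \<open>1 + \<Phi>\<close> and \<open>1\<close> with \<open>\<Phi>\<close> vanishing at all squared samples for \<open>\<nu> > 1/2\<close>, and
  \<open>exp (\<delta> s / 2) \<plusminus> \<i> exp (- \<delta> s / 2)\<close> with a suitable \<open>|\<delta>| < pi\<close> for \<open>\<nu> = 1/2\<close>.
\<close>

section \<open>Parameter integrals and the complex Gaussian\<close>

text \<open>The squared modulus of \<open>F\<close> on a line is not holomorphic;
  \<open>F (z u) * cnj (F (cnj z * u))\<close> is an entire function that agrees with it at real
  \<open>z\<close>, at the price of doubling the growth rate from \<open>pi / 2\<close> to
  \<open>pi\<close>. For \<nu> = 1/2, read in \<open>z\<^sup>2\<close> and rescaled, it has its
  zeros at the integers and type \<open>pi * a\<^sup>2\<close>, so Carlson's bound \<open>pi\<close>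
  is the threshold a < 1. In the other direction squaring merges opposite samples: the two lines
  become two rays at angle \<open>2 * (\<theta> 1 - \<theta> 2)\<close> with moduli
  \<open>a\<^sup>2 * n powr (2 * \<nu>)\<close>, whose reciprocals are summable for \<nu> > 1/2. For
  \<nu> = 1/2, \<open>A + \<i> * B\<close> and \<open>A - \<i> * B\<close> have equal moduli where
  \<open>A * cnj B\<close> is real; for the two exponentials this means that
  \<open>Im (\<delta> * s)\<close> is a multiple of \<open>pi\<close>. At a sample it is, up to
  sign, \<open>a\<^sup>2 * n * norm \<delta>\<close> times a sine. If both sines lie in {0, S, -S},
  the choice \<open>norm \<delta> = pi / (a\<^sup>2 * \<bar>S\<bar>)\<close> works, and
  \<open>norm \<delta> < pi\<close>, the range in which the chirps are square integrable, is the
  condition \<open>\<bar>S\<bar> > 1 / a\<^sup>2\<close>. The three sine and cosine conditions are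
  three choices of the argument of \<delta>.\<close>

lemma holomorphic_on_lebesgue_integral:
  fixes f :: "complex \<Rightarrow> 'a \<Rightarrow> complex"
  assumes S: "open S"
    and meas: "\<And>z. z \<in> S \<Longrightarrow> f z \<in> borel_measurable M"
    and hol: "\<And>x. (\<lambda>z. f z x) holomorphic_on S"
    and dom: "\<And>z. z \<in> S \<Longrightarrow> \<exists>r>0. \<exists>g. integrable M g \<and> (\<forall>w\<in>ball z r. \<forall>x. norm (f w x) \<le> g x)"
  shows "(\<lambda>z. integral\<^sup>L M (f z)) holomorphic_on S"
proof -
  have "(\<lambda>z. integral\<^sup>L M (f z)) field_differentiable at z" if z: "z \<in> S" for z
  proof -
    obtain r1 g where r1: "r1 > 0" and g: "integrable M g"
      and le1: "\<And>w x. w \<in> ball z r1 \<Longrightarrow> norm (f w x) \<le> g x"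
      using dom[OF z] by blast
    obtain r2 where r2: "r2 > 0" "ball z r2 \<subseteq> S" using S z openE by blast
    define r where "r = min r1 r2"
    have r: "r > 0" "ball z r \<subseteq> S" and le: "\<And>w x. w \<in> ball z r \<Longrightarrow> norm (f w x) \<le> g x"
      using r1 r2 le1 by (auto simp: r_def)
    define B where "B = ball z (r/2)"
    have B: "open B" "z \<in> B" "B \<subseteq> S" "B \<subseteq> ball z r" "convex B"
      using r by (auto simp: B_def)
    \<comment> \<open>Cauchy's estimate turns the bound on the integrand into one on its derivative.
      Circles of radius \<open>s < r/2\<close> about \<open>u\<close> stay inside
      \<open>ball z r\<close>; letting \<open>s\<close> tend to \<open>r/2\<close> gives the stated
      constant.\<close>
    have dbound: "norm (deriv (\<lambda>z. f z x) u) \<le> g x / (r/2)" if u: "u \<in> B" for u x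
    proof -
      have sub: "ball u (r/2) \<subseteq> ball z r"
      proof
        fix v assume "v \<in> ball u (r/2)"
        with u dist_triangle[of z v u] show "v \<in> ball z r" by (auto simp: B_def)
      qed
      define c where "c = r/2"
      have c: "c > 0" using r by (simp add: c_def)
      have "norm ((deriv ^^ 1) (\<lambda>z. f z x) u) \<le> (fact 1) * g x / s ^ 1" if s: "0 < s" "s < c" for s
      proof (rule Cauchy_inequality)
        have ss: "cball u s \<subseteq> ball u (r/2)" using s by (auto simp: c_def)
        show "(\<lambda>z. f z x) holomorphic_on ball u s"
          using hol[of x] by (rule holomorphic_on_subset) (use ss sub r in \<open>auto simp: subset_iff\<close>)
        show "continuous_on (cball u s) (\<lambda>z. f z x)"
          using holomorphic_on_imp_continuous_on[OF hol[of x]] by (rule continuous_on_subset) (use ss sub r in \<open>auto simp: subset_iff\<close>)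
        show "norm (f w x) \<le> g x" if "norm (u - w) = s" for w
          using le[of w x] ss sub that by (auto simp: subset_iff dist_norm)
      qed (use s in auto)
      then have *: "norm (deriv (\<lambda>z. f z x) u) * s \<le> g x" if "0 < s" "s < c" for s
        using that by (auto simp: field_simps)
      have lim: "((\<lambda>s. norm (deriv (\<lambda>z. f z x) u) * s) \<longlongrightarrow> norm (deriv (\<lambda>z. f z x) u) * c) (at_left c)"
        by (intro tendsto_intros)
      have "norm (deriv (\<lambda>z. f z x) u) * c \<le> g x"
        by (rule tendsto_upperbound[OF lim])
           (use * c in \<open>auto simp: eventually_at_left_field intro!: exI[of _ 0]\<close>)
      then show ?thesis using c by (simp add: c_def field_simps)
    qed
    have lip: "norm (f w x - f z x) \<le> (g x / (r/2)) * norm (w - z)" if "w \<in> B" for w x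
    proof (rule field_differentiable_bound[OF B(5)])
      show "((\<lambda>z. f z x) has_field_derivative deriv (\<lambda>z. f z x) u) (at u within B)" if "u \<in> B" for u
        using holomorphic_derivI[OF hol[of x] S] B that has_field_derivative_at_within by blast
    qed (use that B dbound in auto)
    \<comment> \<open>Dominated convergence speaks of sequences, hence the passage to arbitrary
      sequences tending to \<open>z\<close>; \<open>lip\<close> bounds all difference quotients by
      one integrable function.\<close>
    have "((\<lambda>w. (integral\<^sup>L M (f w) - integral\<^sup>L M (f z)) / (w - z))
         \<longlongrightarrow> integral\<^sup>L M (\<lambda>x. deriv (\<lambda>z. f z x) z)) (at z within B)"
      unfolding tendsto_at_iff_sequentially comp_def
    proof (intro allI impI)
      fix X assume X: "\<forall>i. X i \<in> B - {z}" and lim: "X \<longlonglongrightarrow> z"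
      have int: "integrable M (f w)" if "w \<in> B" for w
        by (rule Bochner_Integration.integrable_bound[OF g]) (use meas that B le in \<open>auto intro!: AE_I2 order_trans[OF le]\<close>)
      have eq: "(integral\<^sup>L M (f (X i)) - integral\<^sup>L M (f z)) / (X i - z)
          = integral\<^sup>L M (\<lambda>x. (f (X i) x - f z x) / (X i - z))" for i
        using X B int by (subst integral_divide_zero, subst Bochner_Integration.integral_diff) auto
      have limx: "(\<lambda>i. (f (X i) x - f z x) / (X i - z)) \<longlonglongrightarrow> deriv (\<lambda>z. f z x) z" for x
      proof -
        have "((\<lambda>z. f z x) has_field_derivative deriv (\<lambda>z. f z x) z) (at z)"
          using holomorphic_derivI[OF hol[of x] S z] by blast
        then have "((\<lambda>w. (f w x - f z x) / (w - z)) \<longlongrightarrow> deriv (\<lambda>z. f z x) z) (at z)"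
          by (simp add: has_field_derivative_iff)
        moreover have "filterlim X (at z) sequentially"
          using X lim by (auto simp: filterlim_at)
        ultimately show ?thesis by (rule filterlim_compose)
      qed
      show "(\<lambda>i. (integral\<^sup>L M (f (X i)) - integral\<^sup>L M (f z)) / (X i - z))
         \<longlonglongrightarrow> integral\<^sup>L M (\<lambda>x. deriv (\<lambda>z. f z x) z)"
        unfolding eq
      proof (rule integral_dominated_convergence)
        show "integrable M (\<lambda>x. g x / (r/2))" using g by auto
        show mi: "\<And>i. (\<lambda>x. (f (X i) x - f z x) / (X i - z)) \<in> borel_measurable M"
          using meas X B z by (intro borel_measurable_divide borel_measurable_diff) auto
        show "(\<lambda>x. deriv (\<lambda>z. f z x) z) \<in> borel_measurable M"
          by (rule borel_measurable_LIMSEQ_metric[where f = "\<lambda>i x. (f (X i) x - f z x) / (X i - z)"]) (use limx mi in auto)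
        show "AE x in M. (\<lambda>i. (f (X i) x - f z x) / (X i - z)) \<longlonglongrightarrow> deriv (\<lambda>z. f z x) z"
          using limx by auto
        show "AE x in M. norm ((f (X i) x - f z x) / (X i - z)) \<le> g x / (r/2)" for i
          using lip[of "X i"] X by (auto simp: norm_divide divide_le_eq)
      qed
    qed
    then have "((\<lambda>w. integral\<^sup>L M (f w)) has_field_derivative integral\<^sup>L M (\<lambda>x. deriv (\<lambda>z. f z x) z)) (at z)"
      using B by (simp add: has_field_derivative_iff at_within_open[of z B])
    then show ?thesis using field_differentiable_def by blast
  qed
  then show ?thesis
    by (auto simp: holomorphic_on_def intro: field_differentiable_at_within)
qed

text \<open>Completing the square makes the integrand a constant multiple of the normal density with
  mean \<open>q / (2 * p)\<close> and variance \<open>1 / (2 * p)\<close>.\<close>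

lemma gaussian_integral_real:
  fixes p q :: real
  assumes p: "p > 0"
  shows "integrable lborel (\<lambda>x. exp (- p * x\<^sup>2 + q * x))"
    and "(\<integral>x. exp (- p * x\<^sup>2 + q * x) \<partial>lborel) = sqrt (pi / p) * exp (q\<^sup>2 / (4 * p))"
proof -
  define \<sigma> where "\<sigma> = sqrt (1 / (2 * p))"
  have \<sigma>: "\<sigma> > 0" "\<sigma>\<^sup>2 = 1 / (2 * p)" using p by (auto simp: \<sigma>_def)
  define m where "m = q / (2 * p)"
  have "exp (- p * x\<^sup>2 + q * x) = (sqrt (pi / p) * exp (q\<^sup>2 / (4 * p))) * normal_density m \<sigma> x" for x
  proof -
    have "- p * x\<^sup>2 + q * x = q\<^sup>2 / (4 * p) + (-(x - m)\<^sup>2 / (2 * \<sigma>\<^sup>2))"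
      using p unfolding \<sigma> m_def by (simp add: field_simps power2_eq_square)
    then have "exp (- p * x\<^sup>2 + q * x) = exp (q\<^sup>2 / (4 * p)) * exp (-(x - m)\<^sup>2 / (2 * \<sigma>\<^sup>2))"
      by (simp only: exp_add)
    moreover have "2 * pi * \<sigma>\<^sup>2 = pi / p" using p \<sigma> by simp
    ultimately show ?thesis using p by (simp add: normal_density_def)
  qed
  then have eq: "(\<lambda>x. exp (- p * x\<^sup>2 + q * x)) = (\<lambda>x. (sqrt (pi / p) * exp (q\<^sup>2 / (4 * p))) * normal_density m \<sigma> x)"
    by auto
  show "integrable lborel (\<lambda>x. exp (- p * x\<^sup>2 + q * x))"
    unfolding eq using \<sigma> by (intro integrable_mult_right) auto
  show "(\<integral>x. exp (- p * x\<^sup>2 + q * x) \<partial>lborel) = sqrt (pi / p) * exp (q\<^sup>2 / (4 * p))"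
    unfolding eq using \<sigma> by simp
qed

text \<open>Serves as the common majorant below: together with \<open>norm_exp_quadratic_le\<close>
  it dominates all complex Gaussians whose linear coefficient ranges over a disc.\<close>

lemma integrable_gaussian_abs:
  fixes p q :: real
  assumes p: "p > 0"
  shows "integrable lborel (\<lambda>x. exp (- p * x\<^sup>2 + q * \<bar>x\<bar>))"
proof (rule Bochner_Integration.integrable_bound)
  show "integrable lborel (\<lambda>x. exp (- p * x\<^sup>2 + q * x) + exp (- p * x\<^sup>2 + (-q) * x))"
    by (intro Bochner_Integration.integrable_add gaussian_integral_real p)
  show "AE x in lborel. norm (exp (- p * x\<^sup>2 + q * \<bar>x\<bar>))
      \<le> norm (exp (- p * x\<^sup>2 + q * x) + exp (- p * x\<^sup>2 + (-q) * x))"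
  proof (intro AE_I2)
    fix x :: real
    have "0 \<le> exp (- p * x\<^sup>2 + q * x)" "0 \<le> exp (- p * x\<^sup>2 + (-q) * x)" by simp_all
    then show "norm (exp (- p * x\<^sup>2 + q * \<bar>x\<bar>))
      \<le> norm (exp (- p * x\<^sup>2 + q * x) + exp (- p * x\<^sup>2 + (-q) * x))"
      by (cases "x \<ge> 0") (simp_all del: exp_ge_zero)
  qed
qed measurable

lemma norm_exp_quadratic_le:
  fixes p q :: complex and x :: real
  assumes "Re p \<ge> p0" "norm q \<le> Q"
  shows "norm (exp (- p * (of_real x)\<^sup>2 + q * of_real x)) \<le> exp (- p0 * x\<^sup>2 + Q * \<bar>x\<bar>)"
proof -
  have "- Re p * x\<^sup>2 \<le> - p0 * x\<^sup>2" using assms by (simp add: mult_right_mono)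
  moreover have "Re q * x \<le> Q * \<bar>x\<bar>"
  proof -
    have "Re q * x \<le> \<bar>Re q\<bar> * \<bar>x\<bar>" by (metis abs_ge_self abs_mult)
    also have "\<dots> \<le> Q * \<bar>x\<bar>" using abs_Re_le_cmod[of q] assms by (intro mult_right_mono) auto
    finally show ?thesis .
  qed
  moreover have "Re (- p * (of_real x)\<^sup>2 + q * of_real x) = - Re p * x\<^sup>2 + Re q * x"
    by (simp add: power2_eq_square)
  ultimately show ?thesis by simp
qed

lemma islimpt_of_real_pos: "complex_of_real 1 islimpt complex_of_real ` {0<..}"
  unfolding islimpt_approachable
proof (intro allI impI)
  fix e :: real assume "e > 0"
  moreover have "dist (complex_of_real (1 + e/2)) (of_real 1) = e/2"
    using \<open>e > 0\<close> unfolding dist_of_real by (simp add: dist_norm)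
  ultimately show "\<exists>x'\<in>complex_of_real ` {0<..}. x' \<noteq> complex_of_real 1 \<and> dist x' (complex_of_real 1) < e"
    by (intro bexI[of _ "complex_of_real (1 + e/2)"]) (auto simp del: of_real_add of_real_1)
qed

text \<open>Both sides are holomorphic in \<open>q\<close> and, on the right half-plane, in
  \<open>p\<close>. The identity theorem extends the real formula in \<open>q\<close> and then in
  \<open>p\<close>, each time from the positive axis. \<open>Re p > 0\<close> puts
  \<open>pi / p\<close> in the right half-plane, away from the branch cut of
  \<open>csqrt\<close>.\<close>

lemma gaussian_integral_complex:
  fixes p q :: complex
  assumes p: "Re p > 0"
  shows "integrable lborel (\<lambda>x. exp (- p * (of_real x)\<^sup>2 + q * of_real x))"
    and "(LINT x|lborel. exp (- p * (of_real x)\<^sup>2 + q * of_real x)) = csqrt (of_real pi / p) * exp (q\<^sup>2 / (4 * p))"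
proof -
  show "integrable lborel (\<lambda>x. exp (- p * (of_real x)\<^sup>2 + q * of_real x))"
    using norm_exp_quadratic_le[of "Re p" p q "norm q"]
    by (intro Bochner_Integration.integrable_bound[OF integrable_gaussian_abs[OF p, of "norm q"]] AE_I2)
       (simp_all del: norm_exp_eq_Re)
  define I where "I = (\<lambda>p q::complex. LINT x|lborel. exp (- p * (of_real x)\<^sup>2 + q * of_real x))"
  define R where "R = (\<lambda>p q::complex. csqrt (of_real pi / p) * exp (q\<^sup>2 / (4 * p)))"
  have real: "I (of_real p) (of_real q) = R (of_real p) (of_real q)" if "p > 0" for p q :: real
  proof -
    have "I (of_real p) (of_real q) = (LINT x|lborel. complex_of_real (exp (- p * x\<^sup>2 + q * x)))"
      unfolding I_def by (intro Bochner_Integration.integral_cong) (auto simp: exp_of_real[symmetric])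
    also have "\<dots> = of_real (sqrt (pi / p)) * of_real (exp (q\<^sup>2 / (4 * p)))"
      unfolding integral_complex_of_real gaussian_integral_real(2)[OF that] by simp
    also have "\<dots> = csqrt (of_real (pi / p)) * exp (of_real (q\<^sup>2 / (4 * p)))"
    proof -
      have "pi / p \<ge> 0" using that by simp
      then show ?thesis by (simp only: csqrt_of_real exp_of_real)
    qed
    also have "\<dots> = R (of_real p) (of_real q)" by (simp add: R_def)
    finally show ?thesis .
  qed
  have holq: "(\<lambda>q. I p q) holomorphic_on UNIV" if "Re p > 0" for p
    unfolding I_def
  proof (rule holomorphic_on_lebesgue_integral)
    fix z :: complex
    show "\<exists>r>0. \<exists>g. integrable lborel g \<and> (\<forall>w\<in>ball z r. \<forall>x. norm (exp (- p * (of_real x)\<^sup>2 + w * of_real x)) \<le> g x)"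
    proof (intro exI[of _ 1] conjI exI[of _ "\<lambda>x. exp (- Re p * x\<^sup>2 + (norm z + 1) * \<bar>x\<bar>)"] ballI allI)
      fix w x assume "w \<in> ball z 1"
      then have "norm w \<le> norm z + 1" 
        using norm_triangle_ineq2[of w z] by (simp add: dist_norm norm_minus_commute)
      then show "norm (exp (- p * (of_real x)\<^sup>2 + w * of_real x)) \<le> exp (- Re p * x\<^sup>2 + (norm z + 1) * \<bar>x\<bar>)"
        by (intro norm_exp_quadratic_le) auto
    qed (use integrable_gaussian_abs[OF that] in auto)
  qed (auto intro!: holomorphic_intros)
  have holp: "(\<lambda>p. I p q) holomorphic_on {z. Re z > 0}" for q
    unfolding I_def
  proof (rule holomorphic_on_lebesgue_integral)
    fix z :: complex assume z: "z \<in> {z. Re z > 0}"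
    show "\<exists>r>0. \<exists>g. integrable lborel g \<and> (\<forall>w\<in>ball z r. \<forall>x. norm (exp (- w * (of_real x)\<^sup>2 + q * of_real x)) \<le> g x)"
    proof (intro exI[of _ "Re z / 2"] conjI exI[of _ "\<lambda>x. exp (- (Re z / 2) * x\<^sup>2 + norm q * \<bar>x\<bar>)"] ballI allI)
      fix w x assume "w \<in> ball z (Re z / 2)"
      then have "Re w \<ge> Re z / 2" 
        using abs_Re_le_cmod[of "z - w"] by (simp add: dist_norm)
      then show "norm (exp (- w * (of_real x)\<^sup>2 + q * of_real x)) \<le> exp (- (Re z / 2) * x\<^sup>2 + norm q * \<bar>x\<bar>)"
        by (intro norm_exp_quadratic_le) auto
    qed (use z integrable_gaussian_abs[of "Re z/2" "norm q"] in auto)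
  qed (auto intro!: holomorphic_intros open_halfspace_Re_gt)
  have nonpos: "of_real pi / z \<notin> \<real>\<^sub>\<le>\<^sub>0" if "Re z > 0" for z
  proof
    assume "of_real pi / z \<in> \<real>\<^sub>\<le>\<^sub>0"
    then have "Re (of_real pi / z) \<le> 0" by (auto simp: complex_nonpos_Reals_iff)
    moreover have "Re (of_real pi / z) > 0"
      using that by (subst Re_divide) (auto simp: complex_eq_iff intro!: divide_pos_pos add_pos_nonneg)
    ultimately show False by simp
  qed
  have holR: "(\<lambda>p. R p q) holomorphic_on {z. Re z > 0}" "(\<lambda>q. R p q) holomorphic_on UNIV" for p q
    unfolding R_def using nonpos by (auto intro!: holomorphic_intros)
  have 1: "I (of_real p) q = R (of_real p) q" if "p > 0" for p :: real and q
  proof -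
    have "I (of_real p) q - R (of_real p) q = 0"
    proof (rule analytic_continuation[of "\<lambda>q. I (of_real p) q - R (of_real p) q" UNIV "complex_of_real ` {0<..}" "of_real 1"])
      show "(\<lambda>q. I (of_real p) q - R (of_real p) q) holomorphic_on UNIV"
        using holq[of "of_real p"] holR that by (intro holomorphic_intros) auto
    qed (use real[OF that] islimpt_of_real_pos in auto)
    then show ?thesis by simp
  qed
  have "I p q - R p q = 0"
  proof (rule analytic_continuation[of "\<lambda>p. I p q - R p q" "{z. Re z > 0}" "complex_of_real ` {0<..}" "of_real 1"])
    show "(\<lambda>p. I p q - R p q) holomorphic_on {z. Re z > 0}"
      using holp holR by (intro holomorphic_intros) auto
    show "connected {z. Re z > 0}"
      using convex_connected convex_halfspace_Re_gt by blast
  qed (use 1 islimpt_of_real_pos p in \<open>auto simp: open_halfspace_Re_gt\<close>)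
  then show "(LINT x|lborel. exp (- p * (of_real x)\<^sup>2 + q * of_real x)) = csqrt (of_real pi / p) * exp (q\<^sup>2 / (4 * p))"
    by (simp add: I_def R_def)
qed

section \<open>Uniqueness for the Fourier transform\<close>

text \<open>Positive and negative part of \<open>g\<close> have the same Fourier transform. Their
  total masses are its value at frequency zero, hence equal; normalized, they are densities of
  probability measures with the same characteristic function, and Levy's uniqueness theorem
  applies.\<close>

lemma AE_zero_if_fourier_zero_real:
  fixes g :: "real \<Rightarrow> real"
  assumes g: "integrable lborel g"
    and zero: "\<And>t. (LINT x|lborel. iexp (t * x) * of_real (g x)) = 0"
  shows "AE x in lborel. g x = 0"
proof -
  have [measurable]: "g \<in> borel_measurable borel" using g by auto
  define p where "p = (\<lambda>x. max 0 (g x))"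
  define n where "n = (\<lambda>x. max 0 (- g x))"
  have [measurable]: "p \<in> borel_measurable borel" "n \<in> borel_measurable borel"
    unfolding p_def n_def by measurable
  have nonneg: "p x \<ge> 0" "n x \<ge> 0" for x by (auto simp: p_def n_def)
  have gpn: "g x = p x - n x" for x by (auto simp: p_def n_def)
  have pi: "integrable lborel p" "integrable lborel n"
    unfolding p_def n_def using g by auto
  have fi: "integrable lborel (\<lambda>x. iexp (t * x) * of_real (k x))" if "integrable lborel k" for k :: "real \<Rightarrow> real" and t
  proof (rule Bochner_Integration.integrable_bound[OF that])
    have [measurable]: "k \<in> borel_measurable borel" using that by auto
    show "(\<lambda>x. iexp (t * x) * of_real (k x)) \<in> borel_measurable lborel" by measurable
  qed (auto simp: norm_mult)
  have eq: "(LINT x|lborel. iexp (t * x) * of_real (p x)) = (LINT x|lborel. iexp (t * x) * of_real (n x))" for t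
    using zero[of t] fi[OF pi(1), of t] fi[OF pi(2), of t]
    by (simp add: gpn algebra_simps)
  define m where "m = integral\<^sup>L lborel p"
  have m: "integral\<^sup>L lborel n = m"
    using eq[of 0] by (simp add: m_def)
  have "m \<ge> 0" unfolding m_def by (simp add: nonneg integral_nonneg_AE)
  show ?thesis
  proof (cases "m = 0")
    case True
    then have "AE x in lborel. p x = 0" "AE x in lborel. n x = 0"
      using integral_nonneg_eq_0_iff_AE[OF pi(1)] integral_nonneg_eq_0_iff_AE[OF pi(2)] m nonneg m_def by auto
    then show ?thesis by eventually_elim (simp add: gpn)
  next
    case False
    with \<open>m \<ge> 0\<close> have mp: "m > 0" by simp
    define D where "D = (\<lambda>k::real \<Rightarrow> real. density lborel (\<lambda>x. ennreal (k x / m)))"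
    have dist: "real_distribution (D k)"
      if "integrable lborel k" "integral\<^sup>L lborel k = m" "\<And>x. k x \<ge> 0" for k
    proof -
      have "emeasure (D k) (space (D k)) = (\<integral>\<^sup>+x. ennreal (k x / m) \<partial>lborel)"
        unfolding D_def using that by (subst emeasure_density) auto
      also have "\<dots> = ennreal (\<integral>x. k x / m \<partial>lborel)"
        using that mp by (intro nn_integral_eq_integral) auto
      also have "\<dots> = 1" using that mp by simp
      finally have "prob_space (D k)" by (rule prob_spaceI)
      then show ?thesis
        unfolding real_distribution_def real_distribution_axioms_def D_def by simp
    qed
    have char: "char (D k) t = (LINT x|lborel. iexp (t * x) * of_real (k x)) / m"
      if [measurable]: "k \<in> borel_measurable borel" and "\<And>x. k x \<ge> 0" for k t
    proof -
      have "char (D k) t = (LINT x|lborel. (k x / m) *\<^sub>R iexp (t * x))"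
        unfolding char_def D_def using that mp by (subst integral_density) auto
      also have "\<dots> = (LINT x|lborel. (iexp (t * x) * of_real (k x)) / m)"
        by (intro Bochner_Integration.integral_cong) (auto simp: scaleR_conv_of_real)
      finally show ?thesis by simp
    qed
    have "D p = D n"
    proof (rule Levy_uniqueness)
      show "char (D p) = char (D n)"
        using char[of p] char[of n] nonneg eq by (auto simp: fun_eq_iff)
    qed (use dist pi m nonneg m_def in auto)
    then have "AE x in lborel. ennreal (p x / m) = ennreal (n x / m)"
      unfolding D_def by (subst (asm) sigma_finite_measure.density_unique_iff[OF sigma_finite_lborel]) auto
    then show ?thesis
      by eventually_elim (use nonneg mp in \<open>auto simp: gpn\<close>)
  qed
qed

text \<open>Borel versions \<open>u\<close> and \<open>v\<close> of the real and imaginary part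
  reduce this to the real case.\<close>

lemma AE_zero_if_fourier_zero:
  fixes k :: "real \<Rightarrow> complex"
  assumes k: "integrable lebesgue k"
    and zero: "\<And>t. (LINT x|lebesgue. iexp (t * x) * k x) = 0"
  shows "AE x in lebesgue. k x = 0"
proof -
  have km: "k \<in> borel_measurable lebesgue" using k by auto
  obtain u where u[measurable]: "u \<in> borel_measurable borel" and ku: "AE x in lborel. Re (k x) = u x"
    using completion_ex_borel_measurable_real[of "\<lambda>x. Re (k x)" lborel] km by auto
  obtain v where v[measurable]: "v \<in> borel_measurable borel" and kv: "AE x in lborel. Im (k x) = v x"
    using completion_ex_borel_measurable_real[of "\<lambda>x. Im (k x)" lborel] km by auto
  have ku': "AE x in lebesgue. Re (k x) = u x" and kv': "AE x in lebesgue. Im (k x) = v x"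
    using ku kv by (auto intro: AE_completion)
  have meas: "u \<in> borel_measurable lebesgue" "v \<in> borel_measurable lebesgue"
    by (auto intro: measurable_completion)
  have "integrable lebesgue u"
    by (rule integrable_cong_AE_imp[OF integrable_Re[OF k]]) (use ku' meas in \<open>auto elim: eventually_mono\<close>)
  then have ui: "integrable lborel u" by (simp add: integrable_completion)
  have "integrable lebesgue v"
    by (rule integrable_cong_AE_imp[OF integrable_Im[OF k]]) (use kv' meas in \<open>auto elim: eventually_mono\<close>)
  then have vi: "integrable lborel v" by (simp add: integrable_completion)
  have fi: "integrable lborel (\<lambda>x. iexp (t * x) * of_real (w x))" if "integrable lborel w" for w :: "real \<Rightarrow> real" and t
  proof (rule Bochner_Integration.integrable_bound[OF that])
    have [measurable]: "w \<in> borel_measurable borel" using that by auto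
    show "(\<lambda>x. iexp (t * x) * of_real (w x)) \<in> borel_measurable lborel" by measurable
  qed (auto simp: norm_mult)
  define U where "U t = (LINT x|lborel. iexp (t * x) * of_real (u x))" for t
  define V where "V t = (LINT x|lborel. iexp (t * x) * of_real (v x))" for t
  have UV: "U t + \<i> * V t = 0" for t
  proof -
    have "0 = (LINT x|lebesgue. iexp (t * x) * (of_real (u x) + \<i> * of_real (v x)))"
      unfolding zero[of t, symmetric]
    proof (rule integral_cong_AE)
      show "AE x in lebesgue. iexp (t * x) * k x = iexp (t * x) * (of_real (u x) + \<i> * of_real (v x))"
        using ku' kv' by eventually_elim (metis complex_eq)
      have [measurable]: "(\<lambda>x. iexp (t * x)) \<in> borel_measurable lebesgue" by (rule measurable_completion) measurable
      show "(\<lambda>x. iexp (t * x) * k x) \<in> borel_measurable lebesgue" using km by measurable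
      show "(\<lambda>x. iexp (t * x) * (of_real (u x) + \<i> * of_real (v x))) \<in> borel_measurable lebesgue"
        using meas by measurable
    qed
    also have "\<dots> = (LINT x|lborel. iexp (t * x) * (of_real (u x) + \<i> * of_real (v x)))"
      by (rule integral_completion) measurable
    also have "\<dots> = (LINT x|lborel. iexp (t * x) * of_real (u x) + \<i> * (iexp (t * x) * of_real (v x)))"
      by (intro Bochner_Integration.integral_cong) (auto simp: algebra_simps)
    also have "\<dots> = U t + \<i> * V t"
      unfolding U_def V_def using fi[OF ui] fi[OF vi] by (subst Bochner_Integration.integral_add) auto
    finally show ?thesis by simp
  qed
  \<comment> \<open>The Fourier transform of a real function has this symmetry. Conjugating
    \<open>U + \<i> * V = 0\<close> at \<open>- t\<close> therefore gives
    \<open>U - \<i> * V = 0\<close> at \<open>t\<close>, which separates the two transforms.\<close>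
  have cU: "cnj (U (- t)) = U t" and cV: "cnj (V (- t)) = V t" for t
    unfolding U_def V_def Bochner_Integration.integral_cnj[symmetric] by (simp_all add: exp_cnj)
  have "U t - \<i> * V t = 0" for t
    using arg_cong[OF UV[of "- t"], of cnj] by (simp add: cU cV)
  with UV have "U t = 0" "V t = 0" for t
    by (metis add.right_neutral add_diff_cancel_left' add_cancel_left_left complex_i_not_zero diff_add_cancel mult_eq_0_iff mult_2 zero_neq_numeral)+
  then have "AE x in lborel. u x = 0" "AE x in lborel. v x = 0"
    using AE_zero_if_fourier_zero_real[OF ui] AE_zero_if_fourier_zero_real[OF vi] by (auto simp: U_def V_def)
  then have "AE x in lborel. k x = 0"
    using ku kv by eventually_elim (simp add: complex_eq_iff)
  then show ?thesis by (rule AE_completion)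
qed

section \<open>Functions of exponential type and Carlson's theorem\<close>

text \<open>A weak form of Stirling's formula, losing only a factor linear in \<open>n\<close>. The
  induction step rests on \<open>(1 - 1 / (n + 1)) ^ (n + 1) \<le> exp (-1)\<close>.\<close>

lemma fact_mult_exp_le: "n > 0 \<Longrightarrow> fact n * exp (real n) \<le> exp 1 * real n * real n ^ n"
proof (induction n rule: nat_induct_non_zero)
  case (Suc n)
  have "1 - 1 / real (Suc n) \<le> exp (- (1 / real (Suc n)))"
    using exp_ge_add_one_self[of "- (1 / real (Suc n))"] by simp
  then have "(1 - 1 / real (Suc n)) ^ Suc n \<le> exp (- (1 / real (Suc n))) ^ Suc n"
    by (rule power_mono) (simp add: field_simps)
  also have "\<dots> = exp (real (Suc n) * (- (1 / real (Suc n))))"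
    by (rule exp_of_nat_mult[symmetric])
  also have "real (Suc n) * (- (1 / real (Suc n))) = -1"
    using of_nat_neq_0[of n] by (simp add: field_simps del: of_nat_Suc)
  also have "1 - 1 / real (Suc n) = real n / real (Suc n)" by (simp add: field_simps)
  finally have "real n ^ Suc n \<le> exp (-1) * real (Suc n) ^ Suc n"
    unfolding power_divide by (simp add: field_simps del: power_Suc of_nat_Suc)
  then have *: "exp 1 * real n ^ Suc n \<le> real (Suc n) ^ Suc n"
    by (simp add: exp_minus field_simps del: power_Suc of_nat_Suc)
  have "fact (Suc n) * exp (real (Suc n)) = real (Suc n) * exp 1 * (fact n * exp (real n))"
    by (simp add: exp_add algebra_simps)
  also have "\<dots> \<le> real (Suc n) * exp 1 * (exp 1 * real n * real n ^ n)"
    using Suc.IH by (intro mult_left_mono) auto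
  also have "\<dots> = real (Suc n) * exp 1 * (exp 1 * real n ^ Suc n)" by simp
  also have "\<dots> \<le> real (Suc n) * exp 1 * real (Suc n) ^ Suc n"
    using * by (intro mult_left_mono) auto
  finally show ?case by (simp add: mult_ac)
qed simp

lemma higher_deriv_exp_mult: "(deriv ^^ k) (\<lambda>z. exp (s * z)) = (\<lambda>z. s ^ k * exp (s * z :: complex))"
proof (induction k)
  case (Suc k)
  have "deriv (\<lambda>z. s ^ k * exp (s * z)) z = s ^ Suc k * exp (s * z)" for z
    by (rule DERIV_imp_deriv) (auto intro!: derivative_eq_intros)
  with Suc show ?case by simp
qed simp

text \<open>Cauchy's estimate on the circle of radius \<open>k / c\<close>, which minimizes
  \<open>exp (c * R) / R ^ k\<close>, combined with the Stirling bound. The loss is linear in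
  \<open>k\<close>, so the Borel series still converges everywhere outside the disc of radius
  \<open>c\<close>.\<close>

lemma higher_deriv_bound_exp_type:
  assumes K: "K holomorphic_on UNIV" and bd: "\<And>s. norm (K s) \<le> C * exp (c * norm s)" and c: "c > 0"
  shows "norm ((deriv ^^ k) K 0) \<le> C * exp 1 * real (Suc k) * c ^ k"
proof (cases "k = 0")
  case True
  have "C \<ge> 0" using bd[of 0] norm_ge_zero[of "K 0"] by (simp del: norm_ge_zero)
  have "C * 1 \<le> C * exp 1" using \<open>C \<ge> 0\<close> by (intro mult_left_mono) auto
  then show ?thesis using bd[of 0] True by simp
next
  case False
  then have k: "k > 0" by simp
  have "C \<ge> 0" using bd[of 0] norm_ge_zero[of "K 0"] by (simp del: norm_ge_zero)
  define R where "R = real k / c"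
  have R: "R > 0" using k c by (simp add: R_def)
  have "norm ((deriv ^^ k) K 0) \<le> fact k * (C * exp (c * R)) / R ^ k"
  proof (rule Cauchy_inequality)
    show "K holomorphic_on ball 0 R" using K holomorphic_on_subset by blast
    show "continuous_on (cball 0 R) K" using K holomorphic_on_imp_continuous_on holomorphic_on_subset by blast
    show "norm (K x) \<le> C * exp (c * R)" if "norm (0 - x) = R" for x
      using bd[of x] that by simp
  qed (rule R)
  also have "\<dots> = C * (fact k * exp (real k)) * c ^ k / real k ^ k"
    using c by (simp add: R_def field_simps)
  also have "\<dots> \<le> C * (exp 1 * real k * real k ^ k) * c ^ k / real k ^ k"
    using fact_mult_exp_le[OF k] \<open>C \<ge> 0\<close> c by (intro divide_right_mono mult_right_mono mult_left_mono) auto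
  also have "\<dots> = C * exp 1 * real k * c ^ k" using k by simp
  also have "\<dots> \<le> C * exp 1 * real (Suc k) * c ^ k"
    using \<open>C \<ge> 0\<close> c by (intro mult_right_mono mult_left_mono) auto
  finally show ?thesis .
qed

text \<open>The function \<open>B\<close> is the Borel transform of \<open>K\<close>.\<close>

lemma exp_type_circle_representation:
  assumes K: "K holomorphic_on UNIV" and bd: "\<And>s. norm (K s) \<le> C * exp (c * norm s)" and c: "0 < c" "c < r"
  obtains B where "continuous_on (sphere 0 r) B"
    and "\<And>s. ((\<lambda>\<beta>. exp (s * \<beta>) * B \<beta>) has_contour_integral K s) (circlepath 0 r)"
proof -
  have r: "r > 0" using c by simp
  define d where "d = (\<lambda>k. (deriv ^^ k) K 0)"
  define M where "M = (\<lambda>k. norm (d k) / r ^ Suc k)"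
  have sM: "summable M"
  proof (rule summable_comparison_test[OF exI[of _ 0]], intro allI impI)
    fix k
    have "norm (d k) \<le> C * exp 1 * real (Suc k) * c ^ k"
      unfolding d_def using higher_deriv_bound_exp_type[OF K bd c(1)] .
    then have "M k \<le> C * exp 1 * real (Suc k) * c ^ k / r ^ Suc k"
      unfolding M_def using r by (intro divide_right_mono) auto
    also have "\<dots> = C * exp 1 / r * (real (Suc k) * (c / r) ^ k)" using r by (simp add: field_simps)
    finally show "norm (M k) \<le> C * exp 1 / r * (real (Suc k) * (c / r) ^ k)" using r by (simp add: M_def)
  next
    show "summable (\<lambda>k. C * exp 1 / r * (real (Suc k) * (c / r) ^ k))"
      using geometric_deriv_sums[of "c / r"] c r by (intro summable_mult) (auto simp: sums_iff)
  qed
  define b where "b = (\<lambda>k \<beta>. d k / \<beta> ^ Suc k)"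
  define B where "B = (\<lambda>\<beta>. suminf (\<lambda>k. b k \<beta>))"
  have nb: "norm (b k \<beta>) = M k" if "\<beta> \<in> sphere 0 r" for k \<beta>
    using that by (simp add: b_def M_def norm_divide norm_mult norm_power)
  have ul: "uniform_limit (sphere 0 r) (\<lambda>n \<beta>. \<Sum>k<n. b k \<beta>) B sequentially"
    unfolding B_def by (rule Weierstrass_m_test[OF _ sM]) (simp add: nb)
  have contB: "continuous_on (sphere 0 r) B"
    by (rule uniform_limit_theorem[OF _ ul])
       (use r in \<open>auto simp: b_def intro!: always_eventually continuous_intros\<close>)
  have main: "((\<lambda>\<beta>. exp (s * \<beta>) * B \<beta>) has_contour_integral 2 * of_real pi * \<i> * K s) (circlepath 0 r)" for s
  proof -
    define e where "e = (\<lambda>k \<beta>. exp (s * \<beta>) * b k \<beta>)"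
    \<comment> \<open>Each term \<open>d k / \<beta> ^ Suc k\<close> extracts the Taylor coefficient
      \<open>s ^ k / fact k\<close> of the exponential, so termwise integration of the series of
      \<open>B\<close> reproduces the Taylor series of \<open>K\<close>.\<close>
    have ek: "(e k has_contour_integral (2 * of_real pi * \<i>) * (d k / fact k * s ^ k)) (circlepath 0 r)" for k
    proof -
      have "((\<lambda>u. exp (s * u) / (u - 0) ^ Suc k) has_contour_integral
          ((2 * pi * \<i>) / fact k * (deriv ^^ k) (\<lambda>u. exp (s * u)) 0)) (circlepath 0 r)"
        by (rule Cauchy_has_contour_integral_higher_derivative_circlepath)
           (use r in \<open>auto intro!: continuous_intros holomorphic_intros\<close>)
      then have "((\<lambda>u. d k * (exp (s * u) / (u - 0) ^ Suc k)) has_contour_integral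
          d k * ((2 * pi * \<i>) / fact k * (deriv ^^ k) (\<lambda>u. exp (s * u)) 0)) (circlepath 0 r)"
        by (rule has_contour_integral_lmul)
      then show ?thesis
        unfolding higher_deriv_exp_mult by (simp add: e_def b_def mult_ac)
    qed
    have esum: "(\<lambda>k. e k \<beta>) sums (exp (s * \<beta>) * B \<beta>)" if "\<beta> \<in> sphere 0 r" for \<beta>
    proof -
      have "summable (\<lambda>k. b k \<beta>)"
        by (rule summable_norm_cancel) (simp add: nb[OF that] sM)
      then show ?thesis unfolding e_def B_def by (intro sums_mult summable_sums)
    qed
    have ul2: "uniform_limit (sphere 0 r) (\<lambda>n \<beta>. \<Sum>k<n. e k \<beta>) (\<lambda>\<beta>. suminf (\<lambda>k. e k \<beta>)) sequentially"
    proof (rule Weierstrass_m_test)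
      show "summable (\<lambda>k. exp (norm s * r) * M k)" using sM by (rule summable_mult)
      show "norm (e k \<beta>) \<le> exp (norm s * r) * M k" if "\<beta> \<in> sphere 0 r" for k \<beta>
      proof -
        have "norm (exp (s * \<beta>)) \<le> exp (norm s * r)"
          using norm_exp[of "s * \<beta>"] that by (simp add: norm_mult)
        then show ?thesis using nb[OF that] unfolding e_def norm_mult
          by (intro mult_mono) (auto simp: M_def r less_imp_le)
      qed
    qed
    have ev: "\<forall>\<^sub>F n in sequentially. (\<lambda>\<beta>. \<Sum>k<n. e k \<beta>) contour_integrable_on (circlepath 0 r)"
      using ek has_contour_integral_integrable by (intro always_eventually allI contour_integrable_sum) blast+
    note lim = contour_integral_uniform_limit_circlepath[OF ev ul2 _ r]
    have "contour_integral (circlepath 0 r) (\<lambda>\<beta>. \<Sum>k<n. e k \<beta>) = (\<Sum>k<n. (2 * of_real pi * \<i>) * (d k / fact k * s ^ k))" for n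
      by (rule contour_integral_unique, rule has_contour_integral_sum) (use ek in auto)
    with lim have "(\<lambda>k. (2 * of_real pi * \<i>) * (d k / fact k * s ^ k)) sums
        contour_integral (circlepath 0 r) (\<lambda>\<beta>. suminf (\<lambda>k. e k \<beta>))"
      by (simp add: sums_def)
    moreover have "(\<lambda>k. d k / fact k * (s - 0) ^ k) sums K s"
      unfolding d_def by (rule holomorphic_power_series[of K 0 "norm s + 1"])
         (use K holomorphic_on_subset in auto)
    then have "(\<lambda>k. (2 * of_real pi * \<i>) * (d k / fact k * s ^ k)) sums ((2 * of_real pi * \<i>) * K s)"
      by (intro sums_mult) simp
    ultimately have "contour_integral (circlepath 0 r) (\<lambda>\<beta>. suminf (\<lambda>k. e k \<beta>)) = (2 * of_real pi * \<i>) * K s"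
      by (rule sums_unique2)
    moreover have "(\<lambda>\<beta>. suminf (\<lambda>k. e k \<beta>)) contour_integrable_on (circlepath 0 r)"
      using lim by simp
    ultimately have "((\<lambda>\<beta>. suminf (\<lambda>k. e k \<beta>)) has_contour_integral (2 * of_real pi * \<i>) * K s) (circlepath 0 r)"
      by (metis has_contour_integral_integral)
    then show ?thesis
      by (rule has_contour_integral_eq) (use r esum in \<open>auto simp: sums_iff\<close>)
  qed
  show thesis
  proof
    show "continuous_on (sphere 0 r) (\<lambda>\<beta>. B \<beta> / (2 * of_real pi * \<i>))" using contB by (intro continuous_intros) auto
    show "((\<lambda>\<beta>. exp (s * \<beta>) * (B \<beta> / (2 * of_real pi * \<i>))) has_contour_integral K s) (circlepath 0 r)" for s
      using has_contour_integral_div[OF main[of s], of "2 * of_real pi * \<i>"] by simp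
  qed
qed

text \<open>With the zero of \<open>exp u - 1\<close> at the origin divided out,
  \<open>1 / (exp \<mu> - exp \<beta>)\<close> becomes the Cauchy kernel
  \<open>1 / (\<mu> - \<beta>)\<close> times a factor free of poles as long as
  \<open>\<bar>Im (\<mu> - \<beta>)\<bar> < 2 * pi\<close>.\<close>

definition expm1_quot :: "complex \<Rightarrow> complex" where
  "expm1_quot u = (if u = 0 then 1 else (exp u - 1) / u)"

lemma holomorphic_expm1_quot: "expm1_quot holomorphic_on UNIV"
proof (rule pole_theorem_open_0[of "\<lambda>u. exp u - 1" _ 0])
  show "(\<lambda>u. exp u - 1 :: complex) holomorphic_on UNIV" by (intro holomorphic_intros)
  have "deriv (\<lambda>u. exp u - 1 :: complex) 0 = 1"
    by (rule DERIV_imp_deriv) (auto intro!: derivative_eq_intros)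
  then show "expm1_quot 0 = deriv (\<lambda>u. exp u - 1) 0" by (simp add: expm1_quot_def)
qed (auto simp: expm1_quot_def)

lemma expm1_quot_nonzero: "\<bar>Im u\<bar> < 2 * pi \<Longrightarrow> expm1_quot u \<noteq> 0"
  using exp_complex_eqI[of u 0] by (auto simp: expm1_quot_def)

lemma expm1_quot_kernel: "exp b * (expm1_quot (m - b) * (m - b)) = exp m - exp b"
  by (auto simp: expm1_quot_def exp_diff field_simps)

text \<open>Write \<open>K s\<close> as a circle integral of \<open>exp (s * \<beta>)\<close> against \<open>B\<close>, and \<open>exp (s * \<beta>)\<close> as an
  integral of the kernel \<open>exp \<mu> / (exp \<mu> - exp \<beta>)\<close> over a larger circle of radius below
  \<open>\<pi>\<close>. The function \<open>W\<close>, obtained by integrating this kernel against \<open>B\<close>, vanishes for large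
  \<open>Re \<mu>\<close> by expanding in powers of \<open>exp \<beta>\<close>, hence on the strip outside the smaller circle.\<close>

theorem Carlson_entire:
  assumes K: "K holomorphic_on UNIV" and bd: "\<And>s. norm (K s) \<le> C * exp (c * norm s)"
    and c: "0 < c" "c < pi" and zero: "\<And>n::nat. K (of_nat n) = 0"
  shows "K s = 0"
proof -
  define r where "r = (c + pi) / 2"
  define r' where "r' = (r + pi) / 2"
  have r: "c < r" "0 < r" "r < r'" "r' < pi" "r < pi" "0 < r'" using c by (auto simp: r_def r'_def intro!: add_pos_pos)
  obtain B where contB: "continuous_on (sphere 0 r) B"
    and KB: "\<And>s. ((\<lambda>\<beta>. exp (s * \<beta>) * B \<beta>) has_contour_integral K s) (circlepath 0 r)"
    using exp_type_circle_representation[OF K bd c(1) r(1)] by metis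
  \<comment> \<open>Points of \<open>S\<close> and of the small circle have imaginary parts that
    differ by less than \<open>2 * pi\<close>, so the exponential separates them and the kernel has
    no poles for \<mu> in \<open>S\<close>.\<close>
  define S where "S = {z. \<bar>Im z\<bar> < pi} - cball 0 r"
  define W where "W = (\<lambda>\<mu>. contour_integral (circlepath 0 r) (\<lambda>\<beta>. B \<beta> / (exp \<mu> - exp \<beta>)))"
  have strip: "{z. \<bar>Im z\<bar> < pi} = {z. Im z < pi} \<inter> {z. Im z > -pi}" by auto
  have oS: "open S" unfolding S_def strip
    by (intro open_Diff open_Int open_halfspace_Im_lt open_halfspace_Im_gt) auto
  have cstrip: "connected {z. \<bar>Im z\<bar> < pi}" unfolding strip
    by (intro convex_connected convex_Int convex_halfspace_Im_lt convex_halfspace_Im_gt)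
  have cS: "connected S"
  proof -
    \<comment> \<open>Removing from the strip an open ball of radius slightly above \<open>r\<close>
      leaves a connected set that contains \<open>pi\<close>; the union of these sets is
      \<open>S\<close>.\<close>
    have S_eq: "S = \<Union> ((\<lambda>q. {z. \<bar>Im z\<bar> < pi} - ball 0 q) ` {r<..<pi})" (is "_ = \<Union> ?A")
    proof
      show "S \<subseteq> \<Union> ?A"
      proof
        fix z assume z: "z \<in> S"
        define q where "q = min (norm z) ((r + pi) / 2)"
        have "q \<in> {r<..<pi}" "z \<in> {z. \<bar>Im z\<bar> < pi} - ball 0 q"
          using z r by (auto simp: q_def S_def min_def)
        then show "z \<in> \<Union> ?A" by blast
      qed
    qed (auto simp: S_def)
    show ?thesis unfolding S_eq
    proof (rule connected_Union)
      fix s assume "s \<in> ?A"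
      then obtain q where q: "q \<in> {r<..<pi}" and s: "s = {z. \<bar>Im z\<bar> < pi} - ball 0 q" by auto
      have "cball 0 q \<subseteq> {z. \<bar>Im z\<bar> < pi}" using q abs_Im_le_cmod order_trans by (fastforce simp: )
      then show "connected s" unfolding s by (intro connected_diff_ball cstrip) auto
    next
      have "complex_of_real pi \<in> \<Inter> ?A" by auto
      then show "\<Inter> ?A \<noteq> {}" by blast
    qed
  qed
  have Im_le: "\<bar>Im \<beta>\<bar> \<le> r" if "norm \<beta> = r" for \<beta> using abs_Im_le_cmod[of \<beta>] that by simp
  have ne: "exp \<mu> \<noteq> exp \<beta>" if "\<mu> \<in> S" "norm \<beta> = r" for \<mu> \<beta>
  proof
    assume "exp \<mu> = exp \<beta>"
    moreover have "\<bar>Im \<mu> - Im \<beta>\<bar> < 2 * pi" using Im_le[OF that(2)] that(1) r unfolding S_def by auto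
    ultimately have "\<mu> = \<beta>" using exp_complex_eqI by blast
    then show False using that by (simp add: S_def)
  qed
  have holW: "W holomorphic_on S"
  proof -
    define \<gamma> where "\<gamma> = (\<lambda>t. circlepath (0::complex) r t)"
    have \<gamma>: "norm (\<gamma> t) = r" for t using r by (simp add: \<gamma>_def circlepath norm_mult)
    have c\<gamma>: "continuous_on T \<gamma>" for T unfolding \<gamma>_def circlepath by (intro continuous_intros)
    define D where "D = (\<lambda>t. 2 * of_real pi * \<i> * r * exp (2 * of_real pi * \<i> * of_real t))"
    have cD: "continuous_on T D" for T unfolding D_def by (intro continuous_intros)
    have cB\<gamma>: "continuous_on T (\<lambda>t. B (\<gamma> t))" for T
      by (rule continuous_on_compose2[OF contB c\<gamma>]) (auto simp: \<gamma>)
    define f where "f = (\<lambda>\<mu> t. B (\<gamma> t) / (exp \<mu> - exp (\<gamma> t)) * D t)"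
    define f' where "f' = (\<lambda>\<mu> t. - (B (\<gamma> t) * exp \<mu> / (exp \<mu> - exp (\<gamma> t))\<^sup>2) * D t)"
    have W_eq: "W = (\<lambda>\<mu>. integral (cbox 0 1) (f \<mu>))"
      unfolding W_def contour_integral_integral f_def D_def \<gamma>_def
      by (simp add: vector_derivative_circlepath mult_ac)
    have "W holomorphic_on ball z e" if "ball z e \<subseteq> S" for z e
      unfolding W_eq
    proof (rule leibniz_rule_holomorphic[where fx = f'])
      show "((\<lambda>x. f x t) has_field_derivative f' x t) (at x within ball z e)"
        if "x \<in> ball z e" for x t
      proof -
        have "exp x \<noteq> exp (\<gamma> t)" by (rule ne) (use \<gamma> that \<open>ball z e \<subseteq> S\<close> in auto)
        then show ?thesis
          unfolding f_def f'_def by (auto intro!: derivative_eq_intros simp: power2_eq_square)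
      qed
      show "f x integrable_on cbox 0 1" if "x \<in> ball z e" for x
      proof -
        have "exp x - exp (\<gamma> t) \<noteq> 0" for t using ne[of x "\<gamma> t"] \<gamma> that \<open>ball z e \<subseteq> S\<close> by auto
        then show ?thesis
          unfolding f_def by (intro integrable_continuous continuous_intros cB\<gamma> cD c\<gamma>) blast
      qed
      have ne': "exp (fst x) - exp (\<gamma> (snd x)) \<noteq> 0" if "x \<in> ball z e \<times> cbox 0 1" for x
        using ne[OF _ \<gamma>, of "fst x" "snd x"] that \<open>ball z e \<subseteq> S\<close> by auto
      have c2: "continuous_on (ball z e \<times> cbox 0 1) (\<lambda>x. h (snd x))" if "continuous_on UNIV h" for h :: "real \<Rightarrow> complex"
        by (rule continuous_on_compose2[OF that]) (auto intro!: continuous_intros)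
      show "continuous_on (ball z e \<times> cbox 0 1) (\<lambda>(x, t). f' x t)"
        unfolding f'_def case_prod_unfold
        by (intro continuous_intros c2[OF cB\<gamma>] c2[OF cD] c2[OF c\<gamma>]) (use ne' in auto)
    qed auto
    then show ?thesis
      using oS by (metis analytic_on_def analytic_on_open openE)
  qed
  have W0: "W \<mu> = 0" if "Re \<mu> > r" for \<mu>
  proof -
    define x where "x = exp (r - Re \<mu>)"
    have x: "0 < x" "x < 1" using that by (auto simp: x_def)
    have bB: "bounded (B ` sphere 0 r)"
      using compact_continuous_image[OF contB] compact_imp_bounded by (simp add: compact_sphere)
    then obtain Mb where "\<forall>x\<in>B ` sphere 0 r. norm x \<le> Mb" unfolding bounded_iff by blast
    then have Mb: "norm (B \<beta>) \<le> Mb" if "norm \<beta> = r" for \<beta> using that by auto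
    \<comment> \<open>Terms of the geometric series of the kernel, valid for
      \<open>Re \<mu> > r\<close>. The integral of the \<open>n\<close>-th one is a multiple of
      \<open>K (of_nat n)\<close>, with \<open>n = 0\<close> included, and so vanishes.\<close>
    define e where "e = (\<lambda>n \<beta>. exp (- (of_nat (Suc n) * \<mu>)) * (exp (of_nat n * \<beta>) * B \<beta>))"
    have ek: "(e n has_contour_integral 0) (circlepath 0 r)" for n
      using has_contour_integral_lmul[OF KB[of "of_nat n"], of "exp (- (of_nat (Suc n) * \<mu>))"] zero[of n]
      by (simp add: e_def)
    have esum: "(\<lambda>n. e n \<beta>) sums (B \<beta> / (exp \<mu> - exp \<beta>))" if b: "norm \<beta> = r" for \<beta>
    proof -
      have nz: "norm (exp (\<beta> - \<mu>)) < 1"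
        using complex_Re_le_cmod[of \<beta>] b \<open>Re \<mu> > r\<close> by simp
      have "(\<lambda>n. B \<beta> * exp (- \<mu>) * exp (\<beta> - \<mu>) ^ n) sums (B \<beta> * exp (- \<mu>) * (1 / (1 - exp (\<beta> - \<mu>))))"
        by (intro sums_mult geometric_sums nz)
      moreover have "B \<beta> * exp (- \<mu>) * (1 / (1 - exp (\<beta> - \<mu>))) = B \<beta> / (exp \<mu> - exp \<beta>)"
        by (simp add: exp_diff exp_minus field_simps)
      moreover have "B \<beta> * exp (- \<mu>) * exp (\<beta> - \<mu>) ^ n = e n \<beta>" for n
        by (simp add: e_def exp_of_nat_mult[symmetric] exp_add[symmetric] algebra_simps flip: exp_minus)
      ultimately show ?thesis by simp
    qed
    have ul: "uniform_limit (sphere 0 r) (\<lambda>n \<beta>. \<Sum>k<n. e k \<beta>) (\<lambda>\<beta>. suminf (\<lambda>k. e k \<beta>)) sequentially"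
    proof (rule Weierstrass_m_test)
      show "summable (\<lambda>n. Mb * exp (- Re \<mu>) * x ^ n)" using x by (intro summable_mult summable_geometric) auto
      show "norm (e n \<beta>) \<le> Mb * exp (- Re \<mu>) * x ^ n" if "\<beta> \<in> sphere 0 r" for n \<beta>
      proof -
        have b: "norm \<beta> = r" using that by simp
        have "norm (e n \<beta>) = exp (- (real (Suc n) * Re \<mu>) + real n * Re \<beta>) * norm (B \<beta>)"
          by (simp only: e_def norm_mult norm_exp_eq_Re exp_add) simp
        also have "\<dots> \<le> exp (- (real (Suc n) * Re \<mu>) + real n * r) * Mb"
          using complex_Re_le_cmod[of \<beta>] b Mb[OF b] by (intro mult_mono) (auto intro!: mult_left_mono)
        also have "\<dots> = Mb * exp (- Re \<mu>) * x ^ n"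
          unfolding x_def by (simp add: exp_of_nat_mult[symmetric] exp_add[symmetric] algebra_simps)
        finally show ?thesis .
      qed
    qed
    have ev: "\<forall>\<^sub>F n in sequentially. (\<lambda>\<beta>. \<Sum>k<n. e k \<beta>) contour_integrable_on (circlepath 0 r)"
      using ek has_contour_integral_integrable by (intro always_eventually allI contour_integrable_sum) blast+
    have z: "contour_integral (circlepath 0 r) (\<lambda>\<beta>. \<Sum>k<n. e k \<beta>) = 0" for n
      using has_contour_integral_sum[of "{..<n}" e "\<lambda>_. 0"] ek by (intro contour_integral_unique) auto
    have "(\<lambda>n. 0) \<longlonglongrightarrow> contour_integral (circlepath 0 r) (\<lambda>\<beta>. suminf (\<lambda>k. e k \<beta>))"
      using contour_integral_uniform_limit_circlepath(2)[OF ev ul _ r(2)] by (simp add: z)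
    then have "contour_integral (circlepath 0 r) (\<lambda>\<beta>. suminf (\<lambda>k. e k \<beta>)) = 0"
      using LIMSEQ_unique tendsto_const by blast
    moreover have "contour_integral (circlepath 0 r) (\<lambda>\<beta>. suminf (\<lambda>k. e k \<beta>)) = W \<mu>"
      unfolding W_def by (rule contour_integral_eq) (use r esum in \<open>auto simp: sums_iff\<close>)
    ultimately show ?thesis by simp
  qed
  have W_zero: "W \<mu> = 0" if "\<mu> \<in> S" for \<mu>
  proof (rule analytic_continuation_open[of "S \<inter> {z. Re z > r}" S W "\<lambda>_. 0"])
    show "open (S \<inter> {z. Re z > r})" using oS open_halfspace_Re_gt by blast
    have "of_real (r + 1) \<in> S \<inter> {z. Re z > r}" using r by (auto simp: S_def simp del: of_real_add)
    then show "S \<inter> {z. Re z > r} \<noteq> {}" by blast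
  qed (use oS cS holW W0 that in auto)
  have outer: "\<mu> \<in> S" if "norm \<mu> = r'" for \<mu>
    using that r abs_Im_le_cmod[of \<mu>] by (auto simp: S_def)
  have kernel: "((\<lambda>\<mu>. exp (s * \<mu>) * exp \<mu> / (exp \<mu> - exp \<beta>)) has_contour_integral
      2 * of_real pi * \<i> * exp (s * \<beta>)) (circlepath 0 r')" if b: "norm \<beta> = r" for \<beta>
  proof -
    \<comment> \<open>Inside the larger disc \<beta> is the only singularity of the kernel;
      \<open>F\<close> is what remains after the Cauchy kernel is split off.\<close>
    define F where "F = (\<lambda>\<mu>. exp (s * \<mu>) * exp \<mu> / (exp \<beta> * expm1_quot (\<mu> - \<beta>)))"
    have nz: "expm1_quot (\<mu> - \<beta>) \<noteq> 0" if "\<mu> \<in> cball 0 r'" for \<mu>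
      using Im_le[OF b] abs_Im_le_cmod[of \<mu>] that r by (intro expm1_quot_nonzero) auto
    have "(\<lambda>\<mu>. expm1_quot (\<mu> - \<beta>)) holomorphic_on cball 0 r'"
    proof -
      have "(\<lambda>\<mu>. \<mu> - \<beta>) holomorphic_on cball 0 r'" by (intro holomorphic_intros)
      from holomorphic_on_compose_gen[OF this holomorphic_expm1_quot] show ?thesis by (simp add: comp_def)
    qed
    then have "F holomorphic_on cball 0 r'"
      unfolding F_def using nz by (intro holomorphic_intros) auto
    then have "((\<lambda>u. F u / (u - \<beta>)) has_contour_integral 2 * of_real pi * \<i> * F \<beta>) (circlepath 0 r')"
      using b r by (intro Cauchy_integral_circlepath_simple) auto
    moreover have "F \<beta> = exp (s * \<beta>)" by (simp add: F_def expm1_quot_def)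
    moreover have "F u / (u - \<beta>) = exp (s * u) * exp u / (exp u - exp \<beta>)" for u
      unfolding expm1_quot_kernel[symmetric] F_def by (simp add: mult.assoc)
    ultimately show ?thesis by simp
  qed
  have "2 * of_real pi * \<i> * K s = contour_integral (circlepath 0 r) (\<lambda>\<beta>. 2 * of_real pi * \<i> * (exp (s * \<beta>) * B \<beta>))"
    using has_contour_integral_lmul[OF KB[of s]] by (rule contour_integral_unique[symmetric])
  also have "\<dots> = contour_integral (circlepath 0 r) (\<lambda>\<beta>. contour_integral (circlepath 0 r')
      (\<lambda>\<mu>. B \<beta> * (exp (s * \<mu>) * exp \<mu> / (exp \<mu> - exp \<beta>))))"
  proof (rule contour_integral_eq)
    fix \<beta> assume "\<beta> \<in> path_image (circlepath 0 r)"
    then have "norm \<beta> = r" using r by simp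
    from has_contour_integral_lmul[OF kernel[OF this], of "B \<beta>"]
    show "2 * of_real pi * \<i> * (exp (s * \<beta>) * B \<beta>) = contour_integral (circlepath 0 r')
        (\<lambda>\<mu>. B \<beta> * (exp (s * \<mu>) * exp \<mu> / (exp \<mu> - exp \<beta>)))"
      by (subst contour_integral_unique) (auto simp: mult_ac)
  qed
  \<comment> \<open>After the exchange the inner integral is
    \<open>exp (s * \<mu>) * exp \<mu> * W \<mu>\<close>, and the larger circle lies in
    \<open>S\<close>.\<close>
  also have "\<dots> = contour_integral (circlepath 0 r') (\<lambda>\<mu>. contour_integral (circlepath 0 r)
      (\<lambda>\<beta>. B \<beta> * (exp (s * \<mu>) * exp \<mu> / (exp \<mu> - exp \<beta>))))"
  proof (rule contour_integral_swap)
    have "continuous_on (sphere 0 r \<times> sphere 0 r') (\<lambda>x. B (fst x) * (exp (s * snd x) * exp (snd x) / (exp (snd x) - exp (fst x))))"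
      by (intro continuous_intros continuous_on_compose2[OF contB]) (use ne outer in \<open>auto simp: fst_image_times\<close>)
    then show "continuous_on (path_image (circlepath 0 r) \<times> path_image (circlepath 0 r'))
       (\<lambda>(\<beta>, \<mu>). B \<beta> * (exp (s * \<mu>) * exp \<mu> / (exp \<mu> - exp \<beta>)))"
      using r by (simp add: case_prod_unfold)
  qed (auto simp: vector_derivative_circlepath intro!: continuous_intros)
  also have "\<dots> = contour_integral (circlepath 0 r') (\<lambda>\<mu>. 0)"
  proof (rule contour_integral_eq)
    fix \<mu> assume "\<mu> \<in> path_image (circlepath 0 r')"
    then have \<mu>: "\<mu> \<in> S" using outer r by simp
    have "contour_integral (circlepath 0 r) (\<lambda>\<beta>. B \<beta> * (exp (s * \<mu>) * exp \<mu> / (exp \<mu> - exp \<beta>)))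
        = contour_integral (circlepath 0 r) (\<lambda>\<beta>. (exp (s * \<mu>) * exp \<mu>) * (B \<beta> / (exp \<mu> - exp \<beta>)))"
      by (simp add: mult_ac)
    also have "\<dots> = (exp (s * \<mu>) * exp \<mu>) * W \<mu>"
      unfolding W_def
    proof (rule contour_integral_lmul)
      show "(\<lambda>\<beta>. B \<beta> / (exp \<mu> - exp \<beta>)) contour_integrable_on circlepath 0 r"
        by (rule contour_integrable_continuous_circlepath)
           (use contB ne[OF \<mu>] r in \<open>auto intro!: continuous_intros\<close>)
    qed
    finally show "contour_integral (circlepath 0 r) (\<lambda>\<beta>. B \<beta> * (exp (s * \<mu>) * exp \<mu> / (exp \<mu> - exp \<beta>))) = 0"
      using W_zero[OF \<mu>] by simp
  qed
  finally show ?thesis by simp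
qed

section \<open>Zeros of entire functions\<close>

lemma entire_divide_root:
  assumes f: "f holomorphic_on UNIV" and z0: "f z0 = 0"
  obtains g where "g holomorphic_on UNIV" "\<And>z. f z = (z - z0) * g z"
proof
  define g where "g = (\<lambda>z. if z = z0 then deriv f z0 else f z / (z - z0))"
  show "g holomorphic_on UNIV"
    by (rule pole_theorem_open_0[OF f, of z0]) (auto simp: g_def z0)
  show "f z = (z - z0) * g z" for z by (simp add: g_def z0)
qed

lemma entire_divide_roots:
  assumes "finite Z" "f holomorphic_on UNIV" "\<And>w. w \<in> Z \<Longrightarrow> f w = 0"
  shows "\<exists>g. g holomorphic_on UNIV \<and> (\<forall>z. f z = (\<Prod>w\<in>Z. z - w) * g z)"
  using assms
proof (induction Z arbitrary: f rule: finite_induct)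
  case empty
  then show ?case by auto
next
  case (insert w Z)
  then have "f w = 0" by auto
  then obtain h where h: "h holomorphic_on UNIV" "\<And>z. f z = (z - w) * h z"
    using entire_divide_root[OF insert.prems(1)] by metis
  have "h v = 0" if "v \<in> Z" for v
    using insert.prems(2)[of v] h(2)[of v] that insert.hyps by auto
  from insert.IH[OF h(1) this] obtain g where "g holomorphic_on UNIV" "\<And>z. h z = (\<Prod>w\<in>Z. z - w) * g z" by blast
  then show ?case using insert.hyps h(2) by (intro exI[of _ g]) (simp add: mult_ac)
qed

text \<open>On the circle of radius \<open>3 * R\<close> every factor \<open>z - w\<close> has
  modulus at least \<open>2 * R\<close>, at the origin at most \<open>R\<close>. Dividing out the
  zeros and applying the maximum principle to the quotient thus gains a factor 2 per zero.\<close>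

lemma entire_zeros_bound:
  assumes f: "f holomorphic_on UNIV" and Z: "finite Z" "\<And>w. w \<in> Z \<Longrightarrow> f w = 0" "\<And>w. w \<in> Z \<Longrightarrow> norm w \<le> R"
    and R: "R > 0" and M: "\<And>z. norm z = 3 * R \<Longrightarrow> norm (f z) \<le> M"
  shows "norm (f 0) \<le> M / 2 ^ card Z"
proof -
  obtain g where g: "g holomorphic_on UNIV" "\<And>z. f z = (\<Prod>w\<in>Z. z - w) * g z"
    using entire_divide_roots[OF Z(1) f Z(2)] by blast
  have "norm ((deriv ^^ 0) g 0) \<le> fact 0 * (M / (2 * R) ^ card Z) / (3 * R) ^ 0"
  proof (rule Cauchy_inequality)
    show "g holomorphic_on ball 0 (3 * R)" using g holomorphic_on_subset by blast
    show "continuous_on (cball 0 (3 * R)) g" using g holomorphic_on_imp_continuous_on holomorphic_on_subset by blast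
    show "norm (g z) \<le> M / (2 * R) ^ card Z" if "norm (0 - z) = 3 * R" for z
    proof -
      have z: "norm z = 3 * R" using that by simp
      have "(2 * R) ^ card Z = (\<Prod>w\<in>Z. 2 * R)" by simp
      also have "\<dots> \<le> (\<Prod>w\<in>Z. norm (z - w))"
      proof (rule prod_mono)
        fix w assume "w \<in> Z"
        then have "norm w \<le> R" by (rule Z)
        then show "0 \<le> 2 * R \<and> 2 * R \<le> norm (z - w)"
          using norm_triangle_ineq2[of z w] z R by simp
      qed
      finally have "(2 * R) ^ card Z * norm (g z) \<le> (\<Prod>w\<in>Z. norm (z - w)) * norm (g z)"
        by (intro mult_right_mono) auto
      also have "\<dots> = norm (f z)" by (simp add: g(2) norm_mult prod_norm)
      also have "\<dots> \<le> M" using M z by simp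
      finally show ?thesis using R by (simp add: field_simps)
    qed
  qed (use R in auto)
  then have g0: "norm (g 0) \<le> M / (2 * R) ^ card Z" by simp
  have "norm (f 0) = (\<Prod>w\<in>Z. norm w) * norm (g 0)"
    by (simp add: g(2) norm_mult flip: prod_norm)
  also have "\<dots> \<le> (\<Prod>w\<in>Z. R) * (M / (2 * R) ^ card Z)"
    using g0 Z R by (intro mult_mono prod_mono) (auto intro: prod_nonneg)
  also have "\<dots> = M / 2 ^ card Z" using R by (simp add: power_mult_distrib)
  finally show ?thesis .
qed

text \<open>A disc of radius of order \<open>N powr \<nu>\<close> contains \<open>N\<close> zeros.
  The growth there has an exponent of order \<open>N powr (2 * \<nu>)\<close>, and with
  \<open>2 * \<nu> < 1\<close> it loses against the factor \<open>2 ^ N\<close> gained from the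
  zeros. Recentring at \<open>p\<close> gives the conclusion at any point.\<close>

lemma entire_zero_if_dense_power_zeros:
  fixes f :: "complex \<Rightarrow> complex"
  assumes f: "f holomorphic_on UNIV" and bd: "\<And>z. norm (f z) \<le> C * exp (c * (norm z)\<^sup>2)" and c: "c > 0"
    and a: "a > 0" and \<nu>: "0 < \<nu>" "\<nu> < 1 / 2" and zero: "\<And>n::nat. f (of_real (a * real n powr \<nu>)) = 0"
  shows "f p = 0"
proof -
  have C: "C \<ge> 0" using bd[of 0] norm_ge_zero[of "f 0"] by (simp del: norm_ge_zero)
  define x where "x = (\<lambda>n. a * real n powr \<nu>)"
  have inj: "inj x"
  proof (rule strict_mono_imp_inj_on, rule strict_monoI)
    fix m n :: nat assume "m < n"
    then show "x m < x n" unfolding x_def using a \<nu> by (intro mult_strict_left_mono powr_less_mono2) auto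
  qed
  define R where "R = (\<lambda>N. x N + norm p)"
  have bound: "norm (f p) \<le> C * exp (16 * c * (R N)\<^sup>2) / 2 ^ N" if N: "N > 0" for N
  proof -
    define h where "h = (\<lambda>z. f (z + p))"
    define Z where "Z = (\<lambda>n. of_real (x n) - p) ` {..<N}"
    have xN: "0 < x N" using a N by (simp add: x_def)
    then have RN: "R N > 0" by (simp add: R_def add_pos_nonneg)
    have cZ: "card Z = N"
      unfolding Z_def by (subst card_image) (auto intro!: inj_onI dest: injD[OF inj])
    have "(\<lambda>z. z + p) holomorphic_on UNIV" by (intro holomorphic_intros)
    from holomorphic_on_compose_gen[OF this f] have hh: "h holomorphic_on UNIV" by (simp add: h_def comp_def)
    have "norm (h 0) \<le> C * exp (16 * c * (R N)\<^sup>2) / 2 ^ card Z"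
    proof (rule entire_zeros_bound[OF hh, where R = "R N"])
      show "finite Z" by (simp add: Z_def)
      show "h w = 0" if "w \<in> Z" for w using that zero by (auto simp: Z_def h_def x_def)
      show "norm w \<le> R N" if "w \<in> Z" for w
      proof -
        from that obtain n where n: "n < N" "w = of_real (x n) - p" by (auto simp: Z_def)
        have "x n \<le> x N" unfolding x_def using a \<nu> n by (intro mult_left_mono powr_mono2) auto
        moreover have "0 \<le> x n" using a by (simp add: x_def)
        ultimately show ?thesis
          using norm_triangle_ineq4[of "of_real (x n)" p] by (simp add: n R_def)
      qed
      show "norm (h z) \<le> C * exp (16 * c * (R N)\<^sup>2)" if "norm z = 3 * R N" for z
      proof -
        \<comment> \<open>Since \<open>norm p \<le> R N\<close>, the circle of radius
          \<open>3 * R N\<close> about \<open>p\<close> lies in the disc of radius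
          \<open>4 * R N\<close> about the origin; this is the source of the 16.\<close>
        have "norm (z + p) \<le> 4 * R N"
          using norm_triangle_ineq[of z p] that xN by (simp add: R_def)
        then have "(norm (z + p))\<^sup>2 \<le> (4 * R N)\<^sup>2" by (intro power_mono) auto
        then have "c * (norm (z + p))\<^sup>2 \<le> 16 * c * (R N)\<^sup>2" using c by (simp add: power_mult_distrib)
        then have "C * exp (c * (norm (z + p))\<^sup>2) \<le> C * exp (16 * c * (R N)\<^sup>2)"
          using C by (intro mult_left_mono) auto
        then show ?thesis using bd[of "z + p"] by (simp add: h_def)
      qed
    qed (use RN in auto)
    then show ?thesis by (simp add: cZ h_def)
  qed
  have lim1: "(\<lambda>N. a * real N powr (\<nu> - 1/2) + norm p * real N powr (- (1/2))) \<longlonglongrightarrow> a * 0 + norm p * 0"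
    using \<nu> by (intro tendsto_intros tendsto_neg_powr filterlim_real_sequentially) auto
  have "(\<lambda>N. 16 * c * (a * real N powr (\<nu> - 1/2) + norm p * real N powr (- (1/2)))\<^sup>2) \<longlonglongrightarrow> 16 * c * (a * 0 + norm p * 0)\<^sup>2"
    by (intro tendsto_intros lim1)
  then have "(\<lambda>N. 16 * c * (a * real N powr (\<nu> - 1/2) + norm p * real N powr (- (1/2)))\<^sup>2) \<longlonglongrightarrow> 0" by simp
  \<comment> \<open>Half of \<open>ln 2\<close> is spent on growth; the other half remains as
    geometric decay.\<close>
  then have ev: "\<forall>\<^sub>F N in sequentially. 16 * c * (a * real N powr (\<nu> - 1/2) + norm p * real N powr (- (1/2)))\<^sup>2 < ln 2 / 2"
    by (rule order_tendstoD) simp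
  have "\<forall>\<^sub>F N in sequentially. norm (f p) \<le> C * exp (- (ln 2 / 2)) ^ N"
    using ev eventually_gt_at_top[of 0]
  proof eventually_elim
    case (elim N)
    have "a * real N powr (\<nu> - 1/2) + norm p * real N powr (- (1/2)) = R N * real N powr (- (1/2))"
    proof -
      have "\<nu> - 1/2 = \<nu> + - (1/2)" by simp
      then have "real N powr (\<nu> - 1/2) = real N powr \<nu> * real N powr (- (1/2))" by (simp only: powr_add)
      then show ?thesis by (simp only: R_def x_def distrib_right mult.assoc)
    qed
    then have "16 * c * (R N)\<^sup>2 * (real N powr (- (1/2)))\<^sup>2 < ln 2 / 2"
      using elim by (simp add: power_mult_distrib mult.assoc)
    moreover have "(real N powr (- (1/2)))\<^sup>2 = 1 / real N"
      unfolding power2_eq_square powr_add[symmetric] using elim by (simp add: powr_minus_divide)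
    ultimately have "16 * c * (R N)\<^sup>2 \<le> real N * (ln 2 / 2)"
      using elim by (simp add: field_simps)
    then have "C * exp (16 * c * (R N)\<^sup>2) / 2 ^ N \<le> C * exp (real N * (ln 2 / 2)) / 2 ^ N"
      using C by (intro divide_right_mono mult_left_mono) auto
    also have e2: "(2::real) ^ N = exp (real N * ln 2)" by (simp add: exp_of_nat_mult)
    also have "C * exp (real N * (ln 2 / 2)) / exp (real N * ln 2) = C * exp (real N * (- (ln 2 / 2)))"
      by (simp add: exp_diff[symmetric] algebra_simps flip: times_divide_eq_right)
    also have "\<dots> = C * exp (- (ln 2 / 2)) ^ N" by (simp only: exp_of_nat_mult)
    finally show ?case by (rule order_trans[OF bound[OF elim(2), unfolded e2]])
  qed
  moreover have "(\<lambda>N. C * exp (- (ln 2 / 2)) ^ N) \<longlonglongrightarrow> C * 0"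
    by (intro tendsto_intros LIMSEQ_power_zero) auto
  ultimately have "norm (f p) \<le> C * 0"
    by (intro tendsto_lowerbound[of "\<lambda>N. C * exp (- (ln 2 / 2)) ^ N" _ sequentially]) auto
  then show ?thesis by simp
qed

text \<open>Evenness cancels the odd Taylor terms, so \<open>K\<close> is the series of the even
  coefficients. As every complex number is a square, this series converges everywhere because that
  of \<open>f\<close> does.\<close>

lemma even_entire_factor_square:
  assumes f: "f holomorphic_on UNIV" and even: "\<And>z. f (- z) = f z"
  obtains K where "K holomorphic_on UNIV" "\<And>z. f z = K (z\<^sup>2 :: complex)"
proof -
  define A where "A = (\<lambda>n. (deriv ^^ n) f 0 / fact n)"
  have ps: "(\<lambda>n. A n * z ^ n) sums f z" for z
    using holomorphic_power_series[of f 0 "norm z + 1" z] f holomorphic_on_subset by (auto simp: A_def)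
  have ps2: "(\<lambda>n. A (2 * n) * (z\<^sup>2) ^ n) sums f z" for z
  proof -
    have "(\<lambda>n. (A n * z ^ n + A n * (- z) ^ n) / 2) sums ((f z + f (- z)) / 2)"
      by (intro sums_divide sums_add ps)
    then have s: "(\<lambda>n. (A n * z ^ n + A n * (- z) ^ n) / 2) sums f z" by (simp add: even)
    have "(\<lambda>n. (A (2 * n) * z ^ (2 * n) + A (2 * n) * (- z) ^ (2 * n)) / 2) sums f z"
    proof (subst sums_mono_reindex[of "\<lambda>n. 2 * n"])
      show "(A n * z ^ n + A n * (- z) ^ n) / 2 = 0" if "n \<notin> range (\<lambda>n. 2 * n)" for n
      proof -
        have "odd n" using that by (auto elim!: evenE)
        then show ?thesis by simp
      qed
    qed (use s in \<open>auto simp: strict_mono_def\<close>)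
    then show ?thesis by (simp add: power_mult)
  qed
  define K where "K = (\<lambda>s. suminf (\<lambda>n. A (2 * n) * s ^ n))"
  have Ks: "(\<lambda>n. A (2 * n) * s ^ n) sums K s" for s
    using ps2[of "csqrt s"] by (auto simp: K_def sums_iff)
  have "K holomorphic_on ball 0 R" for R
    using power_series_holomorphic[of 0 R "\<lambda>n. A (2 * n)" K] Ks by auto
  then have "K field_differentiable at z" for z
    by (meson centre_in_ball dist_0_norm holomorphic_on_imp_differentiable_at lessI less_add_one mem_ball open_ball)
  then have "K holomorphic_on UNIV" by (auto simp: holomorphic_on_def)
  moreover have "f z = K (z\<^sup>2)" for z
    using ps2[of z] Ks[of "z\<^sup>2"] sums_unique2 by blast
  ultimately show thesis using that by blast
qed

text \<open>Trades a linear factor for an arbitrarily small increase of the exponential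
  rate.\<close>

lemma linear_le_exp: "d > 0 \<Longrightarrow> x \<ge> 0 \<Longrightarrow> y \<ge> 0 \<Longrightarrow> 1 + y * x \<le> (1 + y / d) * exp (d * x :: real)"
proof -
  assume "d > 0" "x \<ge> 0" "y \<ge> 0"
  then have "1 + y * x \<le> (1 + y / d) * (1 + d * x)" by (simp add: field_simps)
  also have "\<dots> \<le> (1 + y / d) * exp (d * x)"
    using \<open>d > 0\<close> \<open>y \<ge> 0\<close> exp_ge_add_one_self[of "d * x"] by (intro mult_left_mono) (auto simp: add_nonneg_nonneg)
  finally show ?thesis .
qed

text \<open>Carlson's theorem applied to the even functions \<open>f z + f (-z)\<close> and \<open>z * (f z - f (-z))\<close>,
  read as functions of \<open>z\<^sup>2\<close>.\<close>

lemma entire_zero_if_sqrt_zeros: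
  assumes f: "f holomorphic_on UNIV" and bd: "\<And>z. norm (f z) \<le> C * exp (pi * (norm z)\<^sup>2)"
    and a: "0 < a" "a < 1"
    and zero: "\<And>n::nat. f (of_real (a * sqrt (real n))) = 0" "\<And>n::nat. f (- of_real (a * sqrt (real n))) = 0"
  shows "f z = 0"
proof -
  have C: "C \<ge> 0" using bd[of 0] norm_ge_zero[of "f 0"] by (simp del: norm_ge_zero)
  have a2: "0 < a\<^sup>2" "a\<^sup>2 < 1" using a by (auto simp: power_less_one_iff abs_square_less_1)
  \<comment> \<open>Half the gap between the type \<open>pi * a\<^sup>2\<close> of the rescaled
    function and Carlson's bound \<open>pi\<close>; it pays for the polynomial factor in
    \<open>key\<close>.\<close>
  define d where "d = pi * (1 - a\<^sup>2) / 2"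
  have d: "d > 0" using a2 by (simp add: d_def)
  have pd: "0 < pi * a\<^sup>2 + d" using d a2 by (simp add: add_pos_pos)
  have "(1 + a\<^sup>2) / 2 < 1" using a2 by simp
  then have "pi * ((1 + a\<^sup>2) / 2) < pi * 1" by (intro mult_strict_left_mono) auto
  moreover have "pi * a\<^sup>2 + d = pi * ((1 + a\<^sup>2) / 2)" by (simp add: d_def field_simps)
  ultimately have cpi: "pi * a\<^sup>2 + d < pi" by (simp only: mult_1_right)
  \<comment> \<open>The factor \<open>1 + (norm z)\<^sup>2\<close> in the growth bound is there for
    the odd part of \<open>f\<close>, which is multiplied by \<open>z\<close> to become
    even.\<close>
  have key: "g z = 0"
    if g: "g holomorphic_on UNIV" "\<And>z. g (- z) = g z" "\<And>z. norm (g z) \<le> D * (1 + (norm z)\<^sup>2) * exp (pi * (norm z)\<^sup>2)"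
      and D: "D \<ge> 0" and g0: "\<And>n::nat. g (of_real (a * sqrt (real n))) = 0" for g D z
  proof -
    obtain K where K: "K holomorphic_on UNIV" "\<And>z. g z = K (z\<^sup>2)"
      using even_entire_factor_square[OF g(1,2)] by metis
    \<comment> \<open>Scaling by \<open>a\<^sup>2\<close> moves the squared samples
      \<open>a\<^sup>2 * n\<close> to the natural numbers.\<close>
    have K': "(\<lambda>s. K (of_real (a\<^sup>2) * s)) holomorphic_on UNIV"
    proof -
      have "(\<lambda>s. of_real (a\<^sup>2) * s) holomorphic_on UNIV" by (intro holomorphic_intros)
      from holomorphic_on_compose_gen[OF this K(1)] show ?thesis by (simp add: comp_def)
    qed
    have "K (of_real (a\<^sup>2) * s) = 0" for s
    proof (rule Carlson_entire[OF K' _ pd cpi])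
      fix s
      define w where "w = csqrt (of_real (a\<^sup>2) * s)"
      have w2: "w\<^sup>2 = of_real (a\<^sup>2) * s" by (simp add: w_def)
      have nw: "(norm w)\<^sup>2 = a\<^sup>2 * norm s" unfolding norm_power[symmetric] w2 by (simp add: norm_mult norm_power)
      have le: "1 + a\<^sup>2 * norm s \<le> (1 + a\<^sup>2 / d) * exp (d * norm s)"
        using linear_le_exp[OF d, of "norm s" "a\<^sup>2"] by simp
      have "norm (K (of_real (a\<^sup>2) * s)) \<le> D * (1 + a\<^sup>2 * norm s) * exp (pi * (a\<^sup>2 * norm s))"
        using g(3)[of w] unfolding K(2) w2 nw .
      also have "\<dots> \<le> D * ((1 + a\<^sup>2 / d) * exp (d * norm s)) * exp (pi * (a\<^sup>2 * norm s))"
        using le D by (intro mult_right_mono mult_left_mono) auto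
      also have "\<dots> = D * (1 + a\<^sup>2 / d) * exp ((pi * a\<^sup>2 + d) * norm s)"
        by (simp add: exp_add algebra_simps)
      finally show "norm (K (of_real (a\<^sup>2) * s)) \<le> D * (1 + a\<^sup>2 / d) * exp ((pi * a\<^sup>2 + d) * norm s)" .
    next
      fix n :: nat
      have "(complex_of_real (a * sqrt (real n)))\<^sup>2 = of_real (a\<^sup>2) * of_nat n"
        by (simp add: power_mult_distrib flip: of_real_power)
      then show "K (of_real (a\<^sup>2) * of_nat n) = 0" using K(2)[of "of_real (a * sqrt (real n))"] g0[of n] by simp
    qed
    from this[of "z\<^sup>2 / of_real (a\<^sup>2)"] show ?thesis using K(2)[of z] a by simp
  qed
  have minus: "(\<lambda>z. f (- z)) holomorphic_on UNIV"
  proof -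
    have "(\<lambda>z::complex. - z) holomorphic_on UNIV" by (intro holomorphic_intros)
    from holomorphic_on_compose_gen[OF this f] show ?thesis by (simp add: comp_def)
  qed
  have nbd: "norm (f z) + norm (f (- z)) \<le> 2 * C * exp (pi * (norm z)\<^sup>2)" for z
    using bd[of z] bd[of "- z"] by simp
  have 1: "f z + f (- z) = 0" for z
  proof (rule key[of "\<lambda>z. f z + f (- z)" "2 * C"])
    show "norm (f z + f (- z)) \<le> 2 * C * (1 + (norm z)\<^sup>2) * exp (pi * (norm z)\<^sup>2)" for z
    proof -
      have "norm (f z + f (- z)) \<le> 2 * C * 1 * exp (pi * (norm z)\<^sup>2)"
        using norm_triangle_ineq[of "f z" "f (- z)"] nbd[of z] by simp
      also have "\<dots> \<le> 2 * C * (1 + (norm z)\<^sup>2) * exp (pi * (norm z)\<^sup>2)"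
        using C by (intro mult_right_mono mult_left_mono) auto
      finally show ?thesis .
    qed
  qed (use f minus C zero in \<open>auto intro!: holomorphic_intros\<close>)
  have 2: "z * (f z - f (- z)) = 0" for z
  proof (rule key[of "\<lambda>z. z * (f z - f (- z))" "2 * C"])
    show "norm (z * (f z - f (- z))) \<le> 2 * C * (1 + (norm z)\<^sup>2) * exp (pi * (norm z)\<^sup>2)" for z
    proof -
      have "0 \<le> (norm z - 1)\<^sup>2 + (norm z)\<^sup>2 + 1" by (simp add: add_nonneg_nonneg)
      then have nz: "norm z \<le> 1 + (norm z)\<^sup>2" by (simp add: power2_diff)
      have "norm (f z - f (- z)) \<le> 2 * C * exp (pi * (norm z)\<^sup>2)"
        using norm_triangle_ineq4[of "f z" "f (- z)"] nbd[of z] by simp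
      then have "norm z * norm (f z - f (- z)) \<le> (1 + (norm z)\<^sup>2) * (2 * C * exp (pi * (norm z)\<^sup>2))"
        using nz by (intro mult_mono) auto
      then show ?thesis by (simp only: norm_mult mult_ac)
    qed
  qed (use f minus C zero in \<open>auto intro!: holomorphic_intros simp: algebra_simps\<close>)
  show ?thesis
  proof (cases "z = 0")
    case True
    then show ?thesis using 1[of 0] by simp
  next
    case False
    then have "f z = f (- z)" using 2[of z] by simp
    then show ?thesis using 1[of z] by simp
  qed
qed

text \<open>A canonical product of genus zero: summability of the reciprocals makes the product of
  \<open>1 - s / x n\<close> converge. The factors beyond a large index contribute at most
  \<open>exp (\<epsilon> / 2 * norm s)\<close> altogether, and finitely many linear factors can be
  absorbed at any small rate.\<close>

lemma entire_with_zeros_exp_type_zero: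
  fixes x :: "nat \<Rightarrow> complex"
  assumes nz: "\<And>n. x n \<noteq> 0" and sum: "summable (\<lambda>n. 1 / norm (x n))"
  obtains P where "P holomorphic_on UNIV" "P 0 = 1" "\<And>n. P (x n) = 0"
    "\<And>\<epsilon>. \<epsilon> > 0 \<Longrightarrow> \<exists>C. \<forall>s. norm (P s) \<le> C * exp (\<epsilon> * norm s)"
proof -
  define p where "p = (\<lambda>N s. \<Prod>n<N. 1 + (- s / x n))"
  define P where "P = (\<lambda>s. lim (\<lambda>N. p N s))"
  have ul: "uniform_limit (cball 0 R) p P sequentially" for R
  proof -
    have "uniformly_convergent_on (cball 0 R) p"
      unfolding p_def
    proof (rule uniformly_convergent_on_prod)
      show "uniformly_convergent_on (cball 0 R) (\<lambda>N s. \<Sum>n<N. norm (- s / x n))"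
      proof (rule Weierstrass_m_test'[where M = "\<lambda>n. R * (1 / norm (x n))"])
        show "norm (norm (- s / x n)) \<le> R * (1 / norm (x n))" if "s \<in> cball 0 R" for n s
          using that nz[of n] by (simp add: norm_divide divide_right_mono)
      qed (intro summable_mult sum)
    qed (auto intro!: continuous_intros nz)
    then show ?thesis
      unfolding P_def using uniformly_convergent_uniform_limit_iff by blast
  qed
  have lim: "(\<lambda>N. p N s) \<longlonglongrightarrow> P s" for s
    using tendsto_uniform_limitI[OF ul[of "norm s"], of s] by simp
  show thesis
  proof
    show "P holomorphic_on UNIV"
    proof (rule holomorphic_uniform_sequence)
      show "p n holomorphic_on UNIV" for n
        unfolding p_def by (intro holomorphic_intros) (use nz in auto)
      show "\<exists>d>0. cball s d \<subseteq> UNIV \<and> uniform_limit (cball s d) p P sequentially" for s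
      proof (intro exI[of _ 1] conjI)
        have "cball s 1 \<subseteq> cball 0 (norm s + 1)" 
        proof
          fix z assume "z \<in> cball s 1"
          then show "z \<in> cball 0 (norm s + 1)"
            using norm_triangle_ineq2[of z s] by (simp add: dist_norm norm_minus_commute)
        qed
        then show "uniform_limit (cball s 1) p P sequentially"
          using ul uniform_limit_on_subset by blast
      qed auto
    qed auto
    show "P 0 = 1" using lim[of 0] by (simp add: p_def LIMSEQ_const_iff)
    show "P (x n) = 0" for n
    proof -
      have "\<forall>\<^sub>F N in sequentially. p N (x n) = 0"
        using eventually_gt_at_top[of n] by eventually_elim (use nz[of n] in \<open>auto simp: p_def intro!: bexI[of _ n]\<close>)
      then have "(\<lambda>N. p N (x n)) \<longlonglongrightarrow> 0" by (rule tendsto_eventually)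
      then show ?thesis using lim LIMSEQ_unique by blast
    qed
    show "\<exists>C. \<forall>s. norm (P s) \<le> C * exp (\<epsilon> * norm s)" if \<epsilon>: "\<epsilon> > 0" for \<epsilon>
    proof -
      define y where "y = (\<lambda>n. 1 / norm (x n))"
      have y0: "y n \<ge> 0" for n by (simp add: y_def)
      obtain m where m: "\<And>N. N \<ge> m \<Longrightarrow> sum y {m..<N} < \<epsilon> / 2"
      proof -
        have "\<exists>m. \<forall>k\<ge>m. \<forall>n. norm (sum y {k..<n}) < \<epsilon> / 2"
          using sum \<epsilon> unfolding summable_Cauchy y_def by (meson half_gt_zero)
        then obtain m where "\<And>n. norm (sum y {m..<n}) < \<epsilon> / 2" by blast
        then have "sum y {m..<N} < \<epsilon> / 2" for N by (smt (verit) real_norm_def)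
        then show thesis using that[of m] by blast
      qed
      \<comment> \<open>The \<open>m\<close> leading factors, at rate \<delta> each, cost at most
        \<open>\<epsilon> / 2\<close>; the added 1 covers \<open>m = 0\<close>.\<close>
      define \<delta> where "\<delta> = \<epsilon> / (2 * (real m + 1))"
      have \<delta>: "\<delta> > 0" "real m * \<delta> \<le> \<epsilon> / 2" using \<epsilon> by (auto simp: \<delta>_def field_simps)
      define C where "C = (\<Prod>n<m. 1 + y n / \<delta>)"
      have C0: "C \<ge> 0" unfolding C_def by (intro prod_nonneg) (auto intro!: add_nonneg_nonneg divide_nonneg_pos y0 \<delta>)
      have "norm (P s) \<le> C * exp (\<epsilon> * norm s)" for s
      proof (rule tendsto_upperbound[OF tendsto_norm[OF lim[of s]]])
        show "\<forall>\<^sub>F N in sequentially. norm (p N s) \<le> C * exp (\<epsilon> * norm s)"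
          using eventually_ge_at_top[of m]
        proof eventually_elim
          case (elim N)
          have n1: "norm (1 + (- s / x n)) \<le> 1 + y n * norm s" for n
            using norm_triangle_ineq[of 1 "- s / x n"] by (simp add: y_def norm_divide)
          have "norm (p N s) \<le> (\<Prod>n<N. 1 + y n * norm s)"
            unfolding p_def prod_norm[symmetric] by (intro prod_mono) (use n1 in auto)
          also have "{..<N} = {..<m} \<union> {m..<N}" using elim by auto
          also have "(\<Prod>n\<in>{..<m} \<union> {m..<N}. 1 + y n * norm s) = (\<Prod>n<m. 1 + y n * norm s) * (\<Prod>n=m..<N. 1 + y n * norm s)"
            by (rule prod.union_disjoint) auto
          also have "\<dots> \<le> (\<Prod>n<m. (1 + y n / \<delta>) * exp (\<delta> * norm s)) * (\<Prod>n=m..<N. exp (y n * norm s))"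
          proof (intro mult_mono prod_mono conjI)
            show "1 + y n * norm s \<le> (1 + y n / \<delta>) * exp (\<delta> * norm s)" for n
              using linear_le_exp[OF \<delta>(1), of "norm s" "y n"] y0 by simp
            show "1 + y n * norm s \<le> exp (y n * norm s)" for n by (rule exp_ge_add_one_self)
          qed (auto intro!: prod_nonneg add_nonneg_nonneg mult_nonneg_nonneg divide_nonneg_pos y0 \<delta>)
          also have "(\<Prod>n<m. (1 + y n / \<delta>) * exp (\<delta> * norm s)) = C * exp (real m * \<delta> * norm s)"
            by (simp add: C_def prod.distrib exp_of_nat_mult[symmetric] mult.assoc)
          also have "(\<Prod>n=m..<N. exp (y n * norm s)) = exp (sum y {m..<N} * norm s)"
            by (simp add: exp_sum sum_distrib_right)
          also have "C * exp (real m * \<delta> * norm s) * exp (sum y {m..<N} * norm s)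
              = C * exp ((real m * \<delta> + sum y {m..<N}) * norm s)"
            by (simp add: exp_add distrib_right)
          also have "\<dots> \<le> C * exp (\<epsilon> * norm s)"
          proof -
            have "real m * \<delta> + sum y {m..<N} \<le> \<epsilon>" using \<delta>(2) m[OF elim] by linarith
            then show ?thesis using C0 by (intro mult_left_mono) (auto intro!: mult_right_mono)
          qed
          finally show ?case .
        qed
      qed auto
      then show ?thesis by blast
    qed
  qed
qed

section \<open>Reflections in two lines\<close>

text \<open>A punctured disc about the origin is stable under all reflections and rotations that fix
  the origin, which makes it the right domain for a quotient of entire functions; the origin itself
  may be a zero.\<close>

lemma entire_nonzero_punctured_disc:
  assumes "f holomorphic_on UNIV" "f w0 \<noteq> 0"
  obtains r where "r > 0" "\<And>z. 0 < norm z \<Longrightarrow> norm z < r \<Longrightarrow> f z \<noteq> (0::complex)"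
proof (cases "f 0 = 0")
  case True
  obtain r where "0 < r" "\<And>z. z \<in> ball 0 r - {0} \<Longrightarrow> f z \<noteq> 0"
    using isolated_zeros[OF assms(1) _ _ _ True _ assms(2)] by (metis UNIV_I connected_UNIV open_UNIV)
  then show thesis by (intro that[of r]) auto
next
  case False
  have "isCont f 0" using holomorphic_on_imp_continuous_on[OF assms(1)] continuous_on_eq_continuous_at[OF open_UNIV] by blast
  then obtain r where "r > 0" "\<forall>y. dist 0 y < r \<longrightarrow> f y \<noteq> 0"
    using continuous_at_avoid[of 0 f 0] False by auto
  then show thesis by (intro that[of r]) auto
qed

text \<open>The quotient of the two functions is invariant under the product of the two reflections,
  an irrational rotation; hence it is constant on circles around the origin and, because of its
  values on the fixed line of a reflection, of modulus one.\<close>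

lemma unimodular_multiple_if_reflected_products_eq:
  fixes H1 H2 :: "complex \<Rightarrow> complex" and a1 a2 :: real
  assumes hol: "H1 holomorphic_on UNIV" "H2 holomorphic_on UNIV"
    and irr: "(a1 - a2) / pi \<notin> \<rat>"
    and eq: "\<And>a w. a \<in> {a1, a2} \<Longrightarrow>
      H1 w * cnj (H1 (cis (2 * a) * cnj w)) = H2 w * cnj (H2 (cis (2 * a) * cnj w))"
  shows "\<exists>\<alpha>::real. \<forall>w. H1 w = exp (\<i> * of_real \<alpha>) * H2 w"
proof (cases "\<forall>w. H2 w = 0")
  case True
  have "H1 w = 0" for w
  proof (rule ccontr)
    assume "H1 w \<noteq> 0"
    then obtain r where r: "r > 0" "\<And>z. 0 < norm z \<Longrightarrow> norm z < r \<Longrightarrow> H1 z \<noteq> 0"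
      using entire_nonzero_punctured_disc[OF hol(1)] by metis
    define z where "z = complex_of_real (r/2)"
    have "H1 z \<noteq> 0" "H1 (cis (2 * a1) * cnj z) \<noteq> 0" using r by (auto simp: z_def norm_mult intro!: r(2))
    then show False using eq[of a1 z] True by auto
  qed
  then show ?thesis using True by auto
next
  case False
  then obtain w0 where "H2 w0 \<noteq> 0" by blast
  then obtain r where r: "r > 0" "\<And>z. 0 < norm z \<Longrightarrow> norm z < r \<Longrightarrow> H2 z \<noteq> 0"
    using entire_nonzero_punctured_disc[OF hol(2)] by metis
  define A where "A = {z::complex. 0 < norm z \<and> norm z < r}"
  define Q where "Q = (\<lambda>w. H1 w / H2 w)"
  define \<sigma> where "\<sigma> = (\<lambda>a w. cis (2 * a) * cnj w)"
  have \<sigma>A: "\<sigma> a w \<in> A" if "w \<in> A" for a w using that by (simp add: A_def \<sigma>_def norm_mult)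
  have Q1: "Q w * cnj (Q (\<sigma> a w)) = 1" if "w \<in> A" "a \<in> {a1, a2}" for a w
    using eq[OF that(2), of w] r(2)[of w] r(2)[of "\<sigma> a w"] \<sigma>A[OF that(1), of a] that(1)
    by (simp add: Q_def \<sigma>_def A_def)
  \<comment> \<open>The relations for both reflections, taken at the point
    \<open>\<sigma> a2 w\<close>, share the factor \<open>Q (\<sigma> a2 w)\<close>; cancelling it
    leaves the composite of the two reflections.\<close>
  have rot: "Q (cis (2 * (a1 - a2)) * w) = Q w" if w: "w \<in> A" for w
  proof -
    have "\<sigma> a1 (\<sigma> a2 w) = cis (2 * (a1 - a2)) * w"
    proof -
      have "\<sigma> a1 (\<sigma> a2 w) = (cis (2 * a1) * cis (- (2 * a2))) * w"
        by (simp add: \<sigma>_def cis_cnj mult.assoc)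
      also have "cis (2 * a1) * cis (- (2 * a2)) = cis (2 * (a1 - a2))"
        by (simp add: cis_mult algebra_simps)
      finally show ?thesis .
    qed
    moreover have "\<sigma> a2 (\<sigma> a2 w) = w" by (simp add: \<sigma>_def cis_cnj mult.assoc[symmetric] cis_mult)
    ultimately have "Q (\<sigma> a2 w) * cnj (Q (cis (2 * (a1 - a2)) * w)) = 1" "Q (\<sigma> a2 w) * cnj (Q w) = 1"
      using Q1[OF \<sigma>A[OF w, of a2], of a1] Q1[OF \<sigma>A[OF w, of a2], of a2] by simp_all
    then have "cnj (Q (cis (2 * (a1 - a2)) * w)) = cnj (Q w)"
      by (metis mult_left_cancel mult_zero_left zero_neq_one)
    then show ?thesis by simp
  qed
  have rotn: "Q (cis (2 * (a1 - a2)) ^ n * w) = Q w" if w: "w \<in> A" for w n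
  proof (induction n)
    case (Suc n)
    have "cis (2 * (a1 - a2)) ^ n * w \<in> A" using w by (simp add: A_def norm_mult norm_power)
    from rot[OF this] Suc show ?case by (simp add: mult.assoc)
  qed simp
  have hQ: "Q holomorphic_on A"
    unfolding Q_def using r hol by (intro holomorphic_on_divide) (auto simp: A_def elim: holomorphic_on_subset)
  have "A = ball 0 r - {0}" by (auto simp: A_def)
  then have oA: "open A" by (simp add: open_Diff)
  have mod1: "norm (Q w) = 1" if w: "w \<in> A" for w
  proof -
    \<comment> \<open>The point of modulus \<open>norm w\<close> on the line fixed by
      \<open>\<sigma> a1\<close>, where the relation reads
      \<open>(norm (Q v))\<^sup>2 = 1\<close>.\<close>
    define v where "v = of_real (norm w) * cis a1"
    have vA: "v \<in> A" using w by (simp add: v_def A_def norm_mult)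
    have "\<sigma> a1 v = v" by (simp add: \<sigma>_def v_def cis_cnj cis_mult mult.left_commute)
    then have "Q v * cnj (Q v) = 1" using Q1[OF vA, of a1] by simp
    then have "complex_of_real ((norm (Q v))\<^sup>2) = of_real 1" unfolding complex_norm_square by simp
    then have "norm (Q v) ^ 2 = 1" unfolding of_real_eq_iff .
    then have v1: "norm (Q v) = 1" using power2_eq_imp_eq[of "norm (Q v)" 1] by simp
    \<comment> \<open>The angle from \<open>v\<close> to \<open>w\<close> in full turns. Fractional
      parts of multiples of the irrational number \<open>(a1 - a2) / pi\<close> approximate it:
      \<open>h\<close> discards full turns, and \<open>k > 0\<close> makes the multiples powers of
      the rotation, so the orbit of \<open>v\<close> accumulates at \<open>w\<close>.\<close>
    define \<alpha> where "\<alpha> = (Arg w - a1) / (2 * pi)"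
    have "\<exists>h k::int. k > 0 \<and> \<bar>of_int k * ((a1 - a2) / pi) - of_int h - \<alpha>\<bar> < 1 / Suc n" for n :: nat
      by (rule sequence_of_fractional_parts_is_dense[OF irr, of "1 / Suc n" \<alpha>]) (simp, blast)
    then obtain h k :: "nat \<Rightarrow> int" where k: "\<And>n. k n > 0"
      and kh: "\<And>n. \<bar>of_int (k n) * ((a1 - a2) / pi) - of_int (h n) - \<alpha>\<bar> < 1 / Suc n" by metis
    define y where "y = (\<lambda>n. of_int (k n) * ((a1 - a2) / pi) - of_int (h n))"
    have "y \<longlonglongrightarrow> \<alpha>"
    proof (rule LIMSEQ_I)
      fix e :: real assume "e > 0"
      then obtain N where N: "1 / Suc N < e" using nat_approx_posE by blast
      have "norm (y n - \<alpha>) < e" if "n \<ge> N" for n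
      proof -
        have "norm (y n - \<alpha>) < 1 / Suc n" using kh[of n] by (simp add: y_def)
        also have "\<dots> \<le> 1 / Suc N" using that by (simp add: frac_le)
        finally show ?thesis using N by simp
      qed
      then show "\<exists>no. \<forall>n\<ge>no. norm (y n - \<alpha>) < e" by blast
    qed
    define x where "x = (\<lambda>n. of_real (norm w) * cis (a1 + 2 * pi * y n))"
    have "x \<longlonglongrightarrow> of_real (norm w) * cis (a1 + 2 * pi * \<alpha>)"
      unfolding x_def cis_conv_exp using \<open>y \<longlonglongrightarrow> \<alpha>\<close> by (intro tendsto_intros)
    also have "of_real (norm w) * cis (a1 + 2 * pi * \<alpha>) = w"
      using w by (simp add: \<alpha>_def A_def cis_Arg sgn_eq)
    finally have xw: "x \<longlonglongrightarrow> w" .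
    have Qx: "Q (x n) = Q v" for n
    proof -
      have "x n = of_real (norm w) * (cis (a1 + of_int (k n) * (2 * (a1 - a2))) * cis (2 * pi * of_int (- h n)))"
      proof -
        have eq: "2 * pi * y n = of_int (k n) * (2 * (a1 - a2)) + 2 * pi * of_int (- h n)"
          by (simp add: y_def field_simps)
        show ?thesis unfolding x_def cis_mult eq by (simp only: add.assoc)
      qed
      also have "cis (2 * pi * of_int (- h n)) = 1" by (rule cis_multiple_2pi) auto
      also have "cis (a1 + of_int (k n) * (2 * (a1 - a2))) = cis (2 * (a1 - a2)) ^ nat (k n) * cis a1"
      proof -
        have rk: "real (nat (k n)) = of_int (k n)" using k[of n] by simp
        show ?thesis unfolding Complex.DeMoivre cis_mult rk by (simp only: add.commute)
      qed
      finally have "x n = cis (2 * (a1 - a2)) ^ nat (k n) * v" by (simp add: v_def)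
      then show ?thesis using rotn[OF vA] by simp
    qed
    have "isCont Q w" using hQ oA w holomorphic_on_imp_continuous_on continuous_on_eq_continuous_at by blast
    then have "(\<lambda>n. Q (x n)) \<longlonglongrightarrow> Q w" using xw isCont_tendsto_compose by blast
    then have "Q w = Q v" unfolding Qx using LIMSEQ_unique tendsto_const by blast
    then show ?thesis using v1 by simp
  qed
  \<comment> \<open>A disc in \<open>A\<close>, clear of the origin. Constant modulus forces
    \<open>Q\<close> to be constant there, and the identity theorem carries
    \<open>H1 = c * H2\<close> to the whole plane, including the zeros of \<open>H2\<close>.\<close>
  define B where "B = ball (complex_of_real (r/2)) (r/4)"
  have BA: "B \<subseteq> A"
  proof
    fix z assume "z \<in> B"
    then have "norm (of_real (r/2) - z) < r/4" by (simp add: B_def dist_norm)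
    moreover have "norm (complex_of_real (r/2)) = r/2" using r by (simp only: norm_of_real)
    ultimately show "z \<in> A"
      using norm_triangle_ineq2[of "of_real (r/2)" z] norm_triangle_ineq3[of "of_real (r/2)" z] r by (auto simp: A_def)
  qed
  have cB: "of_real (r/2) \<in> B" using r by (simp add: B_def)
  have "Q constant_on B"
  proof (rule maximum_modulus_principle[where U = B])
    show "Q holomorphic_on B" using hQ BA holomorphic_on_subset by blast
    show "norm (Q z) \<le> norm (Q (of_real (r/2)))" if "z \<in> B" for z
      using mod1[OF subsetD[OF BA that]] mod1[OF subsetD[OF BA cB]] by simp
  qed (use cB in \<open>auto simp: B_def\<close>)
  then obtain c where c: "\<And>z. z \<in> B \<Longrightarrow> Q z = c" by (auto simp: constant_on_def)
  have nc: "norm c = 1" using mod1[OF subsetD[OF BA cB]] c[OF cB] by simp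
  have H: "H1 w = c * H2 w" for w
  proof (rule analytic_continuation_open[of B UNIV H1 "\<lambda>w. c * H2 w"])
    show "H1 z = c * H2 z" if "z \<in> B" for z
      using c[OF that] r(2)[of z] BA that by (auto simp: Q_def A_def field_simps)
  qed (use cB hol in \<open>auto simp: B_def intro!: holomorphic_intros\<close>)
  have "c \<noteq> 0" using nc by auto
  then have e: "exp (\<i> * of_real (Arg c)) = c"
    using cis_Arg[of c] nc by (simp add: cis_conv_exp sgn_eq)
  show ?thesis by (intro exI[of _ "Arg c"] allI) (simp only: e H)
qed

section \<open>The Bargmann transform\<close>

lemma integrable_lebesgueI: "integrable lborel g \<Longrightarrow> integrable lebesgue (g :: real \<Rightarrow> 'b :: {banach, second_countable_topology})"
  by (simp add: integrable_completion borel_measurable_integrable)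

text \<open>Up to a weight this is the Bargmann transform; the point \<open>(t, \<omega>)\<close> of the time-frequency plane
  corresponds to \<open>w = t - \<i> \<omega>\<close>.\<close>

definition bargmann :: "(real \<Rightarrow> complex) \<Rightarrow> complex \<Rightarrow> complex" where
  "bargmann f w = (LINT x|lebesgue. f x * exp (- of_real pi * (of_real x)\<^sup>2 + (2 * of_real pi * w) * of_real x))
     * exp (- of_real pi / 2 * w\<^sup>2)"

text \<open>The cross term of \<open>(x - t)\<^sup>2\<close> and the modulation combine into
  \<open>2 * pi * w * x\<close>, which is holomorphic in \<open>w\<close>; the remaining factors do
  not depend on \<open>x\<close>. This fixes the sign in
  \<open>w = t - \<i> * \<omega>\<close>.\<close>

lemma gabor_transform_bargmann:
  "gabor_transform f t \<omega> = exp (of_real pi / 2 * (Complex t (- \<omega>))\<^sup>2 - of_real pi * (of_real t)\<^sup>2) * bargmann f (Complex t (- \<omega>))"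
proof -
  define w where "w = Complex t (- \<omega>)"
  have w: "w = of_real t - \<i> * of_real \<omega>" by (simp add: w_def complex_eq_iff)
  have "f x * complex_of_real (gaussian (x - t)) * exp (- (2 * complex_of_real pi * \<i> * complex_of_real x * complex_of_real \<omega>))
     = exp (- of_real pi * (of_real t)\<^sup>2) * (f x * exp (- of_real pi * (of_real x)\<^sup>2 + (2 * of_real pi * w) * of_real x))" for x
  proof -
    have "complex_of_real (gaussian (x - t)) = exp (- of_real pi * (of_real x - of_real t)\<^sup>2)"
      by (simp add: gaussian_def exp_of_real[symmetric])
    then have "complex_of_real (gaussian (x - t)) * exp (- (2 * complex_of_real pi * \<i> * complex_of_real x * complex_of_real \<omega>))
       = exp (- of_real pi * (of_real x - of_real t)\<^sup>2 + - (2 * complex_of_real pi * \<i> * complex_of_real x * complex_of_real \<omega>))"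
      by (simp only: exp_add)
    also have "- of_real pi * (of_real x - of_real t)\<^sup>2 + - (2 * complex_of_real pi * \<i> * complex_of_real x * complex_of_real \<omega>)
        = - of_real pi * (of_real t)\<^sup>2 + (- of_real pi * (of_real x)\<^sup>2 + (2 * of_real pi * w) * of_real x)"
      by (simp add: w power2_diff algebra_simps)
    finally show ?thesis by (simp only: exp_add mult_ac)
  qed
  then have "gabor_transform f t \<omega> = exp (- of_real pi * (of_real t)\<^sup>2) *
     (LINT x|lebesgue. f x * exp (- of_real pi * (of_real x)\<^sup>2 + (2 * of_real pi * w) * of_real x))"
    unfolding gabor_transform_def by (simp only: integral_mult_right_zero)
  also have "\<dots> = exp (of_real pi / 2 * w\<^sup>2 - of_real pi * (of_real t)\<^sup>2) * bargmann f w"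
  proof -
    have "exp (- of_real pi * (of_real t)\<^sup>2) = exp (of_real pi / 2 * w\<^sup>2 - of_real pi * (of_real t)\<^sup>2) * exp (- of_real pi / 2 * w\<^sup>2)"
      by (simp only: exp_add[symmetric]) simp
    then show ?thesis by (simp only: bargmann_def mult_ac)
  qed
  finally show ?thesis by (simp only: w_def)
qed

lemma norm_gabor_transform:
  "norm (gabor_transform f t \<omega>) = exp (- (pi / 2) * (norm (Complex t (- \<omega>)))\<^sup>2) * norm (bargmann f (Complex t (- \<omega>)))"
proof -
  have "Re (of_real pi / 2 * (Complex t (- \<omega>))\<^sup>2 - of_real pi * (of_real t)\<^sup>2) = - (pi / 2) * (norm (Complex t (- \<omega>)))\<^sup>2"
    unfolding cmod_power2 by (simp add: power2_eq_square field_simps)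
  then show ?thesis by (simp only: gabor_transform_bargmann norm_mult norm_exp_eq_Re)
qed

text \<open>A pointwise stand-in for the Cauchy-Schwarz inequality, which supplies integrable
  majorants for products of two square integrable functions.\<close>

lemma norm_mult_le_sum_squares: "norm (u * v :: complex) \<le> ((norm u)\<^sup>2 + (norm v)\<^sup>2) / 2"
  using sum_squares_bound[of "norm u" "norm v"] by (simp add: norm_mult)

lemma norm_exp_weight_le:
  fixes w :: complex and x W :: real
  assumes "norm w \<le> W"
  shows "(norm (exp (- of_real pi * (of_real x)\<^sup>2 + (2 * of_real pi * w) * of_real x)))\<^sup>2 \<le> exp (- (2 * pi) * x\<^sup>2 + (4 * pi * W) * \<bar>x\<bar>)"
proof -
  have "norm (exp (- of_real pi * (of_real x)\<^sup>2 + (2 * of_real pi * w) * of_real x)) \<le> exp (- pi * x\<^sup>2 + (2 * pi * W) * \<bar>x\<bar>)"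
    using assms by (intro norm_exp_quadratic_le) (auto simp: norm_mult)
  then have "(norm (exp (- of_real pi * (of_real x)\<^sup>2 + (2 * of_real pi * w) * of_real x)))\<^sup>2 \<le> (exp (- pi * x\<^sup>2 + (2 * pi * W) * \<bar>x\<bar>))\<^sup>2"
    by (rule power_mono) (rule norm_ge_zero)
  also have "\<dots> = exp (- (2 * pi) * x\<^sup>2 + (4 * pi * W) * \<bar>x\<bar>)"
    by (simp add: power2_eq_square algebra_simps flip: exp_add)
  finally show ?thesis .
qed

lemma measurable_exp_weight: "(\<lambda>x. exp (- of_real pi * (of_real x)\<^sup>2 + (2 * of_real pi * w) * of_real x) :: complex) \<in> borel_measurable lebesgue"
  by (rule measurable_completion) measurable

lemma
  assumes f: "f \<in> L2_real"
  shows integrable_bargmann: "integrable lebesgue (\<lambda>x. f x * exp (- of_real pi * (of_real x)\<^sup>2 + (2 * of_real pi * w) * of_real x))"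
    and holomorphic_bargmann: "bargmann f holomorphic_on UNIV"
proof -
  have fm: "f \<in> borel_measurable lebesgue" and fi: "integrable lebesgue (\<lambda>x. (norm (f x))\<^sup>2)"
    using f by (auto simp: L2_real_def)
  \<comment> \<open>A majorant valid for all \<open>w\<close> in the disc of radius \<open>W\<close>
    at once, as holomorphy under the integral requires.\<close>
  define g where "g = (\<lambda>W x. ((norm (f x))\<^sup>2 + exp (- (2 * pi) * x\<^sup>2 + (4 * pi * W) * \<bar>x\<bar>)) / 2)"
  have gi: "integrable lebesgue (g W)" for W
  proof -
    have "integrable lborel (\<lambda>x. exp (- (2 * pi) * x\<^sup>2 + (4 * pi * W) * \<bar>x\<bar>))"
      by (rule integrable_gaussian_abs) simp
    from integrable_lebesgueI[OF this] fi show ?thesis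
      unfolding g_def by (intro integrable_divide_zero Bochner_Integration.integrable_add) auto
  qed
  have le: "norm (f x * exp (- of_real pi * (of_real x)\<^sup>2 + (2 * of_real pi * w) * of_real x)) \<le> g W x" if "norm w \<le> W" for w W x
    unfolding g_def using norm_exp_weight_le[OF that, of x]
    by (intro order_trans[OF norm_mult_le_sum_squares] divide_right_mono add_left_mono) auto
  have meas: "(\<lambda>x. f x * exp (- of_real pi * (of_real x)\<^sup>2 + (2 * of_real pi * w) * of_real x)) \<in> borel_measurable lebesgue" for w
    by (intro borel_measurable_times fm measurable_exp_weight)
  show "integrable lebesgue (\<lambda>x. f x * exp (- of_real pi * (of_real x)\<^sup>2 + (2 * of_real pi * w) * of_real x))"
    by (rule Bochner_Integration.integrable_bound[OF gi[of "norm w"] meas])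
       (intro AE_I2 order_trans[OF le[OF order_refl]], simp)
  have "(\<lambda>w. LINT x|lebesgue. f x * exp (- of_real pi * (of_real x)\<^sup>2 + (2 * of_real pi * w) * of_real x)) holomorphic_on UNIV"
  proof (rule holomorphic_on_lebesgue_integral)
    fix z :: complex
    show "\<exists>r>0. \<exists>g. integrable lebesgue g \<and> (\<forall>w\<in>ball z r. \<forall>x. norm (f x * exp (- of_real pi * (of_real x)\<^sup>2 + (2 * of_real pi * w) * of_real x)) \<le> g x)"
    proof (intro exI[of _ 1] conjI exI[of _ "g (norm z + 1)"] ballI allI)
      fix w x assume "w \<in> ball z 1"
      then have "norm w \<le> norm z + 1"
        using norm_triangle_ineq2[of w z] by (simp add: dist_norm norm_minus_commute)
      then show "norm (f x * exp (- of_real pi * (of_real x)\<^sup>2 + (2 * of_real pi * w) * of_real x)) \<le> g (norm z + 1) x"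
        by (rule le)
    qed (use gi in auto)
  qed (rule open_UNIV meas | intro holomorphic_intros)+
  then show "bargmann f holomorphic_on UNIV"
    unfolding bargmann_def[abs_def] by (intro holomorphic_intros)
qed

text \<open>The Gabor transform is bounded, because translated and modulated Gaussians all have the
  same squared L2 norm \<open>sqrt (1 / 2)\<close>. Dividing by the weight turns this into the
  growth rate \<open>pi / 2\<close>.\<close>

lemma bargmann_growth:
  assumes f: "f \<in> L2_real"
  obtains C where "C \<ge> 0" "\<And>w. norm (bargmann f w) \<le> C * exp (pi / 2 * (norm w)\<^sup>2)"
proof -
  have fm: "f \<in> borel_measurable lebesgue" and fi: "integrable lebesgue (\<lambda>x. (norm (f x))\<^sup>2)"
    using f by (auto simp: L2_real_def)
  define C where "C = ((\<integral>x. (norm (f x))\<^sup>2 \<partial>lebesgue) + sqrt (1 / 2)) / 2"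
  have C: "C \<ge> 0" unfolding C_def by (intro divide_nonneg_pos add_nonneg_nonneg integral_nonneg_AE) auto
  have bd: "norm (gabor_transform f t \<omega>) \<le> C" for t \<omega>
  proof -
    define v where "v = (\<lambda>x. complex_of_real (gaussian (x - t)) * exp (- (2 * complex_of_real pi * \<i> * complex_of_real x * complex_of_real \<omega>)))"
    have nv: "(norm (v x))\<^sup>2 = exp (- (2 * pi) * x\<^sup>2 + (4 * pi * t) * x) * exp (- (2 * pi) * t\<^sup>2)" for x
    proof -
      have "norm (v x) = exp (- pi * (x - t)\<^sup>2)" by (simp add: v_def norm_mult gaussian_def)
      then show ?thesis
        unfolding exp_add[symmetric] by (simp add: power2_eq_square algebra_simps flip: exp_add)
    qed
    note gi = gaussian_integral_real[of "2 * pi" "4 * pi * t"]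
    have vi: "integrable lborel (\<lambda>x. (norm (v x))\<^sup>2)" unfolding nv using gi(1) by (intro integrable_mult_left) auto
    have "(\<integral>x. (norm (v x))\<^sup>2 \<partial>lebesgue) = (\<integral>x. (norm (v x))\<^sup>2 \<partial>lborel)"
      using vi by (intro integral_completion) auto
    also have "\<dots> = sqrt (pi / (2 * pi)) * exp ((4 * pi * t)\<^sup>2 / (4 * (2 * pi))) * exp (- (2 * pi) * t\<^sup>2)"
      unfolding nv using gi(2) by simp
    also have "\<dots> = sqrt (1 / 2)"
      by (simp add: power2_eq_square mult.assoc flip: exp_add)
    finally have vs: "(\<integral>x. (norm (v x))\<^sup>2 \<partial>lebesgue) = sqrt (1 / 2)" .
    note vi' = integrable_lebesgueI[OF vi]
    have "norm (gabor_transform f t \<omega>) \<le> (\<integral>x. norm (f x * v x) \<partial>lebesgue)"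
      unfolding gabor_transform_def v_def mult.assoc by (rule integral_norm_bound)
    also have "\<dots> \<le> (\<integral>x. ((norm (f x))\<^sup>2 + (norm (v x))\<^sup>2) / 2 \<partial>lebesgue)"
    proof (rule integral_mono_AE')
      show "integrable lebesgue (\<lambda>x. ((norm (f x))\<^sup>2 + (norm (v x))\<^sup>2) / 2)"
        using fi vi' by (intro integrable_divide_zero Bochner_Integration.integrable_add) auto
    qed (rule AE_I2 norm_mult_le_sum_squares | simp add: add_nonneg_nonneg)+
    also have "\<dots> = C" using fi vi' vs by (simp add: C_def)
    finally show ?thesis .
  qed
  have "norm (bargmann f w) \<le> C * exp (pi / 2 * (norm w)\<^sup>2)" for w
  proof -
    have "exp (- (pi / 2) * (norm w)\<^sup>2) * norm (bargmann f w) \<le> C"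
      using bd[of "Re w" "- Im w"] norm_gabor_transform[of f "Re w" "- Im w"] by simp
    then show ?thesis by (simp add: exp_minus field_simps)
  qed
  then show thesis using that C by blast
qed

text \<open>On the imaginary axis the transform is, up to a nonvanishing factor, the Fourier
  transform of the function times \<open>exp (- pi * x\<^sup>2)\<close>. Fourier uniqueness applies
  to this product, and the Gaussian can be cancelled.\<close>

lemma bargmann_determines:
  assumes f: "f1 \<in> L2_real" "f2 \<in> L2_real" and eq: "\<And>w. bargmann f1 w = c * bargmann f2 w"
  shows "AE x in lebesgue. f1 x = c * f2 x"
proof -
  define k where "k = (\<lambda>x. (f1 x - c * f2 x) * exp (- of_real pi * (of_real x)\<^sup>2))"
  have split: "iexp (t * x) * k x = f1 x * exp (- of_real pi * (of_real x)\<^sup>2 + (2 * of_real pi * w) * of_real x)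
      - c * (f2 x * exp (- of_real pi * (of_real x)\<^sup>2 + (2 * of_real pi * w) * of_real x))"
    if "w = \<i> * of_real (t / (2 * pi))" for t x w
  proof -
    have "exp (- of_real pi * (of_real x)\<^sup>2 + (2 * of_real pi * w) * of_real x)
        = iexp (t * x) * exp (- of_real pi * (complex_of_real x)\<^sup>2)"
      unfolding exp_add[symmetric] that by (simp add: mult.assoc)
    then show ?thesis by (simp add: k_def algebra_simps)
  qed
  have "AE x in lebesgue. k x = 0"
  proof (rule AE_zero_if_fourier_zero)
    have "integrable lebesgue (\<lambda>x. iexp (0 * x) * k x)"
      unfolding split[OF refl]
      by (intro Bochner_Integration.integrable_diff integrable_mult_right integrable_bargmann f)
    then show "integrable lebesgue k" by simp
    fix t
    define w where "w = \<i> * of_real (t / (2 * pi))"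
    have "bargmann f1 w = c * bargmann f2 w" by (rule eq)
    then show "(LINT x|lebesgue. iexp (t * x) * k x) = 0"
      unfolding split[OF w_def] using integrable_bargmann[OF f(1), of w] integrable_bargmann[OF f(2), of w]
      by (subst Bochner_Integration.integral_diff) (auto simp: bargmann_def)
  qed
  then show ?thesis by eventually_elim (simp add: k_def)
qed

lemma bargmann_cong_AE:
  assumes f: "f1 \<in> L2_real" "f2 \<in> L2_real" and ae: "AE x in lebesgue. f1 x = c * f2 x"
  shows "bargmann f1 w = c * bargmann f2 w"
proof -
  have fm: "f1 \<in> borel_measurable lebesgue" "f2 \<in> borel_measurable lebesgue" using f by (auto simp: L2_real_def)
  have "(LINT x|lebesgue. f1 x * exp (- of_real pi * (of_real x)\<^sup>2 + (2 * of_real pi * w) * of_real x))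
     = (LINT x|lebesgue. c * (f2 x * exp (- of_real pi * (of_real x)\<^sup>2 + (2 * of_real pi * w) * of_real x)))"
  proof (rule integral_cong_AE)
    show "AE x in lebesgue. f1 x * exp (- of_real pi * (of_real x)\<^sup>2 + (2 * of_real pi * w) * of_real x)
     = c * (f2 x * exp (- of_real pi * (of_real x)\<^sup>2 + (2 * of_real pi * w) * of_real x))"
      using ae by eventually_elim simp
  qed (intro borel_measurable_times borel_measurable_const fm measurable_exp_weight)+
  then show ?thesis by (simp add: bargmann_def)
qed

section \<open>Functions of \<open>w\<^sup>2\<close> as Bargmann transforms\<close>

lemma Re_chirp_parameter_ge:
  assumes r: "norm \<gamma> = r" "r < pi / 2"
  shows "Re (2 * (of_real pi)\<^sup>2 / (of_real pi + 2 * \<gamma>)) \<ge> pi + (pi\<^sup>2 - 4 * r\<^sup>2) / (4 * pi)"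
proof -
  \<comment> \<open>\<open>q\<close> lies on the circle of radius \<open>2 * r < pi\<close> about
    \<open>pi\<close>. Inversion maps the disc of radius \<open>pi\<close> about \<open>pi\<close>
    onto the half-plane \<open>Re (2 * pi\<^sup>2 / q) > pi\<close>, and the smaller circle stays a
    fixed distance inside. This excess over \<open>pi\<close> makes the chirps decay.\<close>
  define q where "q = of_real pi + 2 * \<gamma>"
  have n1: "norm (q - of_real pi) = 2 * r" using r by (simp add: q_def norm_mult)
  have n2: "norm q \<le> 2 * pi" using norm_triangle_ineq[of "of_real pi" "2 * \<gamma>"] r by (simp add: q_def norm_mult)
  have q0: "q \<noteq> 0" using n1 r by auto
  define N where "N = (norm q)\<^sup>2"
  have N: "0 < N" "N \<le> 4 * pi\<^sup>2"
    using q0 power_mono[OF n2, of 2] by (auto simp: N_def power_mult_distrib)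
  have "(norm (q - of_real pi))\<^sup>2 = N - 2 * pi * Re q + pi\<^sup>2"
    unfolding N_def cmod_power2 by (simp add: power2_eq_square algebra_simps)
  then have X: "2 * pi * Re q = N + (pi\<^sup>2 - 4 * r\<^sup>2)"
    by (simp add: n1 power_mult_distrib)
  have "Re (2 * (of_real pi)\<^sup>2 / q) = 2 * pi\<^sup>2 * Re q / N"
    by (simp add: Re_divide N_def cmod_power2 flip: of_real_power)
  also have "\<dots> = pi * (2 * pi * Re q) / N" by (simp add: power2_eq_square)
  also have "\<dots> = pi + pi * (pi\<^sup>2 - 4 * r\<^sup>2) / N" unfolding X using N by (simp add: field_simps)
  also have "\<dots> \<ge> pi + pi * (pi\<^sup>2 - 4 * r\<^sup>2) / (4 * pi\<^sup>2)"
  proof -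
    have "(2 * r)\<^sup>2 \<le> pi\<^sup>2" using r norm_ge_zero[of \<gamma>] by (intro power_mono) auto
    then have "0 \<le> pi * (pi\<^sup>2 - 4 * r\<^sup>2)" by (simp add: power_mult_distrib)
    then show ?thesis using N by (intro add_left_mono divide_left_mono) auto
  qed
  finally show ?thesis by (simp add: q_def power2_eq_square)
qed

text \<open>The chirp \<open>x \<mapsto> exp (- (p - pi) x\<^sup>2)\<close> with \<open>p = 2 pi\<^sup>2 / (pi + 2 \<beta>)\<close> has, up to a constant, the transform
  \<open>exp (\<beta> w\<^sup>2)\<close>. Superposing chirps over the circle that represents \<open>K\<close> yields \<open>K (w\<^sup>2)\<close>.\<close>

lemma bargmann_surj_exp_type:
  assumes K: "K holomorphic_on UNIV" and bd: "\<And>s. norm (K s) \<le> C * exp (c * norm s)" and c: "0 < c" "c < pi / 2"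
  obtains f where "f \<in> L2_real" "\<And>w. bargmann f w = K (w\<^sup>2)"
proof -
  define r where "r = (c + pi / 2) / 2"
  have r: "c < r" "r < pi / 2" "0 < r" using c by (auto simp: r_def)
  obtain B where contB: "continuous_on (sphere 0 r) B"
    and KB: "\<And>s. ((\<lambda>\<beta>. exp (s * \<beta>) * B \<beta>) has_contour_integral K s) (circlepath 0 r)"
    using exp_type_circle_representation[OF K bd c(1) r(1)] by metis
  define \<gamma> where "\<gamma> = (\<lambda>t. circlepath (0::complex) r t)"
  have \<gamma>: "norm (\<gamma> t) = r" for t using r by (simp add: \<gamma>_def circlepath norm_mult)
  have c\<gamma>: "continuous_on T \<gamma>" for T unfolding \<gamma>_def circlepath by (intro continuous_intros)
  define b where "b = (\<lambda>t. B (\<gamma> t) * (2 * of_real pi * \<i> * r * exp (2 * of_real pi * \<i> * of_real t)))"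
  have cb: "continuous_on T b" for T
    unfolding b_def by (intro continuous_intros continuous_on_compose2[OF contB c\<gamma>]) (auto simp: \<gamma>)
  \<comment> \<open>The circle parameter becomes a point of a probability space, so that the
    superposition is a Lebesgue integral open to Fubini's theorem.\<close>
  define M0 where "M0 = restrict_space lborel {0..1::real}"
  interpret M0: prob_space M0
    by (rule prob_spaceI) (simp add: M0_def emeasure_restrict_space space_restrict_space)
  interpret P: pair_sigma_finite lborel M0 ..
  have M0_meas: "h \<in> borel_measurable M0" if "continuous_on UNIV h" for h :: "real \<Rightarrow> complex"
    unfolding M0_def using borel_measurable_continuous_onI[OF that] by (intro measurable_restrict_space1) auto
  have KM: "K s = (\<integral>t. exp (s * \<gamma> t) * b t \<partial>M0)" for s
  proof -
    have "continuous_on {0..1} (\<lambda>t. exp (s * \<gamma> t) * b t)" by (intro continuous_intros c\<gamma> cb)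
    note si = borel_integrable_atLeastAtMost'[OF this]
    have "K s = integral {0..1} (\<lambda>t. exp (s * \<gamma> t) * b t)"
      using contour_integral_unique[OF KB[of s]] unfolding contour_integral_integral
      by (simp add: b_def \<gamma>_def vector_derivative_circlepath mult_ac)
    also have "\<dots> = (LINT t:{0..1}|lborel. exp (s * \<gamma> t) * b t)"
      using set_borel_integral_eq_integral(2)[OF si] by simp
    also have "\<dots> = (\<integral>t. exp (s * \<gamma> t) * b t \<partial>M0)"
      unfolding M0_def set_lebesgue_integral_def by (subst integral_restrict_space) auto
    finally show ?thesis .
  qed
  define p where "p = (\<lambda>t. 2 * (of_real pi)\<^sup>2 / (of_real pi + 2 * \<gamma> t))"
  define \<eta> where "\<eta> = (pi\<^sup>2 - 4 * r\<^sup>2) / (4 * pi)"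
  have \<eta>: "\<eta> > 0"
  proof -
    have "(2 * r)\<^sup>2 < pi\<^sup>2" using r by (intro power_strict_mono) auto
    then show ?thesis by (simp add: \<eta>_def power_mult_distrib)
  qed
  have Rep: "Re (p t) \<ge> pi + \<eta>" for t
    unfolding p_def \<eta>_def by (rule Re_chirp_parameter_ge[OF \<gamma> r(2)])
  have q0: "of_real pi + 2 * \<gamma> t \<noteq> 0" for t
  proof
    assume "of_real pi + 2 * \<gamma> t = 0"
    then have "p t = 0" by (simp add: p_def)
    then show False using Rep[of t] \<eta> pi_gt_zero by simp
  qed
  have pip: "of_real pi / p t = (of_real pi + 2 * \<gamma> t) / (2 * of_real pi)" for t
    using q0[of t] by (simp add: p_def power2_eq_square)
  have pos: "Re (of_real pi / p t) > 0" for t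
  proof -
    have "\<bar>Re (\<gamma> t)\<bar> \<le> r" using abs_Re_le_cmod[of "\<gamma> t"] \<gamma>[of t] by simp
    then have "Re (of_real pi + 2 * \<gamma> t) > 0" using r by simp
    moreover have "2 * complex_of_real pi = of_real (2 * pi)" by simp
    ultimately show ?thesis unfolding pip by (simp only: Re_divide_of_real) simp
  qed
  have cp: "continuous_on UNIV p" unfolding p_def using q0 by (intro continuous_intros c\<gamma>) auto
  \<comment> \<open>Divides the coefficient of the circle integral by the constant that the Gaussian
    integral of the chirp will produce. Continuity rests on \<open>pi / p t\<close> staying in the
    right half-plane.\<close>
  define \<kappa> where "\<kappa> = (\<lambda>t. b t / csqrt (of_real pi / p t))"
  have c\<kappa>: "continuous_on UNIV \<kappa>"
  proof -
    have p0: "p t \<noteq> 0" for t using pos[of t] by auto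
    have "continuous_on UNIV (\<lambda>t. csqrt (of_real pi / p t))"
    proof (rule continuous_on_compose2[of "{z. Re z > 0}" csqrt])
      show "continuous_on {z. Re z > 0} csqrt"
        by (rule holomorphic_on_imp_continuous_on) (auto intro!: holomorphic_intros simp: complex_nonpos_Reals_iff)
      show "continuous_on UNIV (\<lambda>t. of_real pi / p t)" by (intro continuous_intros cp) (use p0 in auto)
    qed (use pos in auto)
    then show ?thesis unfolding \<kappa>_def using p0 by (intro continuous_intros cb) auto
  qed
  have "compact (\<kappa> ` {0..1})" by (intro compact_continuous_image continuous_on_subset[OF c\<kappa>]) auto
  then have "bounded (\<kappa> ` {0..1})" by (rule compact_imp_bounded)
  then obtain m where m: "\<And>t. t \<in> {0..1} \<Longrightarrow> norm (\<kappa> t) \<le> m" unfolding bounded_iff by blast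
  have m0: "m \<ge> 0" using m[of 0] norm_ge_zero[of "\<kappa> 0"] by (simp del: norm_ge_zero)
  have space: "space M0 = {0..1}" by (simp add: M0_def space_restrict_space)
  have [measurable]: "p \<in> borel_measurable M0" "\<kappa> \<in> borel_measurable M0" using cp c\<kappa> M0_meas by auto
  have M0_bound: "integrable M0 h \<and> norm (integral\<^sup>L M0 h) \<le> D"
    if [measurable]: "h \<in> borel_measurable M0" and le: "\<And>t. t \<in> {0..1} \<Longrightarrow> norm (h t) \<le> D" for h :: "real \<Rightarrow> complex" and D
  proof
    show i: "integrable M0 h" by (rule M0.integrable_const_bound[of _ D]) (use le space in \<open>auto intro!: AE_I2\<close>)
    have "norm (integral\<^sup>L M0 h) \<le> (\<integral>t. norm (h t) \<partial>M0)" by (rule integral_norm_bound)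
    also have "\<dots> \<le> D" using i by (intro M0.integral_le_const) (use le space in \<open>auto intro!: AE_I2\<close>)
    finally show "norm (integral\<^sup>L M0 h) \<le> D" .
  qed
  \<comment> \<open>The exponent has \<open>p t - pi\<close> because the transform itself
    contributes \<open>exp (- pi * x\<^sup>2)\<close>. By \<open>Rep\<close> all chirps decay at
    least like \<open>exp (- \<eta> * x\<^sup>2)\<close>.\<close>
  define f where "f = (\<lambda>x. \<integral>t. \<kappa> t * exp (- (p t - of_real pi) * (of_real x)\<^sup>2) \<partial>M0)"
  have fmeas: "f \<in> borel_measurable lborel"
    unfolding f_def by (rule M0.borel_measurable_lebesgue_integral) measurable
  have fbound: "norm (f x) \<le> m * exp (- \<eta> * x\<^sup>2)" for x
    unfolding f_def
  proof (rule M0_bound[THEN conjunct2])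
    show "norm (\<kappa> t * exp (- (p t - of_real pi) * (of_real x)\<^sup>2)) \<le> m * exp (- \<eta> * x\<^sup>2)" if "t \<in> {0..1}" for t
      unfolding norm_mult using m[OF that] m0 norm_exp_quadratic_le[of \<eta> "p t - of_real pi" 0 0 x] Rep[of t]
      by (intro mult_mono) (auto simp del: norm_exp_eq_Re)
  qed measurable
  have fL2: "f \<in> L2_real"
  proof -
    have "integrable lborel (\<lambda>x. (norm (f x))\<^sup>2)"
    proof (rule Bochner_Integration.integrable_bound)
      show "integrable lborel (\<lambda>x. m\<^sup>2 * exp (- (2 * \<eta>) * x\<^sup>2 + 0 * x))"
        using gaussian_integral_real(1)[of "2 * \<eta>" 0] \<eta> by (intro integrable_mult_right) auto
      show "AE x in lborel. norm ((norm (f x))\<^sup>2) \<le> norm (m\<^sup>2 * exp (- (2 * \<eta>) * x\<^sup>2 + 0 * x))"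
      proof (rule AE_I2)
        fix x
        have "(norm (f x))\<^sup>2 \<le> (m * exp (- \<eta> * x\<^sup>2))\<^sup>2" using fbound[of x] by (rule power_mono) simp
        also have "\<dots> = m\<^sup>2 * exp (- (2 * \<eta>) * x\<^sup>2 + 0 * x)"
          by (simp add: power2_eq_square algebra_simps flip: exp_add)
        finally show "norm ((norm (f x))\<^sup>2) \<le> norm (m\<^sup>2 * exp (- (2 * \<eta>) * x\<^sup>2 + 0 * x))" by simp
      qed
    qed (use fmeas in measurable)
    from integrable_lebesgueI[OF this] fmeas show ?thesis
      by (auto simp: L2_real_def intro: measurable_completion)
  qed
  have "bargmann f w = K (w\<^sup>2)" for w
  proof -
    define h where "h = (\<lambda>x t. \<kappa> t * exp (- p t * (of_real x)\<^sup>2 + (2 * of_real pi * w) * of_real x))"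
    have hm: "case_prod h \<in> borel_measurable (lborel \<Otimes>\<^sub>M M0)" unfolding h_def by measurable
    have hx: "h x \<in> borel_measurable M0" for x unfolding h_def by measurable
    define D where "D = (\<lambda>x. m * exp (- pi * x\<^sup>2 + (2 * pi * norm w) * \<bar>x\<bar>))"
    have hb: "norm (h x t) \<le> D x" if "t \<in> {0..1}" for x t
      unfolding h_def D_def norm_mult using m[OF that] m0 Rep[of t] \<eta>
      by (intro mult_mono norm_exp_quadratic_le) (auto simp: norm_mult)
    have Di: "integrable lborel D"
      unfolding D_def by (intro integrable_mult_right integrable_gaussian_abs) auto
    have D0: "D x \<ge> 0" for x using m0 by (simp add: D_def)
    have hint: "integrable (lborel \<Otimes>\<^sub>M M0) (case_prod h)"
    proof (rule P.Fubini_integrable[OF hm])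
      have nm: "(\<lambda>z. norm (case_prod h z)) \<in> borel_measurable (lborel \<Otimes>\<^sub>M M0)" using hm by measurable
      show "integrable lborel (\<lambda>x. \<integral>t. norm (case_prod h (x, t)) \<partial>M0)"
      proof (rule Bochner_Integration.integrable_bound[OF Di])
        show "(\<lambda>x. \<integral>t. norm (case_prod h (x, t)) \<partial>M0) \<in> borel_measurable lborel"
          by (rule M0.borel_measurable_lebesgue_integral) (use nm in \<open>simp add: case_prod_unfold\<close>)
        show "AE x in lborel. norm (\<integral>t. norm (case_prod h (x, t)) \<partial>M0) \<le> norm (D x)"
        proof (rule AE_I2)
          fix x
          have "(\<integral>t. norm (h x t) \<partial>M0) \<le> D x"
            using M0_bound[OF hx, of x "D x"] hb
            by (intro M0.integral_le_const) (auto intro!: AE_I2 simp: space)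
          moreover have "(\<integral>t. norm (h x t) \<partial>M0) \<ge> 0" by simp
          ultimately show "norm (\<integral>t. norm (case_prod h (x, t)) \<partial>M0) \<le> norm (D x)" by simp
        qed
      qed
      show "AE x in lborel. integrable M0 (\<lambda>t. case_prod h (x, t))"
        using M0_bound[OF hx] hb by (intro AE_I2) auto
    qed
    have fw: "f x * exp (- of_real pi * (of_real x)\<^sup>2 + (2 * of_real pi * w) * of_real x) = (\<integral>t. h x t \<partial>M0)" for x
    proof -
      have "\<kappa> t * exp (- (p t - of_real pi) * (of_real x)\<^sup>2) * exp (- of_real pi * (of_real x)\<^sup>2 + (2 * of_real pi * w) * of_real x) = h x t" for t
        unfolding h_def mult.assoc exp_add[symmetric] by (simp add: algebra_simps)
      then show ?thesis unfolding f_def by (simp flip: integral_mult_left_zero)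
    qed
    have inner: "(\<integral>x. h x t \<partial>lborel) = exp (of_real pi / 2 * w\<^sup>2) * (exp (w\<^sup>2 * \<gamma> t) * b t)" for t
    proof -
      have "Re (p t) > 0" using Rep[of t] \<eta> pi_gt_zero by linarith
      note gi = gaussian_integral_complex(2)[OF this, of "2 * of_real pi * w"]
      have nz: "csqrt (of_real pi / p t) \<noteq> 0" using pos[of t] by auto
      have "(\<integral>x. h x t \<partial>lborel) = \<kappa> t * (csqrt (of_real pi / p t) * exp ((2 * of_real pi * w)\<^sup>2 / (4 * p t)))"
        unfolding h_def by (simp only: integral_mult_right_zero gi)
      also have "\<dots> = b t * exp ((2 * of_real pi * w)\<^sup>2 / (4 * p t))"
        using nz by (simp add: \<kappa>_def)
      \<comment> \<open>\<open>pi / p t\<close> is affine in \<open>\<gamma> t\<close>: its constant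
        part yields the weight that the definition of the transform cancels, its linear part yields
        \<open>w\<^sup>2 * \<gamma> t\<close>. This dictates the choice of \<open>p\<close>.\<close>
      also have "(2 * of_real pi * w)\<^sup>2 / (4 * p t) = of_real pi / 2 * w\<^sup>2 + w\<^sup>2 * \<gamma> t"
      proof -
        have "(2 * of_real pi * w)\<^sup>2 / (4 * p t) = of_real pi * w\<^sup>2 * (of_real pi / p t)"
          by (simp add: power2_eq_square)
        also have "\<dots> = of_real pi / 2 * w\<^sup>2 + w\<^sup>2 * \<gamma> t"
          unfolding pip by (simp add: field_simps)
        finally show ?thesis .
      qed
      finally show ?thesis by (simp add: exp_add mult_ac)
    qed
    have "(LINT x|lebesgue. f x * exp (- of_real pi * (of_real x)\<^sup>2 + (2 * of_real pi * w) * of_real x))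
        = (LINT x|lborel. f x * exp (- of_real pi * (of_real x)\<^sup>2 + (2 * of_real pi * w) * of_real x))"
    proof (rule integral_completion)
      have [measurable]: "f \<in> borel_measurable borel" using fmeas by simp
      show "(\<lambda>x. f x * exp (- of_real pi * (of_real x)\<^sup>2 + (2 * of_real pi * w) * of_real x)) \<in> borel_measurable lborel"
        by measurable
    qed
    also have "\<dots> = (\<integral>t. (\<integral>x. h x t \<partial>lborel) \<partial>M0)"
      unfolding fw by (rule P.Fubini_integral[OF hint, symmetric])
    also have "\<dots> = exp (of_real pi / 2 * w\<^sup>2) * K (w\<^sup>2)"
      unfolding inner KM by (rule integral_mult_right_zero)
    finally show ?thesis by (simp add: bargmann_def exp_minus)
  qed
  with fL2 show thesis using that by blast
qed

section \<open>Sampling on two lines\<close>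

lemma
  shows measurable_lebesgue_translate: "(\<lambda>x. t + x :: real) \<in> lebesgue \<rightarrow>\<^sub>M lebesgue"
    and distr_lebesgue_translate: "distr lebesgue lebesgue (\<lambda>x. t + x :: real) = lebesgue"
  using lebesgue_affine_measurable[where c = "\<lambda>_::real. 1" and t = t] lebesgue_real_affine[of 1 t]
  by (simp_all add: density_1)

text \<open>The substitution \<open>y = t0 + x\<close> moves the window and recombines the
  modulations. What is left over is a factor of modulus one, so the moduli are only moved in the
  plane.\<close>

lemma
  fixes f :: "real \<Rightarrow> complex" and t0 \<omega>0 :: real
  assumes f: "f \<in> L2_real"
  defines "g \<equiv> \<lambda>x. exp (- (2 * of_real pi * \<i> * of_real x * of_real \<omega>0)) * f (t0 + x)"
  shows L2_time_frequency_shift: "g \<in> L2_real"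
    and gabor_time_frequency_shift:
      "gabor_transform g t \<omega> = exp (2 * of_real pi * \<i> * of_real t0 * of_real (\<omega>0 + \<omega>)) * gabor_transform f (t0 + t) (\<omega>0 + \<omega>)"
proof -
  have fm: "f \<in> borel_measurable lebesgue" and fi: "integrable lebesgue (\<lambda>x. (norm (f x))\<^sup>2)"
    using f by (auto simp: L2_real_def)
  have em: "(\<lambda>x. exp (- (2 * of_real pi * \<i> * of_real x * of_real \<omega>)) :: complex) \<in> borel_measurable lebesgue" for \<omega>
    by (rule measurable_completion) measurable
  have ftm: "(\<lambda>x. f (t0 + x)) \<in> borel_measurable lebesgue"
    using measurable_comp[OF measurable_lebesgue_translate fm] by (simp add: comp_def)
  have "integrable (distr lebesgue lebesgue (\<lambda>x. t0 + x)) (\<lambda>x. (norm (f x))\<^sup>2)"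
    unfolding distr_lebesgue_translate by (rule fi)
  then have "integrable lebesgue (\<lambda>x. (norm (f (t0 + x)))\<^sup>2)"
    by (subst (asm) integrable_distr_eq[OF measurable_lebesgue_translate]) (use fm in auto)
  then show "g \<in> L2_real"
    using borel_measurable_times[OF em ftm] by (simp add: L2_real_def g_def norm_mult)
  define h where "h = (\<lambda>y. f y * complex_of_real (gaussian (y - (t0 + t))) * exp (- (2 * complex_of_real pi * \<i> * complex_of_real y * complex_of_real (\<omega>0 + \<omega>))))"
  have hm: "h \<in> borel_measurable lebesgue"
    unfolding h_def
  proof (intro borel_measurable_times fm em)
    show "(\<lambda>y. complex_of_real (gaussian (y - (t0 + t)))) \<in> borel_measurable lebesgue"
      unfolding gaussian_def by (rule measurable_completion) measurable
  qed
  have "gabor_transform f (t0 + t) (\<omega>0 + \<omega>) = integral\<^sup>L (distr lebesgue lebesgue (\<lambda>x. t0 + x)) h"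
    unfolding distr_lebesgue_translate gabor_transform_def h_def by simp
  also have "\<dots> = (LINT x|lebesgue. h (t0 + x))"
    by (rule integral_distr[OF measurable_lebesgue_translate hm])
  finally have eq: "gabor_transform f (t0 + t) (\<omega>0 + \<omega>) = (LINT x|lebesgue. h (t0 + x))" .
  have "g x * complex_of_real (gaussian (x - t)) * exp (- (2 * complex_of_real pi * \<i> * complex_of_real x * complex_of_real \<omega>))
      = exp (2 * of_real pi * \<i> * of_real t0 * of_real (\<omega>0 + \<omega>)) * h (t0 + x)" for x
  proof -
    have "exp (- (2 * of_real pi * \<i> * of_real x * of_real \<omega>0)) * exp (- (2 * complex_of_real pi * \<i> * complex_of_real x * complex_of_real \<omega>))
        = exp (2 * of_real pi * \<i> * of_real t0 * of_real (\<omega>0 + \<omega>)) * exp (- (2 * complex_of_real pi * \<i> * complex_of_real (t0 + x) * complex_of_real (\<omega>0 + \<omega>)))"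
      unfolding exp_add[symmetric] by (simp add: algebra_simps)
    from arg_cong[OF this, of "\<lambda>z. z * (f (t0 + x) * complex_of_real (gaussian (x - t)))"]
    show ?thesis unfolding g_def h_def add_diff_cancel_left by (simp only: mult_ac)
  qed
  then show "gabor_transform g t \<omega> = exp (2 * of_real pi * \<i> * of_real t0 * of_real (\<omega>0 + \<omega>)) * gabor_transform f (t0 + t) (\<omega>0 + \<omega>)"
    unfolding gabor_transform_def[of g] eq by (simp only: integral_mult_right_zero)
qed

lemma gabor_phase_retrieval_iff_bargmann:
  "does_gabor_phase_retrieval \<Lambda> \<longleftrightarrow>
     (\<forall>f1\<in>L2_real. \<forall>f2\<in>L2_real.
        (\<forall>(t, \<omega>)\<in>\<Lambda>. norm (bargmann f1 (Complex t (- \<omega>))) = norm (bargmann f2 (Complex t (- \<omega>)))) \<longrightarrow>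
        (\<exists>\<alpha>::real. \<forall>w. bargmann f1 w = exp (\<i> * of_real \<alpha>) * bargmann f2 w))"
proof -
  have "(\<exists>\<alpha>::real. AE x in lebesgue. f1 x = exp (\<i> * of_real \<alpha>) * f2 x) \<longleftrightarrow>
      (\<exists>\<alpha>::real. \<forall>w. bargmann f1 w = exp (\<i> * of_real \<alpha>) * bargmann f2 w)"
    if "f1 \<in> L2_real" "f2 \<in> L2_real" for f1 f2
    using bargmann_cong_AE[OF that] bargmann_determines[OF that] by blast
  then show ?thesis
    by (simp add: does_gabor_phase_retrieval_def norm_gabor_transform)
qed

lemma gabor_phase_retrieval_translate:
  assumes "does_gabor_phase_retrieval \<Lambda>"
  shows "does_gabor_phase_retrieval ((\<lambda>p. (t0, \<omega>0) + p) ` \<Lambda>)"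
  unfolding does_gabor_phase_retrieval_def
proof (intro ballI impI)
  fix f1 f2
  assume f: "f1 \<in> L2_real" "f2 \<in> L2_real"
    and eq: "\<forall>(t, \<omega>)\<in>(\<lambda>p. (t0, \<omega>0) + p) ` \<Lambda>. norm (gabor_transform f1 t \<omega>) = norm (gabor_transform f2 t \<omega>)"
  define g where "g = (\<lambda>f x. exp (- (2 * of_real pi * \<i> * of_real x * of_real \<omega>0)) * f (t0 + x :: real))"
  have L2: "g f \<in> L2_real" if "f \<in> L2_real" for f
    unfolding g_def by (rule L2_time_frequency_shift[OF that])
  have shift: "gabor_transform (g f) t \<omega> = exp (2 * of_real pi * \<i> * of_real t0 * of_real (\<omega>0 + \<omega>)) * gabor_transform f (t0 + t) (\<omega>0 + \<omega>)"
    if "f \<in> L2_real" for f t \<omega>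
    unfolding g_def by (rule gabor_time_frequency_shift[OF that])
  have "\<forall>(t, \<omega>)\<in>\<Lambda>. norm (gabor_transform (g f1) t \<omega>) = norm (gabor_transform (g f2) t \<omega>)"
  proof clarify
    fix t \<omega> assume "(t, \<omega>) \<in> \<Lambda>"
    then have "(t0, \<omega>0) + (t, \<omega>) \<in> (\<lambda>p. (t0, \<omega>0) + p) ` \<Lambda>" by (rule imageI)
    then have "norm (gabor_transform f1 (t0 + t) (\<omega>0 + \<omega>)) = norm (gabor_transform f2 (t0 + t) (\<omega>0 + \<omega>))"
      using eq by auto
    then show "norm (gabor_transform (g f1) t \<omega>) = norm (gabor_transform (g f2) t \<omega>)"
      by (simp only: shift[OF f(1)] shift[OF f(2)] norm_mult)
  qed
  then obtain \<alpha> :: real where "AE x in lebesgue. g f1 x = exp (\<i> * of_real \<alpha>) * g f2 x"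
    using assms L2[OF f(1)] L2[OF f(2)] unfolding does_gabor_phase_retrieval_def by blast
  \<comment> \<open>The shift is undone on the level of transforms, where its phase factor cancels;
    injectivity then leads back to the functions.\<close>
  from bargmann_cong_AE[OF L2[OF f(1)] L2[OF f(2)] this]
  have gab: "gabor_transform (g f1) t \<omega> = exp (\<i> * of_real \<alpha>) * gabor_transform (g f2) t \<omega>" for t \<omega>
    by (simp add: gabor_transform_bargmann)
  have "gabor_transform f1 t \<omega> = exp (\<i> * of_real \<alpha>) * gabor_transform f2 t \<omega>" for t \<omega>
    using gab[of "t - t0" "\<omega> - \<omega>0"] by (simp add: shift[OF f(1)] shift[OF f(2)])
  then have *: "bargmann f1 (Complex t (- \<omega>)) = exp (\<i> * of_real \<alpha>) * bargmann f2 (Complex t (- \<omega>))" for t \<omega>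
    by (simp add: gabor_transform_bargmann)
  have "bargmann f1 w = exp (\<i> * of_real \<alpha>) * bargmann f2 w" for w
    using *[of "Re w" "- Im w"] by simp
  then show "\<exists>\<alpha>::real. AE x in lebesgue. f1 x = exp (\<i> * of_real \<alpha>) * f2 x"
    using bargmann_determines[OF f] by blast
qed

lemma gabor_phase_retrieval_translate_iff:
  "does_gabor_phase_retrieval ((\<lambda>p. (t0, \<omega>0) + p) ` \<Lambda>) \<longleftrightarrow> does_gabor_phase_retrieval \<Lambda>"
proof
  assume "does_gabor_phase_retrieval ((\<lambda>p. (t0, \<omega>0) + p) ` \<Lambda>)"
  from gabor_phase_retrieval_translate[OF this, of "- t0" "- \<omega>0"]
  show "does_gabor_phase_retrieval \<Lambda>" unfolding image_image add.assoc[symmetric] by (simp flip: zero_prod_def)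
qed (rule gabor_phase_retrieval_translate)

text \<open>The point \<open>x * (sin \<theta>, cos \<theta>)\<close> corresponds to
  \<open>x * (sin \<theta> - \<i> * cos \<theta>)\<close>, which explains the quarter turn in
  \<open>cis (\<theta> - pi / 2)\<close>.\<close>

lemma line_samples_ball_iff:
  "(\<forall>(t, \<omega>)\<in>line_samples a \<nu> \<theta>. P (Complex t (- \<omega>))) \<longleftrightarrow>
   (\<forall>n::nat. P (of_real (a * real n powr \<nu>) * cis (\<theta> - pi / 2)) \<and> P (- of_real (a * real n powr \<nu>) * cis (\<theta> - pi / 2)))"
proof -
  have "Complex (x * sin \<theta>) (- (x * cos \<theta>)) = of_real x * cis (\<theta> - pi / 2)" for x
    by (simp add: complex_eq_iff cos_diff sin_diff)
  then have "(\<forall>(t, \<omega>)\<in>line_samples a \<nu> \<theta>. P (Complex t (- \<omega>))) \<longleftrightarrow>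
      (\<forall>x\<in>int_powers \<nu>. P (of_real (a * x) * cis (\<theta> - pi / 2)))"
    by (simp add: line_samples_def)
  also have "\<dots> \<longleftrightarrow> (\<forall>n::nat. P (of_real (a * real n powr \<nu>) * cis (\<theta> - pi / 2)) \<and> P (- of_real (a * real n powr \<nu>) * cis (\<theta> - pi / 2)))"
  proof (intro iffI allI conjI ballI)
    fix n :: nat
    assume L: "\<forall>x\<in>int_powers \<nu>. P (of_real (a * x) * cis (\<theta> - pi / 2))"
    have "real n powr \<nu> \<in> int_powers \<nu>" "- (real n powr \<nu>) \<in> int_powers \<nu>"
      unfolding int_powers_def by blast+
    with L have "P (of_real (a * (real n powr \<nu>)) * cis (\<theta> - pi / 2))"
      and "P (of_real (a * - (real n powr \<nu>)) * cis (\<theta> - pi / 2))" by blast+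
    then show "P (of_real (a * real n powr \<nu>) * cis (\<theta> - pi / 2))" "P (- of_real (a * real n powr \<nu>) * cis (\<theta> - pi / 2))"
      by simp_all
  next
    fix x
    assume R: "\<forall>n::nat. P (of_real (a * real n powr \<nu>) * cis (\<theta> - pi / 2)) \<and> P (- of_real (a * real n powr \<nu>) * cis (\<theta> - pi / 2))"
      and "x \<in> int_powers \<nu>"
    then obtain n :: nat where "x = real n powr \<nu> \<or> x = - (real n powr \<nu>)" unfolding int_powers_def by blast
    then show "P (of_real (a * x) * cis (\<theta> - pi / 2))" using R[rule_format, of n] by auto
  qed
  finally show ?thesis .
qed

lemma reflected_product_eq_if_samples_eq:
  fixes H1 H2 :: "complex \<Rightarrow> complex"
  assumes hol: "H1 holomorphic_on UNIV" "H2 holomorphic_on UNIV"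
    and gr: "\<And>w. norm (H1 w) \<le> C1 * exp (pi / 2 * (norm w)\<^sup>2)" "\<And>w. norm (H2 w) \<le> C2 * exp (pi / 2 * (norm w)\<^sup>2)"
    and a: "a > 0" and \<nu>: "\<nu> > 0" "\<nu> < 1/2 \<or> \<nu> = 1/2 \<and> a < 1"
    and eq: "\<And>n::nat. norm (H1 (of_real (a * real n powr \<nu>) * cis b)) = norm (H2 (of_real (a * real n powr \<nu>) * cis b))"
      "\<And>n::nat. norm (H1 (- of_real (a * real n powr \<nu>) * cis b)) = norm (H2 (- of_real (a * real n powr \<nu>) * cis b))"
  shows "H1 w * cnj (H1 (cis (2 * b) * cnj w)) = H2 w * cnj (H2 (cis (2 * b) * cnj w))"
proof -
  define L where "L = (\<lambda>H z. H (z * cis b) * cnj (H (cnj z * cis b)) :: complex)"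
  have holL: "L H holomorphic_on UNIV" if "H holomorphic_on UNIV" for H
  proof -
    have "(\<lambda>z. z * cis b) holomorphic_on UNIV" by (intro holomorphic_intros)
    from holomorphic_on_compose_gen[OF this that] have g: "(\<lambda>z. H (z * cis b)) holomorphic_on UNIV"
      by (simp add: comp_def)
    then have "(cnj \<circ> (\<lambda>z. H (z * cis b)) \<circ> cnj) holomorphic_on UNIV"
      by (intro holomorphic_on_compose_cnj_cnj) (auto elim: holomorphic_on_subset)
    with g show ?thesis unfolding L_def comp_def by (rule holomorphic_on_mult)
  qed
  have grL: "norm (L H z) \<le> C\<^sup>2 * exp (pi * (norm z)\<^sup>2)"
    if "\<And>w. norm (H w) \<le> C * exp (pi / 2 * (norm w)\<^sup>2)" for H C z
  proof -
    have "norm (L H z) \<le> (C * exp (pi / 2 * (norm z)\<^sup>2)) * (C * exp (pi / 2 * (norm z)\<^sup>2))"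
      unfolding L_def norm_mult complex_mod_cnj
      using that[of "z * cis b"] that[of "cnj z * cis b"] order_trans[OF norm_ge_zero that[of z]]
      by (intro mult_mono) (auto simp: norm_mult)
    also have "\<dots> = C\<^sup>2 * exp (pi * (norm z)\<^sup>2)" by (simp add: power2_eq_square algebra_simps flip: exp_add)
    finally show ?thesis .
  qed
  define E where "E = (\<lambda>z. L H1 z - L H2 z)"
  have holE: "E holomorphic_on UNIV" unfolding E_def by (intro holomorphic_on_diff holL hol)
  have grE: "norm (E z) \<le> (C1\<^sup>2 + C2\<^sup>2) * exp (pi * (norm z)\<^sup>2)" for z
    using norm_triangle_ineq4[of "L H1 z" "L H2 z"] grL[OF gr(1), of z] grL[OF gr(2), of z]
    by (simp add: E_def distrib_right)
  have real: "L H (of_real x) = of_real ((norm (H (of_real x * cis b)))\<^sup>2)" for H x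
    by (simp only: L_def complex_cnj_complex_of_real complex_norm_square)
  have zero: "E (of_real (a * real n powr \<nu>)) = 0" "E (- of_real (a * real n powr \<nu>)) = 0" for n :: nat
    using real[of _ "a * real n powr \<nu>"] real[of _ "- (a * real n powr \<nu>)"] eq[of n] by (simp_all add: E_def)
  have "E z = 0" for z
  proof (cases "\<nu> < 1 / 2")
    case True
    show ?thesis
      by (rule entire_zero_if_dense_power_zeros[OF holE grE _ a \<nu>(1) True zero(1)]) simp
  next
    case False
    then have [simp]: "\<nu> = 1 / 2" and a1: "a < 1" using \<nu> by auto
    show ?thesis
      by (rule entire_zero_if_sqrt_zeros[OF holE grE a a1]) (use zero in \<open>simp_all add: powr_half_sqrt\<close>)
  qed
  \<comment> \<open>Substituting \<open>z = w * cis (- b)\<close> turns the identity for the line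
    into one for the reflection in it.\<close>
  moreover have "w * cis (- b) * cis b = w" by (simp add: mult.assoc cis_mult)
  moreover have "cnj (w * cis (- b)) * cis b = cis (2 * b) * cnj w"
  proof -
    have "cis (2 * b) = cis b * cis b" by (simp add: cis_mult)
    then show ?thesis by (simp only: complex_cnj_mult cis_cnj minus_minus mult_ac)
  qed
  ultimately show ?thesis unfolding E_def L_def by (metis eq_iff_diff_eq_0)
qed

section \<open>Counterexamples built from functions of \<open>w\<^sup>2\<close>\<close>

text \<open>\<open>(x * cis (\<theta> - pi / 2))\<^sup>2\<close> is
  \<open>- x\<^sup>2 * cis (2 * \<theta>)\<close> whatever the sign of \<open>x\<close>, so one
  condition per \<open>n\<close> and line accounts for both samples. The last hypothesis excludes
  proportionality by any complex factor.\<close>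

lemma not_gabor_phase_retrievalI:
  fixes \<theta> :: "nat \<Rightarrow> real"
  assumes hol: "K1 holomorphic_on UNIV" "K2 holomorphic_on UNIV"
    and gr: "\<And>s. norm (K1 s) \<le> C1 * exp (c * norm s)" "\<And>s. norm (K2 s) \<le> C2 * exp (c * norm s)"
    and c: "0 < c" "c < pi / 2"
    and eq: "\<And>l n. l \<in> {1, 2} \<Longrightarrow> norm (K1 (- of_real ((a * real n powr \<nu>)\<^sup>2) * cis (2 * \<theta> l)))
        = norm (K2 (- of_real ((a * real n powr \<nu>)\<^sup>2) * cis (2 * \<theta> l)))"
    and ne: "\<And>u. (\<And>s. K1 s = u * K2 s) \<Longrightarrow> False"
  shows "\<not> does_gabor_phase_retrieval (\<Union>l\<in>{1, 2}. line_samples a \<nu> (\<theta> l))"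
proof
  assume does: "does_gabor_phase_retrieval (\<Union>l\<in>{1, 2}. line_samples a \<nu> (\<theta> l))"
  obtain f1 where f1: "f1 \<in> L2_real" "\<And>w. bargmann f1 w = K1 (w\<^sup>2)"
    using bargmann_surj_exp_type[OF hol(1) gr(1) c] by blast
  obtain f2 where f2: "f2 \<in> L2_real" "\<And>w. bargmann f2 w = K2 (w\<^sup>2)"
    using bargmann_surj_exp_type[OF hol(2) gr(2) c] by blast
  have sq: "(of_real x * cis (\<theta> l - pi / 2))\<^sup>2 = - of_real (x\<^sup>2) * cis (2 * \<theta> l)" for x l
  proof -
    have "(cis (\<theta> l - pi / 2))\<^sup>2 = - cis (2 * \<theta> l)"
      unfolding power2_eq_square cis_mult by (simp add: complex_eq_iff cos_diff sin_diff)
    then show ?thesis by (simp add: power_mult_distrib)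
  qed
  have "\<forall>(t, \<omega>)\<in>line_samples a \<nu> (\<theta> l). norm (bargmann f1 (Complex t (- \<omega>))) = norm (bargmann f2 (Complex t (- \<omega>)))"
    if "l \<in> {1, 2}" for l
    unfolding line_samples_ball_iff[where P = "\<lambda>z. norm (bargmann f1 z) = norm (bargmann f2 z)"]
  proof (intro allI)
    fix n :: nat
    show "norm (bargmann f1 (of_real (a * real n powr \<nu>) * cis (\<theta> l - pi / 2))) = norm (bargmann f2 (of_real (a * real n powr \<nu>) * cis (\<theta> l - pi / 2))) \<and>
        norm (bargmann f1 (- of_real (a * real n powr \<nu>) * cis (\<theta> l - pi / 2))) = norm (bargmann f2 (- of_real (a * real n powr \<nu>) * cis (\<theta> l - pi / 2)))"
      using eq[OF that, of n] unfolding f1(2) f2(2) mult_minus_left power2_minus sq by simp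
  qed
  then have "\<forall>(t, \<omega>)\<in>(\<Union>l\<in>{1, 2}. line_samples a \<nu> (\<theta> l)). norm (bargmann f1 (Complex t (- \<omega>))) = norm (bargmann f2 (Complex t (- \<omega>)))"
    by blast
  then obtain \<alpha> :: real where "\<And>w. bargmann f1 w = exp (\<i> * of_real \<alpha>) * bargmann f2 w"
    using does f1(1) f2(1) unfolding gabor_phase_retrieval_iff_bargmann by blast
  then have *: "K1 (w\<^sup>2) = exp (\<i> * of_real \<alpha>) * K2 (w\<^sup>2)" for w by (simp add: f1(2) f2(2))
  have "K1 s = exp (\<i> * of_real \<alpha>) * K2 s" for s using *[of "csqrt s"] by simp
  then show False by (rule ne)
qed

text \<open>The squared norms differ from \<open>(norm A)\<^sup>2 + (norm B)\<^sup>2\<close> by the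
  cross term \<open>2 * Im (A * cnj B)\<close>, taken with opposite signs.\<close>

lemma norm_add_sub_ii_eq: "Im (A * cnj B) = 0 \<Longrightarrow> norm (A + \<i> * B) = norm (A - \<i> * B)"
  unfolding cmod_def by (simp add: power2_eq_square algebra_simps)

text \<open>Once one ray of squared samples is rotated onto the negative real axis, the
  \<open>q\<close>-th power, \<open>q\<close> being a denominator of the angle over
  \<open>pi\<close>, is real on both rays. Adding \<i> or \<open>- \<i>\<close> to a real number
  gives the same modulus.\<close>

lemma not_gabor_phase_retrieval_rational_angle:
  fixes \<theta> :: "nat \<Rightarrow> real"
  assumes rat: "(\<theta> 1 - \<theta> 2) / pi \<in> \<rat>"
  shows "\<not> does_gabor_phase_retrieval (\<Union>l\<in>{1, 2}. line_samples a \<nu> (\<theta> l))"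
proof -
  obtain i :: int and q :: nat where q: "q \<noteq> 0" and iq: "(\<theta> 1 - \<theta> 2) / pi = of_int i / of_nat q"
    using rat unfolding Rats_eq_int_div_nat by auto
  define K where "K = (\<lambda>s. (s * cis (- (2 * \<theta> 1))) ^ q)"
  have rot: "real q * (2 * (\<theta> 2 - \<theta> 1)) = 2 * pi * of_int (- i)"
    using iq q by (simp add: field_simps)
  have Kreal: "K (- of_real y * cis (2 * \<theta> l)) = of_real ((- y) ^ q)" if "l \<in> {1, 2}" for y l
  proof -
    have "cis (2 * (\<theta> l - \<theta> 1)) ^ q = 1"
    proof (cases "l = 1")
      case False
      then have "cis (2 * (\<theta> l - \<theta> 1)) ^ q = cis (2 * pi * of_int (- i))"
        using that rot by (simp only: Complex.DeMoivre) auto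
      also have "\<dots> = 1" by (rule cis_multiple_2pi) auto
      finally show ?thesis .
    qed simp
    moreover have "- of_real y * cis (2 * \<theta> l) * cis (- (2 * \<theta> 1)) = of_real (- y) * cis (2 * (\<theta> l - \<theta> 1))"
      unfolding mult.assoc cis_mult by (simp add: algebra_simps)
    ultimately show ?thesis unfolding K_def by (simp only: power_mult_distrib of_real_power mult_1_right)
  qed
  \<comment> \<open>\<open>q ^ q\<close> comes from \<open>norm s / q \<le> exp (norm s / q)\<close>
    raised to the power \<open>q\<close>; the 1 pays for the added constant.\<close>
  define C where "C = real q ^ q + 1"
  have growth: "norm (K s + u) \<le> C * exp (1 * norm s)" if "norm u = 1" for s u
  proof -
    have "norm s / real q \<le> exp (norm s / real q)"
      using exp_ge_add_one_self[of "norm s / real q"] by linarith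
    then have "norm s \<le> real q * exp (norm s / real q)" using q by (simp add: field_simps)
    then have "norm s ^ q \<le> (real q * exp (norm s / real q)) ^ q" by (rule power_mono) simp
    also have "\<dots> = real q ^ q * exp (norm s)"
      using q by (simp add: power_mult_distrib flip: exp_of_nat_mult)
    finally have "norm (K s) \<le> real q ^ q * exp (norm s)" by (simp add: K_def norm_mult norm_power)
    moreover have "norm (K s + u) \<le> norm (K s) + 1" using norm_triangle_ineq[of "K s" u] that by simp
    moreover have "1 \<le> exp (norm s)" by simp
    ultimately show ?thesis unfolding C_def distrib_right mult_1_left by linarith
  qed
  have hK: "K holomorphic_on UNIV" unfolding K_def by (intro holomorphic_intros)
  show ?thesis
  proof (rule not_gabor_phase_retrievalI[where c = 1 and ?C1.0 = C and ?C2.0 = C])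
    show "(\<lambda>s. K s + \<i>) holomorphic_on UNIV" "(\<lambda>s. K s + (- \<i>)) holomorphic_on UNIV"
      using hK by (auto intro!: holomorphic_intros)
    show "norm (K (- of_real ((a * real n powr \<nu>)\<^sup>2) * cis (2 * \<theta> l)) + \<i>)
        = norm (K (- of_real ((a * real n powr \<nu>)\<^sup>2) * cis (2 * \<theta> l)) + (- \<i>))" if "l \<in> {1, 2}" for l n
      unfolding Kreal[OF that] by (simp add: cmod_def)
    show False if u: "\<And>s. K s + \<i> = u * (K s + (- \<i>))" for u
    proof -
      have "K 0 = 0" using q by (simp add: K_def)
      then have "u = - 1" using u[of 0] by (simp add: complex_eq_iff)
      moreover have "K (cis (2 * \<theta> 1)) = 1" by (simp add: K_def cis_mult)
      ultimately show False using u[of "cis (2 * \<theta> 1)"] by (simp add: complex_eq_iff)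
    qed
  qed (use growth[where u = \<i>] growth[where u = "- \<i>"] pi_gt3 in auto)
qed

lemma not_gabor_phase_retrieval_sparse:
  fixes \<theta> :: "nat \<Rightarrow> real"
  assumes a: "a > 0" and \<nu>: "\<nu> > 1 / 2"
  shows "\<not> does_gabor_phase_retrieval (\<Union>l\<in>{1, 2}. line_samples a \<nu> (\<theta> l))"
proof -
  \<comment> \<open>Indexing by \<open>Suc n\<close> leaves out the sample at the origin, where a
    product normalized by \<open>P 0 = 1\<close> cannot vanish; the factor \<open>s\<close> in
    \<Phi> takes care of it.\<close>
  define x where "x = (\<lambda>l n. - complex_of_real ((a * real (Suc n) powr \<nu>)\<^sup>2) * cis (2 * \<theta> l))"
  have x0: "x l n \<noteq> 0" for l n using a by (simp add: x_def)
  have "summable (\<lambda>n. real n powr (- (2 * \<nu>)))"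
    using \<nu> by (simp add: summable_real_powr_iff)
  then have "summable (\<lambda>n. real (Suc n) powr (- (2 * \<nu>)))"
    by (subst summable_Suc_iff)
  then have s0: "summable (\<lambda>n. 1 / a\<^sup>2 * real (Suc n) powr (- (2 * \<nu>)))"
    by (rule summable_mult)
  have "1 / norm (x l n) = 1 / a\<^sup>2 * real (Suc n) powr (- (2 * \<nu>))" for l n
  proof -
    have "norm (x l n) = (a * real (Suc n) powr \<nu>)\<^sup>2"
      unfolding x_def norm_mult norm_minus_cancel norm_of_real norm_cis by simp
    also have "\<dots> = a\<^sup>2 * real (Suc n) powr (2 * \<nu>)"
      by (simp add: power_mult_distrib power2_eq_square flip: powr_add)
    finally show ?thesis by (simp add: powr_minus_divide)
  qed
  with s0 have xs: "summable (\<lambda>n. 1 / norm (x l n))" for l by simp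
  \<comment> \<open>The rates 1/4 for each of the two products and 1/2 for the factor
    \<open>s\<close> add up to 1, which is below \<open>pi / 2\<close>.\<close>
  have "\<exists>P. P holomorphic_on UNIV \<and> P 0 = 1 \<and> (\<forall>n. P (x l n) = 0) \<and> (\<exists>C. \<forall>s. norm (P s) \<le> C * exp (1/4 * norm s))" for l
    using entire_with_zeros_exp_type_zero[of "x l", OF x0 xs] by (metis zero_less_divide_1_iff zero_less_numeral)
  then obtain P where P: "\<And>l. P l holomorphic_on UNIV" "\<And>l. P l 0 = 1" "\<And>l n. P l (x l n) = 0"
    and "\<And>l. \<exists>C. \<forall>s. norm (P l s) \<le> C * exp (1/4 * norm s)" by metis
  then obtain C where C: "\<And>l s. norm (P l s) \<le> C l * exp (1/4 * norm s)" by metis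
  define \<Phi> where "\<Phi> = (\<lambda>s. s * (P 1 s * P 2 s))"
  have gr: "norm (1 + \<Phi> s) \<le> (1 + 2 * (C 1 * C 2)) * exp (1 * norm s)" for s
  proof -
    have C0: "0 \<le> C l" for l using order_trans[OF norm_ge_zero C[of l 0]] by simp
    have "norm s / 2 \<le> exp (norm s / 2)" using exp_ge_add_one_self[of "norm s / 2"] by linarith
    then have s: "norm s \<le> 2 * exp (norm s / 2)" by simp
    have "norm (\<Phi> s) \<le> (2 * exp (norm s / 2)) * ((C 1 * exp (1/4 * norm s)) * (C 2 * exp (1/4 * norm s)))"
      unfolding \<Phi>_def norm_mult using s C C0 by (intro mult_mono) auto
    also have "\<dots> = 2 * (C 1 * C 2) * exp (norm s)"
      by (simp add: mult_ac flip: exp_add)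
    finally have "norm (\<Phi> s) \<le> 2 * (C 1 * C 2) * exp (norm s)" .
    moreover have "norm (1 + \<Phi> s) \<le> 1 + norm (\<Phi> s)" using norm_triangle_ineq[of 1 "\<Phi> s"] by simp
    moreover have "1 \<le> exp (norm s)" by simp
    ultimately show ?thesis unfolding distrib_right mult_1_left by linarith
  qed
  have zero: "\<Phi> (- of_real ((a * real n powr \<nu>)\<^sup>2) * cis (2 * \<theta> l)) = 0" if "l \<in> {1, 2}" for l n
  proof (cases n)
    case 0
    then show ?thesis using \<nu> by (simp add: \<Phi>_def)
  next
    case (Suc m)
    then show ?thesis using P(3)[of l m] that unfolding x_def \<Phi>_def by auto
  qed
  show ?thesis
  proof (rule not_gabor_phase_retrievalI[where c = 1 and ?K2.0 = "\<lambda>_. 1" and ?C2.0 = 1])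
    show "(\<lambda>s. 1 + \<Phi> s) holomorphic_on UNIV"
      unfolding \<Phi>_def using P by (intro holomorphic_intros)
    show "norm (1 + \<Phi> (- of_real ((a * real n powr \<nu>)\<^sup>2) * cis (2 * \<theta> l))) = norm (1::complex)" if "l \<in> {1, 2}" for l n
      unfolding zero[OF that] by simp
    show False if u: "\<And>s. 1 + \<Phi> s = u * 1" for u
    proof -
      have "u = 1" using u[of 0] by (simp add: \<Phi>_def)
      with u have \<Phi>0: "\<Phi> s = 0" for s by simp
      obtain r1 where r1: "r1 > 0" "\<And>z. 0 < norm z \<Longrightarrow> norm z < r1 \<Longrightarrow> P 1 z \<noteq> 0"
        using entire_nonzero_punctured_disc[OF P(1), of 1 0] P(2)[of 1] by auto
      obtain r2 where r2: "r2 > 0" "\<And>z. 0 < norm z \<Longrightarrow> norm z < r2 \<Longrightarrow> P 2 z \<noteq> 0"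
        using entire_nonzero_punctured_disc[OF P(1), of 2 0] P(2)[of 2] by auto
      define z where "z = complex_of_real (min r1 r2 / 2)"
      have "norm z = min r1 r2 / 2" unfolding z_def norm_of_real using r1 r2 by simp
      then have "0 < norm z" "norm z < r1" "norm z < r2" using r1(1) r2(1) by auto
      then have "\<Phi> z \<noteq> 0" using r1(2)[of z] r2(2)[of z] by (auto simp: \<Phi>_def)
      then show False using \<Phi>0 by simp
    qed
  qed (use gr pi_gt3 in auto)
qed

lemma not_gabor_phase_retrieval_chirps:
  fixes \<theta> :: "nat \<Rightarrow> real"
  assumes a: "a > 0" and S: "\<bar>S\<bar> > 1 / a\<^sup>2" and \<psi>: "\<And>l. l \<in> {1, 2} \<Longrightarrow> sin (\<psi> + 2 * \<theta> l) \<in> {0, S, - S}"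
  shows "\<not> does_gabor_phase_retrieval (\<Union>l\<in>{1, 2}. line_samples a (1 / 2) (\<theta> l))"
proof -
  have S0: "\<bar>S\<bar> > 0" using S a by (smt (verit) zero_less_divide_1_iff zero_less_power)
  \<comment> \<open>With this modulus of \<delta>, \<open>Im (\<delta> * s)\<close> at the
    \<open>n\<close>-th sample is \<open>- n * pi\<close> times a sine divided by
    \<open>\<bar>S\<bar>\<close>, and that quotient is 0, 1 or -1.\<close>
  define r where "r = pi / (a\<^sup>2 * \<bar>S\<bar>)"
  have r: "0 < r" "r < pi"
  proof -
    show "0 < r" using a S0 by (simp add: r_def)
    have "1 < a\<^sup>2 * \<bar>S\<bar>" using S a by (simp add: field_simps)
    then have "pi / (a\<^sup>2 * \<bar>S\<bar>) < pi / 1" by (intro divide_strict_left_mono) auto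
    then show "r < pi" by (simp add: r_def)
  qed
  define \<delta> where "\<delta> = of_real r * cis \<psi>"
  have n\<delta>: "norm \<delta> = r" using r by (simp add: \<delta>_def norm_mult)
  have int: "\<exists>k::int. a\<^sup>2 * Im (\<delta> * cis (2 * \<theta> l)) = pi * of_int k" if "l \<in> {1, 2}" for l
  proof -
    have "Im (\<delta> * cis (2 * \<theta> l)) = r * sin (\<psi> + 2 * \<theta> l)"
      unfolding \<delta>_def mult.assoc cis_mult by simp
    then have eq: "a\<^sup>2 * Im (\<delta> * cis (2 * \<theta> l)) = pi / \<bar>S\<bar> * sin (\<psi> + 2 * \<theta> l)"
      using a by (simp add: r_def)
    from \<psi>[OF that] consider "sin (\<psi> + 2 * \<theta> l) = 0" | "sin (\<psi> + 2 * \<theta> l) = \<bar>S\<bar>" | "sin (\<psi> + 2 * \<theta> l) = - \<bar>S\<bar>"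
      by (cases "S \<ge> 0") auto
    then show ?thesis
    proof cases
      case 1
      then show ?thesis unfolding eq by (intro exI[of _ 0]) simp
    next
      case 2
      then show ?thesis unfolding eq using S0 by (intro exI[of _ 1]) simp
    next
      case 3
      then show ?thesis unfolding eq using S0 by (intro exI[of _ "-1"]) simp
    qed
  qed
  define A where "A = (\<lambda>s. exp (\<delta> / 2 * s))"
  define B where "B = (\<lambda>s. exp (- (\<delta> / 2 * s)))"
  have nA: "norm (A s) \<le> exp (r / 2 * norm s)" and nB: "norm (B s) \<le> exp (r / 2 * norm s)" for s
    using norm_exp[of "\<delta> / 2 * s"] norm_exp[of "- (\<delta> / 2 * s)"] n\<delta>
    by (simp_all add: A_def B_def norm_mult norm_divide)
  have modulus: "norm (A s + \<i> * B s) = norm (A s - \<i> * B s)"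
    if l: "l \<in> {1, 2}" and s: "s = - of_real ((a * real n powr (1 / 2))\<^sup>2) * cis (2 * \<theta> l)" for l n s
  proof (rule norm_add_sub_ii_eq)
    obtain k :: int where k: "a\<^sup>2 * Im (\<delta> * cis (2 * \<theta> l)) = pi * of_int k" using int[OF l] by blast
    have "(a * real n powr (1 / 2))\<^sup>2 = a\<^sup>2 * real n" by (simp add: power_mult_distrib powr_half_sqrt)
    then have "\<delta> * s = - of_real (a\<^sup>2 * real n) * (\<delta> * cis (2 * \<theta> l))" by (simp add: s)
    then have Im_eq: "Im (\<delta> * s) = - real n * (a\<^sup>2 * Im (\<delta> * cis (2 * \<theta> l)))" by simp
    have Im: "Im (\<delta> * s) = of_int (- int n * k) * pi" unfolding Im_eq k by simp
    have "A s * cnj (B s) = exp (\<delta> / 2 * s - cnj (\<delta> / 2 * s))"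
      unfolding A_def B_def by (simp add: exp_cnj flip: exp_add)
    also have "\<delta> / 2 * s - cnj (\<delta> / 2 * s) = \<i> * of_real (Im (\<delta> * s))"
      by (simp add: complex_eq_iff field_simps)
    finally have "Im (A s * cnj (B s)) = sin (Im (\<delta> * s))" by (simp add: Im_exp)
    also have "\<dots> = 0" unfolding Im sin_times_pi_eq_0 by (rule Ints_of_int)
    finally show "Im (A s * cnj (B s)) = 0" .
  qed
  show ?thesis
  proof (rule not_gabor_phase_retrievalI[where c = "r / 2" and ?C1.0 = 2 and ?C2.0 = 2])
    show "(\<lambda>s. A s + \<i> * B s) holomorphic_on UNIV" "(\<lambda>s. A s - \<i> * B s) holomorphic_on UNIV"
      unfolding A_def B_def by (intro holomorphic_intros)+
    show "norm (A s + \<i> * B s) \<le> 2 * exp (r / 2 * norm s)" "norm (A s - \<i> * B s) \<le> 2 * exp (r / 2 * norm s)" for s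
      using norm_triangle_ineq[of "A s" "\<i> * B s"] norm_triangle_ineq4[of "A s" "\<i> * B s"] nA[of s] nB[of s]
      by (simp_all add: norm_mult)
    show "norm (A (- of_real ((a * real n powr (1 / 2))\<^sup>2) * cis (2 * \<theta> l)) + \<i> * B (- of_real ((a * real n powr (1 / 2))\<^sup>2) * cis (2 * \<theta> l)))
        = norm (A (- of_real ((a * real n powr (1 / 2))\<^sup>2) * cis (2 * \<theta> l)) - \<i> * B (- of_real ((a * real n powr (1 / 2))\<^sup>2) * cis (2 * \<theta> l)))"
      if "l \<in> {1, 2}" for l n
      by (rule modulus[OF that refl])
    show False if u: "\<And>s. A s + \<i> * B s = u * (A s - \<i> * B s)" for u
    proof -
      \<comment> \<open>The value at 0 makes the factor \<i>; at \<open>1 / \<delta>\<close> this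
        would force \<open>exp (1 / 2) = exp (- (1 / 2))\<close>.\<close>
      have "1 + \<i> = u * (1 - \<i>)" using u[of 0] by (simp add: A_def B_def)
      moreover have "\<i> * (1 - \<i>) = 1 + \<i>" by (simp add: algebra_simps)
      ultimately have ui: "u = \<i>" by (metis complex_i_not_one eq_iff_diff_eq_0 mult_right_cancel)
      have d0: "\<delta> \<noteq> 0" using n\<delta> r by auto
      have "A (1 / \<delta>) = of_real (exp (1 / 2))" "B (1 / \<delta>) = of_real (exp (- (1 / 2)))"
        using d0 by (simp_all add: A_def B_def flip: exp_of_real)
      then have "Re (of_real (exp (1 / 2)) + \<i> * of_real (exp (- (1 / 2)))) = Re (\<i> * (of_real (exp (1 / 2)) - \<i> * of_real (exp (- (1 / 2)))))"
        using u[of "1 / \<delta>"] ui by simp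
      then have "exp (1 / 2) = exp (- (1 / 2) :: real)" by simp
      then show False by simp
    qed
  qed (use r in auto)
qed

theorem theorem1p3:
  fixes a \<nu> t0 \<omega>0 :: real and \<theta> :: "nat \<Rightarrow> real" and \<Lambda> :: "(real \<times> real) set"
  assumes "a > 0" and "\<nu> > 0"
    and "\<theta> 1 \<in> {0..2 * pi}" and "\<theta> 2 \<in> {0..2 * pi}"
    and "\<Lambda> = (\<Union>l\<in>{1, 2}. (\<lambda>p. (t0, \<omega>0) + p) ` line_samples a \<nu> (\<theta> l))"
  shows "((\<theta> 1 - \<theta> 2) / pi \<notin> \<rat> \<and> (\<nu> < 1/2 \<or> \<nu> = 1/2 \<and> a < 1)
            \<longrightarrow> does_gabor_phase_retrieval \<Lambda>) \<and>
         ((\<theta> 1 - \<theta> 2) / pi \<in> \<rat>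
          \<or> \<nu> > 1/2
          \<or> \<nu> = 1/2 \<and> a > 1 \<and> \<bar>cos (\<theta> 1 - \<theta> 2)\<bar> > 1 / a\<^sup>2
          \<or> \<nu> = 1/2 \<and> a > 1 \<and> \<bar>sin (\<theta> 1 - \<theta> 2)\<bar> > 1 / a\<^sup>2
          \<or> \<nu> = 1/2 \<and> a > 1 \<and> \<bar>sin (2 * \<theta> 1 - 2 * \<theta> 2)\<bar> > 1 / a\<^sup>2
            \<longrightarrow> \<not> does_gabor_phase_retrieval \<Lambda>)"
proof -
  define \<Lambda>0 where "\<Lambda>0 = (\<Union>l\<in>{1, 2}. line_samples a \<nu> (\<theta> l))"
  have "\<Lambda> = (\<lambda>p. (t0, \<omega>0) + p) ` \<Lambda>0" unfolding assms(5) \<Lambda>0_def by (simp only: image_UN)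
  then have reduce: "does_gabor_phase_retrieval \<Lambda> \<longleftrightarrow> does_gabor_phase_retrieval \<Lambda>0"
    by (simp only: gabor_phase_retrieval_translate_iff)
  have pos: "does_gabor_phase_retrieval \<Lambda>0"
    if irr: "(\<theta> 1 - \<theta> 2) / pi \<notin> \<rat>" and \<nu>: "\<nu> < 1/2 \<or> \<nu> = 1/2 \<and> a < 1"
    unfolding gabor_phase_retrieval_iff_bargmann
  proof (intro ballI impI)
    fix f1 f2
    assume f: "f1 \<in> L2_real" "f2 \<in> L2_real"
      and eq: "\<forall>(t, \<omega>)\<in>\<Lambda>0. norm (bargmann f1 (Complex t (- \<omega>))) = norm (bargmann f2 (Complex t (- \<omega>)))"
    obtain C1 where C1: "\<And>w. norm (bargmann f1 w) \<le> C1 * exp (pi / 2 * (norm w)\<^sup>2)"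
      using bargmann_growth[OF f(1)] by blast
    obtain C2 where C2: "\<And>w. norm (bargmann f2 w) \<le> C2 * exp (pi / 2 * (norm w)\<^sup>2)"
      using bargmann_growth[OF f(2)] by blast
    show "\<exists>\<alpha>::real. \<forall>w. bargmann f1 w = exp (\<i> * of_real \<alpha>) * bargmann f2 w"
    proof (rule unimodular_multiple_if_reflected_products_eq)
      \<comment> \<open>The quarter turns cancel in the difference of the two directions.\<close>
      show "((\<theta> 1 - pi / 2) - (\<theta> 2 - pi / 2)) / pi \<notin> \<rat>" using irr by simp
      fix b w assume "b \<in> {\<theta> 1 - pi / 2, \<theta> 2 - pi / 2}"
      then obtain l where l: "l \<in> {1, 2}" "b = \<theta> l - pi / 2" by blast
      have "\<forall>(t, \<omega>)\<in>line_samples a \<nu> (\<theta> l). norm (bargmann f1 (Complex t (- \<omega>))) = norm (bargmann f2 (Complex t (- \<omega>)))"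
        using eq l(1) unfolding \<Lambda>0_def by blast
      then show "bargmann f1 w * cnj (bargmann f1 (cis (2 * b) * cnj w)) = bargmann f2 w * cnj (bargmann f2 (cis (2 * b) * cnj w))"
        unfolding line_samples_ball_iff[where P = "\<lambda>z. norm (bargmann f1 z) = norm (bargmann f2 z)"] l(2)
        by (intro reflected_product_eq_if_samples_eq[OF holomorphic_bargmann[OF f(1)] holomorphic_bargmann[OF f(2)] C1 C2 assms(1,2) \<nu>]) blast+
    qed (intro holomorphic_bargmann f)+
  qed
  have neg_chirps: "\<not> does_gabor_phase_retrieval \<Lambda>0"
    if "\<nu> = 1/2" "\<bar>S\<bar> > 1 / a\<^sup>2" "sin (\<psi> + 2 * \<theta> 1) \<in> {0, S, - S}" "sin (\<psi> + 2 * \<theta> 2) \<in> {0, S, - S}" for S \<psi>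
    unfolding \<Lambda>0_def that(1) by (rule not_gabor_phase_retrieval_chirps[OF assms(1) that(2), of \<psi>]) (use that in auto)
  have neg: "\<not> does_gabor_phase_retrieval \<Lambda>0"
    if "(\<theta> 1 - \<theta> 2) / pi \<in> \<rat>
          \<or> \<nu> > 1/2
          \<or> \<nu> = 1/2 \<and> a > 1 \<and> \<bar>cos (\<theta> 1 - \<theta> 2)\<bar> > 1 / a\<^sup>2
          \<or> \<nu> = 1/2 \<and> a > 1 \<and> \<bar>sin (\<theta> 1 - \<theta> 2)\<bar> > 1 / a\<^sup>2
          \<or> \<nu> = 1/2 \<and> a > 1 \<and> \<bar>sin (2 * \<theta> 1 - 2 * \<theta> 2)\<bar> > 1 / a\<^sup>2"
    using that
  proof (elim disjE conjE)
    assume "(\<theta> 1 - \<theta> 2) / pi \<in> \<rat>"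
    then show ?thesis unfolding \<Lambda>0_def by (rule not_gabor_phase_retrieval_rational_angle)
  next
    assume "\<nu> > 1/2"
    then show ?thesis unfolding \<Lambda>0_def by (rule not_gabor_phase_retrieval_sparse[OF assms(1)])
  next
    assume *: "\<nu> = 1/2" "\<bar>cos (\<theta> 1 - \<theta> 2)\<bar> > 1 / a\<^sup>2"
    have sin_compl: "sin (pi / 2 - x) = cos x" for x :: real by (simp add: sin_diff)
    \<comment> \<open>This \<psi> places the two angles symmetrically about \<open>pi / 2\<close>,
      so that both sines equal the cosine in the hypothesis.\<close>
    have "pi / 2 - \<theta> 1 - \<theta> 2 + 2 * \<theta> 1 = pi / 2 - (\<theta> 2 - \<theta> 1)" "pi / 2 - \<theta> 1 - \<theta> 2 + 2 * \<theta> 2 = pi / 2 - (\<theta> 1 - \<theta> 2)"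
      by simp_all
    then have "sin (pi / 2 - \<theta> 1 - \<theta> 2 + 2 * \<theta> 1) = cos (\<theta> 1 - \<theta> 2)" "sin (pi / 2 - \<theta> 1 - \<theta> 2 + 2 * \<theta> 2) = cos (\<theta> 1 - \<theta> 2)"
      using cos_minus[of "\<theta> 1 - \<theta> 2"] sin_compl by (simp_all only: minus_diff_eq)
    then show ?thesis by (intro neg_chirps[OF *, of "pi / 2 - \<theta> 1 - \<theta> 2"]) auto
  next
    assume *: "\<nu> = 1/2" "\<bar>sin (\<theta> 1 - \<theta> 2)\<bar> > 1 / a\<^sup>2"
    \<comment> \<open>With the two angles symmetric about 0 the sines are opposite.\<close>
    have "- \<theta> 1 - \<theta> 2 + 2 * \<theta> 1 = \<theta> 1 - \<theta> 2" "- \<theta> 1 - \<theta> 2 + 2 * \<theta> 2 = - (\<theta> 1 - \<theta> 2)"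
      by simp_all
    then have "sin (- \<theta> 1 - \<theta> 2 + 2 * \<theta> 1) = sin (\<theta> 1 - \<theta> 2)" "sin (- \<theta> 1 - \<theta> 2 + 2 * \<theta> 2) = - sin (\<theta> 1 - \<theta> 2)"
      by (simp_all only: sin_minus)
    then show ?thesis by (intro neg_chirps[OF *, of "- \<theta> 1 - \<theta> 2"]) auto
  next
    assume *: "\<nu> = 1/2" "\<bar>sin (2 * \<theta> 1 - 2 * \<theta> 2)\<bar> > 1 / a\<^sup>2"
    \<comment> \<open>Here the second angle is 0, where the sine vanishes, and the first is twice
      the angle between the lines.\<close>
    have "- (2 * \<theta> 2) + 2 * \<theta> 1 = 2 * \<theta> 1 - 2 * \<theta> 2" "- (2 * \<theta> 2) + 2 * \<theta> 2 = 0" by simp_all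
    then have "sin (- (2 * \<theta> 2) + 2 * \<theta> 1) = sin (2 * \<theta> 1 - 2 * \<theta> 2)" "sin (- (2 * \<theta> 2) + 2 * \<theta> 2) = 0"
      by (simp_all only: sin_zero)
    then show ?thesis by (intro neg_chirps[OF *, of "- (2 * \<theta> 2)"]) auto
  qed
  show ?thesis unfolding reduce using pos neg by blast
qed

end
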